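(* Let $V$ be an $n$-dimensional left vector space over a division ring $K$, $2\le n<\infty$, let $k\in\{1,\dots,n-1\}$, and let $\mathcal G=\{(S,U)\in\mathcal G_k\times\mathcal G_{n-k}\mid S+U=V\}$. Every adjacency preserving transformation of $\mathcal G$ is one of the following mappings: (1) the restriction to $\mathcal G$ of $G_k(l)\times G_{n-k}(l)$ for some semilinear isomorphism $l:V\to V$; (2) the restriction to $\mathcal G$ of $D_k(s)\mathbin{\dot\times} D_{n-k}(s)$ for some semilinear isomorphism $s:V\to V^*$; (3) only when $n=2k$: the restriction to $\mathcal G$ of $G_k(l)\mathbin{\dot\times}G_k(l)$ for some semilinear isomorphism $l:V\to V$, or of $D_k(s)\times D_k(s)$ for some semilinear isomorphism $s:V\to V^*$; (4) only when $n=2$ and $k=1$: the restriction to $\mathcal G$ of $f\times f$ or of $f\mathbin{\dot\times}f$ for some bijection $f:\mathcal G_1\to\mathcal G_1$. Hence every adjacency preserving transformation of $\mathcal G$ is a closeness preserving transformation of $\mathcal G$.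
   Context: $\mathcal G_i$ denotes the set of all $i$-dimensional subspaces of $V$. Subspaces $P,T$ of $V$ are adjacent, $P\sim T$, if $\dim P=\dim T=\dim(P\cap T)+1$. Elements $(S,U),(S',U')\in\mathcal G$ are adjacent if ($S=S'$ and $U\sim U'$) or ($S\sim S'$ and $U=U'$); they are close if ($S=S'$ and $U\ne U'$) or ($S\neq S'$ and $U=U'$). A bijection $f:\mathcal G\to\mathcal G$ is an adjacency preserving (respectively closeness preserving) transformation if both $f$ and $f^{-1}$ map adjacent (respectively close) elements to adjacent (respectively close) elements. For maps $f':\mathcal G_k\to\mathcal G_k$, $f'':\mathcal G_{n-k}\to\mathcal G_{n-k}$, the map $f'\times f''$ on $\mathcal G_k\times\mathcal G_{n-k}$ is $(S,U)\mapsto(f'(S),f''(U))$. For maps $g':\mathcal G_k\to\mathcal G_{n-k}$, $g'':\mathcal G_{n-k}\to\mathcal G_k$, the map $g'\mathbin{\dot\times}g''$ on $\mathcal G_k\times\mathcal G_{n-k}$ is $(S,U)\mapsto(g''(U),g'(S))$. A semilinear isomorphism $l:V\to V$ is an additive bijection with $l(av)=\sigma(a)l(v)$ for some automorphism $\sigma$ of $K$. $V^*$ is the dual space of $V$ (a right vector space over $K$); a semilinear isomorphism $s:V\to V^*$ is an additive bijection with $s(av)=s(v)\tau(a)$ for some anti-automorphism $\tau$ of $K$. For $1\le i\le n-1$, $G_i(l):\mathcal G_i\to\mathcal G_i$ is $S\mapsto l(S)$, and $D_i(s):\mathcal G_i\to\mathcal G_{n-i}$ is $S\mapsto (s(S))^\circ$,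 where $(s(S))^\circ\subset V$ is the annihilator of $s(S)$, i.e. the set of vectors on which all functionals in $s(S)$ vanish. *)

theory Defs
  imports Main
begin

text \<open>
  The locales \<open>module\<close> and \<open>vector_space\<close> of HOL ask for commutative scalars, so left vector spaces
  over a division ring are introduced here.  The space V is the whole type of vectors.
\<close>

locale left_vector_space =
  fixes scale :: "'k::division_ring \<Rightarrow> 'v::ab_group_add \<Rightarrow> 'v"
  assumes scale_right_distrib: "scale a (x + y) = scale a x + scale a y"
    and scale_left_distrib: "scale (a + b) x = scale a x + scale b x"
    and scale_scale: "scale a (scale b x) = scale (a * b) x"
    and scale_one: "scale 1 x = x"

definition is_subspace :: "('k::division_ring \<Rightarrow> 'v::ab_group_add \<Rightarrow> 'v) \<Rightarrow> 'v set \<Rightarrow> bool" where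
  "is_subspace scale S \<longleftrightarrow>
     0 \<in> S \<and> (\<forall>x\<in>S. \<forall>y\<in>S. x + y \<in> S) \<and> (\<forall>a. \<forall>x\<in>S. scale a x \<in> S)"

definition is_basis ::
    "('k::division_ring \<Rightarrow> 'v::ab_group_add \<Rightarrow> 'v) \<Rightarrow> 'v set \<Rightarrow> 'v set \<Rightarrow> bool" where
  "is_basis scale B S \<longleftrightarrow>
     finite B \<and>
     S = range (\<lambda>c. \<Sum>b\<in>B. scale (c b) b) \<and>
     (\<forall>c. (\<Sum>b\<in>B. scale (c b) b) = 0 \<longrightarrow> (\<forall>b\<in>B. c b = 0))"

text \<open>
  Dimension is a relation, so that no value is assigned to spaces of infinite dimension.
\<close>

definition has_dim ::
    "('k::division_ring \<Rightarrow> 'v::ab_group_add \<Rightarrow> 'v) \<Rightarrow> 'v set \<Rightarrow> nat \<Rightarrow> bool" where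
  "has_dim scale S d \<longleftrightarrow> (\<exists>B. is_basis scale B S \<and> card B = d)"

definition grassmannian ::
    "('k::division_ring \<Rightarrow> 'v::ab_group_add \<Rightarrow> 'v) \<Rightarrow> nat \<Rightarrow> 'v set set" where
  "grassmannian scale i = {S. is_subspace scale S \<and> has_dim scale S i}"

definition complementary_pairs ::
    "('k::division_ring \<Rightarrow> 'v::ab_group_add \<Rightarrow> 'v) \<Rightarrow> nat \<Rightarrow> nat \<Rightarrow> ('v set \<times> 'v set) set" where
  "complementary_pairs scale n k =
     {(S, U). S \<in> grassmannian scale k \<and> U \<in> grassmannian scale (n - k) \<and>
              {x + y | x y. x \<in> S \<and> y \<in> U} = UNIV}"

definition adjacent_subspaces ::
    "('k::division_ring \<Rightarrow> 'v::ab_group_add \<Rightarrow> 'v) \<Rightarrow> 'v set \<Rightarrow> 'v set \<Rightarrow> bool" where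
  "adjacent_subspaces scale P T \<longleftrightarrow>
     (\<exists>d. has_dim scale P (d + 1) \<and> has_dim scale T (d + 1) \<and> has_dim scale (P \<inter> T) d)"

definition adjacent_pairs ::
    "('k::division_ring \<Rightarrow> 'v::ab_group_add \<Rightarrow> 'v) \<Rightarrow> 'v set \<times> 'v set \<Rightarrow> 'v set \<times> 'v set \<Rightarrow> bool" where
  "adjacent_pairs scale = (\<lambda>(S, U) (S', U').
     S = S' \<and> adjacent_subspaces scale U U' \<or> adjacent_subspaces scale S S' \<and> U = U')"

definition close_pairs :: "'v set \<times> 'v set \<Rightarrow> 'v set \<times> 'v set \<Rightarrow> bool" where
  "close_pairs = (\<lambda>(S, U) (S', U'). S = S' \<and> U \<noteq> U' \<or> S \<noteq> S' \<and> U = U')"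

definition preserving_transformation :: "('a \<Rightarrow> 'a \<Rightarrow> bool) \<Rightarrow> 'a set \<Rightarrow> ('a \<Rightarrow> 'a) \<Rightarrow> bool" where
  "preserving_transformation R A f \<longleftrightarrow>
     bij_betw f A A \<and>
     (\<forall>x\<in>A. \<forall>y\<in>A. R x y \<longrightarrow> R (f x) (f y)) \<and>
     (\<forall>x\<in>A. \<forall>y\<in>A. R x y \<longrightarrow> R (inv_into A f x) (inv_into A f y))"

definition ring_automorphism :: "('k::division_ring \<Rightarrow> 'k) \<Rightarrow> bool" where
  "ring_automorphism \<sigma> \<longleftrightarrow>
     bij \<sigma> \<and> \<sigma> 1 = 1 \<and> (\<forall>a b. \<sigma> (a + b) = \<sigma> a + \<sigma> b) \<and> (\<forall>a b. \<sigma> (a * b) = \<sigma> a * \<sigma> b)"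

definition ring_antiautomorphism :: "('k::division_ring \<Rightarrow> 'k) \<Rightarrow> bool" where
  "ring_antiautomorphism \<tau> \<longleftrightarrow>
     bij \<tau> \<and> \<tau> 1 = 1 \<and> (\<forall>a b. \<tau> (a + b) = \<tau> a + \<tau> b) \<and> (\<forall>a b. \<tau> (a * b) = \<tau> b * \<tau> a)"

definition semilinear_iso ::
    "('k::division_ring \<Rightarrow> 'v::ab_group_add \<Rightarrow> 'v) \<Rightarrow> ('v \<Rightarrow> 'v) \<Rightarrow> bool" where
  "semilinear_iso scale l \<longleftrightarrow>
     bij l \<and> (\<forall>x y. l (x + y) = l x + l y) \<and>
     (\<exists>\<sigma>. ring_automorphism \<sigma> \<and> (\<forall>a x. l (scale a x) = scale (\<sigma> a) (l x)))"

definition dual_space ::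
    "('k::division_ring \<Rightarrow> 'v::ab_group_add \<Rightarrow> 'v) \<Rightarrow> ('v \<Rightarrow> 'k) set" where
  "dual_space scale =
     {\<phi>. (\<forall>x y. \<phi> (x + y) = \<phi> x + \<phi> y) \<and> (\<forall>a x. \<phi> (scale a x) = a * \<phi> x)}"

text \<open>
  The dual space is a right vector space: addition is pointwise and the multiple of \<open>\<phi>\<close> by \<open>a\<close> is
  the functional \<open>\<lambda>w. \<phi> w * a\<close>.
\<close>

definition semilinear_iso_dual ::
    "('k::division_ring \<Rightarrow> 'v::ab_group_add \<Rightarrow> 'v) \<Rightarrow> ('v \<Rightarrow> 'v \<Rightarrow> 'k) \<Rightarrow> bool" where
  "semilinear_iso_dual scale s \<longleftrightarrow>
     bij_betw s UNIV (dual_space scale) \<and> (\<forall>x y. s (x + y) = (\<lambda>w. s x w + s y w)) \<and>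
     (\<exists>\<tau>. ring_antiautomorphism \<tau> \<and> (\<forall>a x. s (scale a x) = (\<lambda>w. s x w * \<tau> a)))"

definition annihilator :: "('v \<Rightarrow> 'k::division_ring) set \<Rightarrow> 'v set" where
  "annihilator \<Phi> = {v. \<forall>\<phi>\<in>\<Phi>. \<phi> v = 0}"

text \<open>
  The maps \<open>G\<^sub>i(l)\<close> and \<open>D\<^sub>i(s)\<close> are given by the same formula for every \<open>i\<close>, so the index is dropped.
\<close>

definition G_map :: "('v \<Rightarrow> 'v) \<Rightarrow> 'v set \<Rightarrow> 'v set" where
  "G_map l S = l ` S"

definition D_map :: "('v \<Rightarrow> 'v \<Rightarrow> 'k::division_ring) \<Rightarrow> 'v set \<Rightarrow> 'v set" where
  "D_map s S = annihilator (s ` S)"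

text \<open>
  The untwisted product of two maps is \<^const>\<open>map_prod\<close>.
\<close>

definition twisted_prod :: "('a \<Rightarrow> 'b) \<Rightarrow> ('c \<Rightarrow> 'd) \<Rightarrow> 'a \<times> 'c \<Rightarrow> 'd \<times> 'b" where
  "twisted_prod g' g'' = (\<lambda>(S, U). (g'' U, g' S))"

end

theory Submission imports Defs begin

text \<open>
  Call the pairs with a prescribed first component a row and those with a prescribed second component
  a column. Adjacent pairs lie in a common row or in a common column, and so do the three pairs of a
  triangle. Two edges of a row that meet in a pair are linked by triangles inside the row
  (\<open>complements_linked\<close>), and a row is connected (\<open>complements_connected\<close>). So an adjacency
  preserving transformation \<open>f\<close> sends a row into a row or into a column. The same is true of columns
  and of the inverse of \<open>f\<close>, and two subspaces of equal dimension have a common complement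
  (\<open>common_complement\<close>), so \<open>f\<close> treats all rows alike: it sends rows to rows and columns to columns,
  or it exchanges them (\<open>grid_iso_cases\<close>). Hence \<open>f\<close> is \<open>(S, U) \<mapsto> (\<phi> S, \<psi> U)\<close> or
  \<open>(S, U) \<mapsto> (\<psi> U, \<phi> S)\<close> for bijections \<open>\<phi>\<close> and \<open>\<psi>\<close> between Grassmannians. This already gives the
  claim on closeness. Moreover, \<open>\<phi>\<close> and \<open>\<psi>\<close> preserve complementarity, and, looking at pairs with a
  common complement, also adjacency of subspaces in both directions.

  It remains to determine the pairs \<open>(\<phi>, \<psi>)\<close>. If \<open>n = 2\<close>, then complementary points are just distinct
  ones, and all that is left is \<open>\<phi> = \<psi>\<close>. Let \<open>n > 2\<close>. If \<open>k\<close> is \<open>1\<close> or \<open>n - 1\<close>, complementarity is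
  non-incidence of points and hyperplanes. For other \<open>k\<close> one follows Chow: a clique of a Grassmannian
  lies in a star (all subspaces through a given one) or in a top (all subspaces of a given one), as
  \<open>clique_star_or_top\<close> shows, and \<open>\<phi>\<close> sends either all tops to tops or all tops to stars
  (\<open>chow_dichotomy\<close>). In the first case \<open>\<phi>\<close> comes with a bijection one dimension higher, and
  \<open>inc_pair_descend\<close> replaces such a pair by one a dimension lower, until points and lines are reached.
  In all these cases the fundamental theorem of projective geometry provides a semilinear map \<open>l\<close> that
  induces \<open>\<phi>\<close>, and it induces \<open>\<psi>\<close> as well, because a subspace is determined by its complements
  (\<open>complements_determine\<close>).

  If tops go to stars, or points to hyperplanes, then \<open>\<phi>\<close> is first composed with the map that sends a
  subspace to its annihilator in the dual space; this reverses inclusions, so the previous case yields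
  a semilinear map onto the dual. For this reason everything is done for maps between two spaces with
  different division rings. The dual space is realised on the vectors of the given space by means of
  coordinates, as a left vector space over the opposite ring (\<open>dual_exists\<close>).
\<close>

section \<open>Subspaces and dimension over a division ring\<close>

context left_vector_space
begin

abbreviation sub :: "'v set \<Rightarrow> bool" where "sub \<equiv> is_subspace scale"

lemma scale_zero_left [simp]: "scale 0 x = 0"
  using scale_left_distrib[of 0 0 x] by simp

lemma scale_zero_right [simp]: "scale a 0 = 0"
  using scale_right_distrib[of a 0 0] by simp

lemma scale_minus_left [simp]: "scale (- a) x = - scale a x"
  using scale_left_distrib[of a "- a" x] by (simp add: eq_neg_iff_add_eq_0 add.commute)

lemma scale_minus_right [simp]: "scale a (- x) = - scale a x"
  using scale_right_distrib[of a x "- x"] by (simp add: eq_neg_iff_add_eq_0 add.commute)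

lemma scale_diff_left: "scale (a - b) x = scale a x - scale b x"
  using scale_left_distrib[of a "- b" x] by simp

lemma scale_diff_right: "scale a (x - y) = scale a x - scale a y"
  using scale_right_distrib[of a x "- y"] by simp

lemmas scale_simps = scale_right_distrib scale_left_distrib scale_diff_left scale_diff_right

lemma scale_cancel [simp]: "a \<noteq> 0 \<Longrightarrow> scale (inverse a) (scale a x) = x"
  by (simp add: scale_scale scale_one)

lemma scale_eq_0_iff [simp]: "scale a x = 0 \<longleftrightarrow> a = 0 \<or> x = 0"
  by (metis scale_cancel scale_zero_left scale_zero_right)

lemma sub_0: "sub S \<Longrightarrow> 0 \<in> S"
  and sub_add: "sub S \<Longrightarrow> x \<in> S \<Longrightarrow> y \<in> S \<Longrightarrow> x + y \<in> S"
  and sub_scale: "sub S \<Longrightarrow> x \<in> S \<Longrightarrow> scale a x \<in> S"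
  by (auto simp: is_subspace_def)

lemma sub_minus: "sub S \<Longrightarrow> x \<in> S \<Longrightarrow> - x \<in> S"
  using sub_scale[of S x "- 1"] by (simp add: scale_one)

lemma sub_diff: "sub S \<Longrightarrow> x \<in> S \<Longrightarrow> y \<in> S \<Longrightarrow> x - y \<in> S"
  using sub_add[of S x "- y"] sub_minus[of S y] by simp

lemma sub_scale_iff: "sub S \<Longrightarrow> a \<noteq> 0 \<Longrightarrow> scale a x \<in> S \<longleftrightarrow> x \<in> S"
  by (metis scale_cancel sub_scale)

lemma sub_zero [simp]: "sub {0}"
  and sub_UNIV [simp]: "sub UNIV"
  by (auto simp: is_subspace_def)

lemma sub_Int: "sub S \<Longrightarrow> sub T \<Longrightarrow> sub (S \<inter> T)"
  by (auto simp: is_subspace_def)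

text \<open>
  The span of a subspace \<open>S\<close> and one further vector \<open>v\<close>, which may already lie in \<open>S\<close>.
\<close>

definition adjoin :: "'v \<Rightarrow> 'v set \<Rightarrow> 'v set" where
  "adjoin v S = {x. \<exists>a. x - scale a v \<in> S}"

definition ssum :: "'v set \<Rightarrow> 'v set \<Rightarrow> 'v set" where
  "ssum S T = {x + y | x y. x \<in> S \<and> y \<in> T}"

lemma sub_adjoin:
  assumes "sub S" shows "sub (adjoin v S)"
  unfolding is_subspace_def
proof (intro conjI ballI allI)
  show "0 \<in> adjoin v S"
    using sub_0[OF assms] by (auto simp: adjoin_def intro!: exI[of _ 0])
next
  fix x y assume "x \<in> adjoin v S" "y \<in> adjoin v S"
  then obtain a b where "x - scale a v \<in> S" "y - scale b v \<in> S"
    by (auto simp: adjoin_def)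
  from sub_add[OF assms this] have "x + y - scale (a + b) v \<in> S"
    by (simp add: scale_simps algebra_simps)
  then show "x + y \<in> adjoin v S" by (auto simp: adjoin_def)
next
  fix c x assume "x \<in> adjoin v S"
  then obtain a where "x - scale a v \<in> S" by (auto simp: adjoin_def)
  from sub_scale[OF assms this, of c] have "scale c x - scale (c * a) v \<in> S"
    by (simp add: scale_simps scale_scale)
  then show "scale c x \<in> adjoin v S" by (auto simp: adjoin_def)
qed

lemma subset_adjoin: "S \<subseteq> adjoin v S"
  by (auto simp: adjoin_def intro!: exI[of _ 0])

lemma mem_adjoin: "sub S \<Longrightarrow> v \<in> adjoin v S"
  by (auto simp: adjoin_def scale_one sub_0 intro!: exI[of _ 1])

lemma adjoin_least: "sub T \<Longrightarrow> S \<subseteq> T \<Longrightarrow> v \<in> T \<Longrightarrow> adjoin v S \<subseteq> T"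
  unfolding adjoin_def by (clarify, metis diff_add_cancel sub_add sub_scale subsetD)

lemma adjoin_exchange:
  assumes "sub S" "w \<in> adjoin v S" "w \<notin> S" shows "v \<in> adjoin w S"
proof -
  obtain a where a: "w - scale a v \<in> S" using assms(2) by (auto simp: adjoin_def)
  with assms(3) have "a \<noteq> 0" by auto
  from a have "- scale (inverse a) (w - scale a v) \<in> S"
    using assms(1) sub_minus sub_scale by blast
  with \<open>a \<noteq> 0\<close> have "v - scale (inverse a) w \<in> S" by (simp add: scale_simps)
  then show ?thesis by (auto simp: adjoin_def)
qed

lemma adjoin_cover:
  assumes "sub S" "sub T" "S \<subseteq> T" "T \<subseteq> adjoin v S"
  shows "T = S \<or> T = adjoin v S"
proof (cases "T \<subseteq> S")
  case False
  then obtain t where t: "t \<in> T" "t \<notin> S" by blast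
  then have "v \<in> adjoin t S" using adjoin_exchange[OF assms(1)] assms(4) by blast
  moreover have "adjoin t S \<subseteq> T" using adjoin_least[OF assms(2,3) t(1)] .
  ultimately have "adjoin v S \<subseteq> T" using adjoin_least[OF assms(2,3)] by blast
  with assms show ?thesis by blast
qed (use assms in blast)

text \<open>
  Modulo \<open>T\<close> the space \<open>adjoin v T\<close> is generated by any of its vectors outside \<open>T\<close>, by exchange. So the
  part of \<open>S\<close> inside \<open>T\<close> is a hyperplane of \<open>S\<close> as soon as \<open>S\<close> is not contained in \<open>T\<close>.
\<close>

lemma adjoin_Int:
  assumes "sub S" "sub T" "S \<subseteq> adjoin v T" "s \<in> S" "s \<notin> T"
  shows "S = adjoin s (S \<inter> T)"
proof
  have v: "v \<in> adjoin s T" using adjoin_exchange assms by blast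
  then have S: "S \<subseteq> adjoin s T" using assms adjoin_least sub_adjoin subset_adjoin by (meson subset_trans)
  show "S \<subseteq> adjoin s (S \<inter> T)"
  proof
    fix x assume "x \<in> S"
    with S obtain a where "x - scale a s \<in> T" by (auto simp: adjoin_def)
    moreover have "x - scale a s \<in> S" using \<open>x \<in> S\<close> assms sub_diff sub_scale by blast
    ultimately show "x \<in> adjoin s (S \<inter> T)" by (auto simp: adjoin_def)
  qed
  show "adjoin s (S \<inter> T) \<subseteq> S" using assms adjoin_least by blast
qed

lemma ssum_iff: "x \<in> ssum S T \<longleftrightarrow> (\<exists>s\<in>S. \<exists>t\<in>T. x = s + t)"
  by (auto simp: ssum_def)

lemma sub_ssum: "sub S \<Longrightarrow> sub T \<Longrightarrow> sub (ssum S T)"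
  unfolding is_subspace_def
proof (intro conjI ballI allI, goal_cases)
  case 1
  then show ?case unfolding ssum_iff by (metis add_0)
next
  case (2 x y)
  then obtain a b c d where *: "a \<in> S" "b \<in> T" "c \<in> S" "d \<in> T" "x = a + b" "y = c + d"
    unfolding ssum_iff by blast
  then have "x + y = (a + c) + (b + d)" by (simp add: algebra_simps)
  then show ?case unfolding ssum_iff using 2 * by blast
next
  case (3 a x)
  then show ?case unfolding ssum_iff by (metis scale_right_distrib)
qed

lemma ssum_upper1: "sub T \<Longrightarrow> S \<subseteq> ssum S T"
  unfolding ssum_def using sub_0 by force

lemma ssum_upper2: "sub S \<Longrightarrow> T \<subseteq> ssum S T"
  unfolding ssum_def using sub_0 by force

lemma ssum_least: "sub R \<Longrightarrow> S \<subseteq> R \<Longrightarrow> T \<subseteq> R \<Longrightarrow> ssum S T \<subseteq> R"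
  unfolding ssum_def using sub_add by blast

lemma ssum_adjoin:
  assumes "sub S" "sub T" shows "ssum S (adjoin v T) = adjoin v (ssum S T)"
proof -
  have "x - scale a v = s + t \<longleftrightarrow> x = s + (t + scale a v)" for x a s t
    by (auto simp: algebra_simps)
  then show ?thesis
    unfolding adjoin_def ssum_def
    by (auto; metis add.commute add_diff_cancel diff_add_cancel)
qed

text \<open>
  Dimension is handled through chains of subspaces in which each member covers the previous one.
  Compared with bases this makes monotonicity and the passage to intersections immediate;
  \<open>has_dim_iff_flag\<close> shows that both notions of dimension agree.
\<close>

inductive flag :: "'v set \<Rightarrow> nat \<Rightarrow> bool" where
  flag_0: "flag {0} 0"
| flag_Suc: "flag S d \<Longrightarrow> v \<notin> S \<Longrightarrow> flag (adjoin v S) (Suc d)"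

lemma flag_sub: "flag S d \<Longrightarrow> sub S"
  by (induction rule: flag.induct) (auto intro: sub_adjoin)

lemma flag_Suc': "flag H d \<Longrightarrow> S = adjoin v H \<Longrightarrow> v \<notin> H \<Longrightarrow> flag S (Suc d)"
  using flag_Suc by blast

text \<open>
  The exchange argument of the Jordan-Hoelder theorem. If the last but one member \<open>S'\<close> of the chain
  differs from \<open>H\<close>, then \<open>S' \<inter> H\<close> is a hyperplane of both, and a chain up to \<open>S' \<inter> H\<close> can be
  continued through \<open>H\<close>.
\<close>

lemma flag_hyperplane:
  assumes "flag S e" "sub H" "S = adjoin s H" "s \<notin> H"
  shows "\<exists>d. e = Suc d \<and> flag H d"
  using assms
proof (induction arbitrary: H s rule: flag.induct)
  case flag_0
  then have "s \<in> {0}" using mem_adjoin by blast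
  with flag_0 sub_0 show ?case by blast
next
  case (flag_Suc S' d u)
  note subS' = flag_sub[OF flag_Suc.hyps(1)]
  have HS: "H \<subseteq> adjoin u S'" using flag_Suc.prems subset_adjoin by blast
  have sS: "s \<in> adjoin u S'" using flag_Suc.prems mem_adjoin by blast
  show ?case
  proof (cases "S' \<subseteq> H")
    case True
    then have "H = S'"
      using adjoin_cover[OF subS' flag_Suc.prems(1) True HS] flag_Suc.prems sS by auto
    with flag_Suc.hyps show ?thesis by auto
  next
    case False
    then obtain t where t: "t \<in> S'" "t \<notin> H" by blast
    have "S' = adjoin t (S' \<inter> H)"
      using adjoin_Int[OF subS' flag_Suc.prems(1), of s t] t flag_Suc.prems subset_adjoin[of S' u] by blast
    from flag_Suc.IH[OF sub_Int[OF subS' flag_Suc.prems(1)] this] t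
    obtain c where c: "d = Suc c" "flag (S' \<inter> H) c" by blast
    have "\<not> H \<subseteq> S'"
    proof
      assume "H \<subseteq> S'"
      from adjoin_cover[OF flag_Suc.prems(1) subS' this, of s] flag_Suc.prems(2) subset_adjoin[of S' u]
      have "S' = H \<or> S' = adjoin u S'" by auto
      with t flag_Suc.hyps(2) mem_adjoin[OF subS'] show False by blast
    qed
    then obtain h where h: "h \<in> H" "h \<notin> S'" by blast
    have "H = adjoin h (H \<inter> S')"
      using adjoin_Int[OF flag_Suc.prems(1) subS' HS h] .
    then have "flag H (Suc c)" using flag_Suc'[OF c(2), of H h] h by (auto simp: Int_commute)
    with c show ?thesis by auto
  qed
qed

text \<open>
  Cutting \<open>S\<close> with the last but one member of the chain for \<open>T\<close> shortens the chain for \<open>S\<close> by at most one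
  step. For \<open>S = T\<close> this is the uniqueness of the dimension.
\<close>

lemma flag_mono:
  assumes "flag T d" "flag S e" "S \<subseteq> T" shows "e \<le> d \<and> (e = d \<longrightarrow> S = T)"
  using assms
proof (induction arbitrary: S e rule: flag.induct)
  case flag_0
  have "sub S" using flag_0 flag_sub by blast
  then have "S = {0}" using flag_0 sub_0 by blast
  moreover have "e = 0" using flag_0(1)
  proof cases
    case (flag_Suc S' d v)
    then have "v \<in> S" "0 \<in> S'" using mem_adjoin flag_sub sub_0 by blast+
    with \<open>S = {0}\<close> flag_Suc show ?thesis by auto
  qed simp
  ultimately show ?case by simp
next
  case (flag_Suc T' d v)
  have subs: "sub S" "sub T'" using flag_Suc flag_sub by blast+
  show ?case
  proof (cases "S \<subseteq> T'")
    case True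
    with flag_Suc.IH[OF flag_Suc.prems(1)] show ?thesis by auto
  next
    case False
    then obtain s where s: "s \<in> S" "s \<notin> T'" by blast
    have S: "S = adjoin s (S \<inter> T')" using adjoin_Int[OF subs flag_Suc.prems(2) s] .
    from flag_hyperplane[OF flag_Suc.prems(1) sub_Int[OF subs] S] s
    obtain c where c: "e = Suc c" "flag (S \<inter> T') c" by blast
    from flag_Suc.IH[OF c(2)] have "c \<le> d" "c = d \<longrightarrow> S \<inter> T' = T'" by auto
    moreover have "S = adjoin v T'" if "S \<inter> T' = T'"
      using adjoin_cover[OF subs(2,1), of v] that flag_Suc.prems s by blast
    ultimately show ?thesis using c by auto
  qed
qed

lemma flag_exists_subset:
  assumes "flag T d" "sub S" "S \<subseteq> T" shows "\<exists>e. flag S e"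
  using assms
proof (induction arbitrary: S rule: flag.induct)
  case flag_0
  then have "S = {0}" using sub_0 by blast
  then show ?case using flag.flag_0 by blast
next
  case (flag_Suc T' d v)
  note subT = flag_sub[OF flag_Suc.hyps(1)]
  from flag_Suc.IH[of "S \<inter> T'"] obtain e where e: "flag (S \<inter> T') e"
    using flag_Suc.prems subT sub_Int by blast
  show ?case
  proof (cases "S \<subseteq> T'")
    case True
    with e show ?thesis by (auto simp: Int_absorb2)
  next
    case False
    then obtain s where s: "s \<in> S" "s \<notin> T'" by blast
    have S: "S = adjoin s (S \<inter> T')" using adjoin_Int[OF flag_Suc.prems(1) subT flag_Suc.prems(2) s] .
    show ?thesis using flag_Suc'[OF e S] s by blast
  qed
qed

lemma basis_insert:
  assumes B: "is_basis scale B S" and S: "sub S" and v: "v \<notin> S"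
  shows "is_basis scale (insert v B) (adjoin v S) \<and> v \<notin> B"
proof -
  have fin: "finite B" and ran: "S = range (\<lambda>c. \<Sum>b\<in>B. scale (c b) b)"
    and ind: "\<And>c. (\<Sum>b\<in>B. scale (c b) b) = 0 \<Longrightarrow> \<forall>b\<in>B. c b = 0"
    using B by (auto simp: is_basis_def)
  have in_S: "(\<Sum>b\<in>B. scale (c b) b) \<in> S" for c using ran by blast
  have vB: "v \<notin> B"
  proof
    assume "v \<in> B"
    have "(\<Sum>b\<in>B. scale (if b = v then 1 else 0) b) = v"
      using fin \<open>v \<in> B\<close> by (subst sum.remove[OF fin \<open>v \<in> B\<close>]) (auto simp: scale_one intro: sum.neutral)
    with in_S[of "\<lambda>b. if b = v then 1 else 0"] v show False by simp
  qed
  have sum_ins: "(\<Sum>b\<in>insert v B. scale (c b) b) = scale (c v) v + (\<Sum>b\<in>B. scale (c b) b)" for c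
    using fin vB by simp
  have "adjoin v S = range (\<lambda>c. \<Sum>b\<in>insert v B. scale (c b) b)"
  proof (intro equalityI subsetI)
    fix x assume "x \<in> adjoin v S"
    then obtain a where "x - scale a v \<in> S" by (auto simp: adjoin_def)
    then obtain c where c: "x - scale a v = (\<Sum>b\<in>B. scale (c b) b)" using ran by blast
    have "(\<Sum>b\<in>B. scale ((c(v := a)) b) b) = (\<Sum>b\<in>B. scale (c b) b)"
      using vB by (intro sum.cong) auto
    then have "x = (\<Sum>b\<in>insert v B. scale ((c(v := a)) b) b)"
      unfolding sum_ins using c by (simp add: algebra_simps)
    then show "x \<in> range (\<lambda>c. \<Sum>b\<in>insert v B. scale (c b) b)" by blast
  next
    fix x assume "x \<in> range (\<lambda>c. \<Sum>b\<in>insert v B. scale (c b) b)"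
    then obtain c where "x = (\<Sum>b\<in>insert v B. scale (c b) b)" by blast
    then show "x \<in> adjoin v S" unfolding sum_ins adjoin_def
      using in_S by (auto intro!: exI[of _ "c v"])
  qed
  moreover have "\<forall>b\<in>insert v B. c b = 0" if "(\<Sum>b\<in>insert v B. scale (c b) b) = 0" for c
  proof -
    have eq: "scale (c v) v = - (\<Sum>b\<in>B. scale (c b) b)"
      using that unfolding sum_ins by (simp add: eq_neg_iff_add_eq_0)
    then have "scale (c v) v \<in> S" using in_S sub_minus[OF S] by simp
    then have "c v = 0" using sub_scale_iff[OF S] v by blast
    with eq ind[of c] show ?thesis by auto
  qed
  ultimately show ?thesis using fin vB by (auto simp: is_basis_def)
qed

lemma basis_empty: "is_basis scale {} {0}"
  by (auto simp: is_basis_def)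

lemma flag_imp_has_dim: "flag S d \<Longrightarrow> has_dim scale S d"
proof (induction rule: flag.induct)
  case flag_0
  then show ?case using basis_empty by (auto simp: has_dim_def)
next
  case (flag_Suc S d v)
  then obtain B where B: "is_basis scale B S" "card B = d" by (auto simp: has_dim_def)
  from basis_insert[OF B(1) flag_sub[OF flag_Suc.hyps(1)] flag_Suc.hyps(2)] B
  show ?case unfolding has_dim_def by (metis card_insert_disjoint is_basis_def)
qed

lemma basis_imp_flag: "finite B \<Longrightarrow> is_basis scale B S \<Longrightarrow> flag S (card B)"
proof (induction B arbitrary: S rule: finite_induct)
  case empty
  then have "S = {0}" by (auto simp: is_basis_def)
  then show ?case using flag_0 by simp
next
  case (insert v B)
  define T where "T = range (\<lambda>c. \<Sum>b\<in>B. scale (c b) b)"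
  have ran: "S = range (\<lambda>c. \<Sum>b\<in>insert v B. scale (c b) b)"
    and ind: "\<And>c. (\<Sum>b\<in>insert v B. scale (c b) b) = 0 \<Longrightarrow> \<forall>b\<in>insert v B. c b = 0"
    using insert.prems by (auto simp: is_basis_def)
  have sum_ins: "(\<Sum>b\<in>insert v B. scale (c b) b) = scale (c v) v + (\<Sum>b\<in>B. scale (c b) b)" for c
    using insert.hyps by simp
  have upd: "(\<Sum>b\<in>B. scale ((c(v := a)) b) b) = (\<Sum>b\<in>B. scale (c b) b)" for c a
    using insert.hyps by (intro sum.cong) auto
  have comb: "scale a v + (\<Sum>b\<in>B. scale (c b) b) = (\<Sum>b\<in>insert v B. scale ((c(v := a)) b) b)" for c a
    unfolding sum_ins upd by simp
  have "is_basis scale B T"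
    unfolding is_basis_def
  proof (intro conjI allI impI)
    fix c assume "(\<Sum>b\<in>B. scale (c b) b) = 0"
    then have "(\<Sum>b\<in>insert v B. scale ((c(v := 0)) b) b) = 0" unfolding sum_ins upd by simp
    from ind[OF this] show "\<forall>b\<in>B. c b = 0" using insert.hyps by (metis fun_upd_other insertCI)
  qed (use insert.hyps T_def in auto)
  then have flagT: "flag T (card B)" using insert.IH by blast
  have "v \<notin> T"
  proof
    assume "v \<in> T"
    then obtain c where "v = (\<Sum>b\<in>B. scale (c b) b)" by (auto simp: T_def)
    then have "(\<Sum>b\<in>insert v B. scale ((c(v := - 1)) b) b) = 0"
      unfolding sum_ins upd by (simp add: scale_one)
    from ind[OF this] show False by auto
  qed
  moreover have "S = adjoin v T"
  proof (intro equalityI subsetI)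
    fix x assume "x \<in> S"
    then obtain c where "x = (\<Sum>b\<in>insert v B. scale (c b) b)" using ran by blast
    then show "x \<in> adjoin v T" unfolding sum_ins adjoin_def T_def by (auto intro!: exI[of _ "c v"])
  next
    fix x assume "x \<in> adjoin v T"
    then obtain a c where "x - scale a v = (\<Sum>b\<in>B. scale (c b) b)" by (auto simp: adjoin_def T_def)
    then have "x = scale a v + (\<Sum>b\<in>B. scale (c b) b)" by (simp add: algebra_simps)
    then show "x \<in> S" unfolding comb ran by blast
  qed
  ultimately show ?case using flagT flag_Suc'[OF flagT] insert.hyps by simp
qed

lemma has_dim_iff_flag: "has_dim scale S d \<longleftrightarrow> flag S d"
  using flag_imp_has_dim basis_imp_flag unfolding has_dim_def by (metis is_basis_def)

lemma flag_unique: "flag S d \<Longrightarrow> flag S e \<Longrightarrow> d = e"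
  using flag_mono by (metis antisym order_refl)

end

locale fin_dim_space = left_vector_space scale
  for scale :: "'k::division_ring \<Rightarrow> 'v::ab_group_add \<Rightarrow> 'v" +
  fixes n :: nat
  assumes dim_UNIV: "has_dim scale UNIV n"
begin

definition dim :: "'v set \<Rightarrow> nat" where "dim S = (THE d. flag S d)"

lemma flag_dim: "sub S \<Longrightarrow> flag S (dim S)"
proof -
  assume "sub S"
  then obtain d where "flag S d" using flag_exists_subset dim_UNIV has_dim_iff_flag by blast
  then show ?thesis unfolding dim_def using flag_unique by (metis theI)
qed

lemma flag_iff_dim: "sub S \<Longrightarrow> flag S d \<longleftrightarrow> dim S = d"
  using flag_dim flag_unique by blast

lemma has_dim_iff: "has_dim scale S d \<longleftrightarrow> sub S \<and> dim S = d"
  using has_dim_iff_flag flag_iff_dim flag_sub by blast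

abbreviation Gr :: "nat \<Rightarrow> 'v set set" where "Gr \<equiv> grassmannian scale"

lemma Gr_iff: "S \<in> Gr i \<longleftrightarrow> sub S \<and> dim S = i"
  by (auto simp: grassmannian_def has_dim_iff)

lemma dim_UNIV_eq [simp]: "dim UNIV = n"
  using dim_UNIV has_dim_iff by blast

lemma dim_zero [simp]: "dim {0} = 0"
  using flag_0 flag_iff_dim by auto

lemma dim_mono: "sub S \<Longrightarrow> sub T \<Longrightarrow> S \<subseteq> T \<Longrightarrow> dim S \<le> dim T"
  using flag_mono[OF flag_dim flag_dim] by blast

lemma dim_eq_imp_eq: "sub S \<Longrightarrow> sub T \<Longrightarrow> S \<subseteq> T \<Longrightarrow> dim T \<le> dim S \<Longrightarrow> S = T"
  using flag_mono[OF flag_dim flag_dim] by (metis antisym)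

lemma dim_less: "sub S \<Longrightarrow> sub T \<Longrightarrow> S \<subset> T \<Longrightarrow> dim S < dim T"
  using dim_eq_imp_eq by (metis linorder_not_le psubsetE subset_refl)

lemma dim_le: "sub S \<Longrightarrow> dim S \<le> n"
  using dim_mono[of S UNIV] by simp

lemma dim_adjoin: "sub S \<Longrightarrow> v \<notin> S \<Longrightarrow> dim (adjoin v S) = Suc (dim S)"
  using flag_Suc[OF flag_dim] flag_iff_dim sub_adjoin by blast

lemma dim_eq_0: "sub S \<Longrightarrow> dim S = 0 \<longleftrightarrow> S = {0}"
  using dim_eq_imp_eq[of "{0}" S] sub_0 by auto

lemma dim_eq_n: "sub S \<Longrightarrow> dim S = n \<longleftrightarrow> S = UNIV"
  using dim_eq_imp_eq[of S UNIV] by auto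

text \<open>
  Induction along the subspaces between \<open>R\<close> and \<open>T\<close>, one new vector at a time; it ends because
  the dimension is bounded.
\<close>

lemma subspace_extend_induct [consumes 3, case_names base step]:
  assumes "sub R" "sub T" "R \<subseteq> T"
    and "P R"
    and step: "\<And>S v. sub S \<Longrightarrow> R \<subseteq> S \<Longrightarrow> S \<subseteq> T \<Longrightarrow> P S \<Longrightarrow> v \<in> T \<Longrightarrow> v \<notin> S \<Longrightarrow> P (adjoin v S)"
  shows "P T"
proof -
  have "P T" if "sub S" "R \<subseteq> S" "S \<subseteq> T" "P S" for S
    using that
  proof (induction "dim T - dim S" arbitrary: S rule: less_induct)
    case less
    show ?case
    proof (cases "S = T")
      case False
      then obtain v where v: "v \<in> T" "v \<notin> S" using less.prems by blast
      have le: "adjoin v S \<subseteq> T" using adjoin_least less.prems v assms by blast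
      have "dim (adjoin v S) \<le> dim T" using dim_mono[OF sub_adjoin _ le] less.prems assms by blast
      then have "dim T - dim (adjoin v S) < dim T - dim S" using dim_adjoin less.prems v by force
      then show ?thesis
        using less.hyps[of "adjoin v S"] step[OF less.prems v] le less.prems sub_adjoin subset_adjoin
        by (meson subset_trans)
    qed (use less in blast)
  qed
  then show ?thesis using assms by blast
qed

lemma intermediate_subspace:
  assumes "sub S" "sub T" "S \<subseteq> T" "dim S \<le> d" "d \<le> dim T"
  shows "\<exists>R. sub R \<and> S \<subseteq> R \<and> R \<subseteq> T \<and> dim R = d"
proof -
  have "d \<le> dim T \<longrightarrow> (\<exists>R. sub R \<and> S \<subseteq> R \<and> R \<subseteq> T \<and> dim R = d)" using assms(1-3)
  proof (induction rule: subspace_extend_induct)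
    case base
    show ?case
    proof
      assume "d \<le> dim S"
      then have "dim S = d" using assms by simp
      with assms show "\<exists>R. sub R \<and> S \<subseteq> R \<and> R \<subseteq> S \<and> dim R = d" by blast
    qed
  next
    case (step S' v)
    have dims: "dim (adjoin v S') = Suc (dim S')" using step dim_adjoin by simp
    have subA: "sub (adjoin v S')" using sub_adjoin step by simp
    have up: "S' \<subseteq> adjoin v S'" by (rule subset_adjoin)
    show ?case
    proof
      assume d: "d \<le> dim (adjoin v S')"
      show "\<exists>R. sub R \<and> S \<subseteq> R \<and> R \<subseteq> adjoin v S' \<and> dim R = d"
      proof (cases "d \<le> dim S'")
        case True
        then obtain R where "sub R" "S \<subseteq> R" "R \<subseteq> S'" "dim R = d" using step by blast
        with up show ?thesis by blast
      next
        case False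
        with d dims have "dim (adjoin v S') = d" by simp
        with subA up step show ?thesis by blast
      qed
    qed
  qed
  then show ?thesis using assms by blast
qed

text \<open>
  Build \<open>T\<close> up from \<open>S \<inter> T\<close>: a vector of \<open>T\<close> that is new to an intermediate space \<open>R\<close> is also new to \<open>S + R\<close>,
  so both dimensions grow by one.
\<close>

lemma dim_ssum:
  assumes S: "sub S" and T: "sub T"
  shows "dim (ssum S T) + dim (S \<inter> T) = dim S + dim T"
proof -
  define D where "D = S \<inter> T"
  have D: "sub D" "D \<subseteq> S" "D \<subseteq> T" using sub_Int[OF assms] by (auto simp: D_def)
  have "dim (ssum S T) + dim D = dim S + dim T"
    using D(1) T D(3)
  proof (induction rule: subspace_extend_induct)
    case base
    have "ssum S D = S"
      using ssum_least[OF S order_refl D(2)] ssum_upper1[OF D(1), of S] by (rule equalityI)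
    then show ?case by simp
  next
    case (step R v)
    have "v \<notin> ssum S R"
    proof
      assume "v \<in> ssum S R"
      then obtain s r where *: "s \<in> S" "r \<in> R" "v = s + r" unfolding ssum_iff by blast
      then have "s = v - r" by simp
      moreover have "v - r \<in> T" using step * T sub_diff by (meson subsetD)
      ultimately have "s \<in> D" using * by (simp add: D_def)
      then show False using * step sub_add by blast
    qed
    then show ?case
      using step dim_adjoin ssum_adjoin[OF S] sub_ssum[OF S] by auto
  qed
  then show ?thesis by (simp add: D_def)
qed

lemma Gr_ssum_Int_0:
  assumes "S \<in> Gr i" "T \<in> Gr (n - i)" "i \<le> n"
  shows "ssum S T = UNIV \<longleftrightarrow> S \<inter> T = {0}"
proof -
  have sub: "sub S" "sub T" and "dim S + dim T = n" using assms by (auto simp: Gr_iff)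
  with dim_ssum[OF sub] have "dim (ssum S T) = n \<longleftrightarrow> dim (S \<inter> T) = 0" by linarith
  then show ?thesis using dim_eq_n[OF sub_ssum[OF sub]] dim_eq_0[OF sub_Int[OF sub]] by simp
qed

lemma complementary_pairs_iff:
  "i \<le> n \<Longrightarrow> (S, U) \<in> complementary_pairs scale n i \<longleftrightarrow> S \<in> Gr i \<and> U \<in> Gr (n - i) \<and> S \<inter> U = {0}"
  using Gr_ssum_Int_0[of S i U] unfolding complementary_pairs_def ssum_def by blast

end

section \<open>Isomorphisms between grids of pairs\<close>

definition edge :: "('a \<Rightarrow> 'a \<Rightarrow> bool) \<Rightarrow> ('b \<Rightarrow> 'b \<Rightarrow> bool) \<Rightarrow> 'a \<times> 'b \<Rightarrow> 'a \<times> 'b \<Rightarrow> bool" where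
  "edge A B p q \<longleftrightarrow> fst p = fst q \<and> B (snd p) (snd q) \<or> A (fst p) (fst q) \<and> snd p = snd q"

text \<open>
  What is needed of the rows of a set \<open>C\<close> of pairs. The assumption \<open>linked\<close> says that two edges of a row
  that meet in a pair are connected by triangles of that row. It prevents a map from bending a row at
  one of its pairs.
\<close>

locale linked_rows =
  fixes C :: "('a \<times> 'b) set" and B :: "'b \<Rightarrow> 'b \<Rightarrow> bool"
  assumes irrefl: "\<not> B u u"
    and sym: "B u u' \<Longrightarrow> B u' u"
    and linked: "\<lbrakk>(s, u) \<in> C; (s, u') \<in> C; (s, u'') \<in> C; B u u'; B u u''\<rbrakk>
      \<Longrightarrow> \<exists>w. (s, w) \<in> C \<and> B u w \<and> (w = u' \<or> B w u') \<and> (w = u'' \<or> B w u'')"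
    and connected: "\<lbrakk>(s, u) \<in> C; (s, u') \<in> C\<rbrakk>
      \<Longrightarrow> (\<lambda>v w. B v w \<and> (s, v) \<in> C \<and> (s, w) \<in> C)\<^sup>*\<^sup>* u u'"
    and nontrivial: "(s, u) \<in> C \<Longrightarrow> \<exists>u'. (s, u') \<in> C \<and> u' \<noteq> u"
    and common: "\<lbrakk>s \<in> fst ` C; s' \<in> fst ` C\<rbrakk> \<Longrightarrow> \<exists>u. (s, u) \<in> C \<and> (s', u) \<in> C"

locale linked_grid =
  rows: linked_rows C B + cols: linked_rows "prod.swap ` C" A
  for C :: "('a \<times> 'b) set" and A :: "'a \<Rightarrow> 'a \<Rightarrow> bool" and B :: "'b \<Rightarrow> 'b \<Rightarrow> bool"

lemma linked_grid_swap: "linked_grid C A B \<Longrightarrow> linked_grid (prod.swap ` C) B A"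
  by (simp add: linked_grid_def image_image)

context linked_grid begin

lemma edge_same_line: "edge A B p q \<Longrightarrow> fst p = fst q \<or> snd p = snd q"
  by (auto simp: edge_def)

lemma triangle:
  assumes "edge A B p q" "edge A B q r" "edge A B p r" "fst p = fst q"
  shows "fst p = fst r"
  using assms rows.irrefl cols.irrefl unfolding edge_def by metis

end

text \<open>
  A triangle cannot turn from a row into a column, hence by \<open>linked\<close> all edges of the row at one pair
  have images in the same direction. Connectedness carries the direction along the row.
\<close>

lemma row_in_line:
  assumes C: "linked_grid C A B" and D: "linked_grid D A' B'"
    and f: "\<And>p. p \<in> C \<Longrightarrow> f p \<in> D"
    and hom: "\<And>p q. p \<in> C \<Longrightarrow> q \<in> C \<Longrightarrow> edge A B p q \<Longrightarrow> edge A' B' (f p) (f q)"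
  shows "(\<forall>u u'. (s, u) \<in> C \<longrightarrow> (s, u') \<in> C \<longrightarrow> fst (f (s, u)) = fst (f (s, u'))) \<or>
         (\<forall>u u'. (s, u) \<in> C \<longrightarrow> (s, u') \<in> C \<longrightarrow> snd (f (s, u)) = snd (f (s, u')))"
proof -
  interpret C: linked_grid C A B by fact
  interpret D: linked_grid D A' B' by fact
  have hom': "edge A' B' (f (s, u)) (f (s, u'))" if "(s, u) \<in> C" "(s, u') \<in> C" "B u u'" for u u'
    using hom that by (auto simp: edge_def)
  \<comment> \<open>two edges of the row at a pair have images in the same direction\<close>
  have turn: "fst (f (s, u)) = fst (f (s, u''))"
    if *: "(s, u) \<in> C" "(s, u') \<in> C" "(s, u'') \<in> C" "B u u'" "B u u''"
      "fst (f (s, u)) = fst (f (s, u'))" for u u' u''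
  proof -
    obtain w where w: "(s, w) \<in> C" "B u w" "w = u' \<or> B w u'" "w = u'' \<or> B w u''"
      using C.rows.linked[OF *(1-5)] by blast
    note edge = hom'[OF *(1) *(2) *(4)] hom'[OF *(1) *(3) *(5)] hom'[OF *(1) w(1) w(2)]
    have "fst (f (s, u)) = fst (f (s, w))"
      using w(3)
    proof
      assume "B w u'"
      then have "edge A' B' (f (s, u')) (f (s, w))" using C.rows.sym hom'[OF *(2) w(1)] by blast
      from D.triangle[OF edge(1) this edge(3) *(6)] show ?thesis .
    qed (use * in simp)
    note row = this
    from w(4) show ?thesis
    proof
      assume "B w u''"
      from D.triangle[OF edge(3) hom'[OF w(1) *(3) this] edge(2) row]
      show ?thesis .
    qed (use row in simp)
  qed
  show ?thesis
  proof (cases "\<exists>u u'. (s, u) \<in> C \<and> (s, u') \<in> C \<and> B u u' \<and> fst (f (s, u)) = fst (f (s, u'))")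
    case True
    then obtain u0 u1 where u: "(s, u0) \<in> C" "(s, u1) \<in> C" "B u0 u1" "fst (f (s, u0)) = fst (f (s, u1))"
      by blast
    \<comment> \<open>invariant along a path: there is an edge at \<open>v\<close> whose image runs in a row, and \<open>f\<close> has not left that row\<close>
    let ?P = "\<lambda>v. (s, v) \<in> C \<and> (\<exists>w. (s, w) \<in> C \<and> B v w \<and> fst (f (s, v)) = fst (f (s, w))) \<and>
        fst (f (s, v)) = fst (f (s, u0))"
    have all: "?P v" if "(s, v) \<in> C" for v
      using C.rows.connected[OF u(1) that]
    proof (induction rule: rtranclp_induct)
      case base
      then show ?case using u by auto
    next
      case (step v w)
      then obtain w' where w': "(s, w') \<in> C" "B v w'" "fst (f (s, v)) = fst (f (s, w'))" by blast
      have "fst (f (s, v)) = fst (f (s, w))" using turn w' step by blast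
      moreover have "B w v" using step C.rows.sym by blast
      ultimately show ?case using step by auto
    qed
    have "fst (f (s, u)) = fst (f (s, v))" if "(s, u) \<in> C" "(s, v) \<in> C" for u v
      using all[OF that(1)] all[OF that(2)] by simp
    then show ?thesis by blast
  next
    case False
    have "snd (f (s, u)) = snd (f (s, v))" if "(s, u) \<in> C" "(s, v) \<in> C" for u v
      using C.rows.connected[OF that]
    proof (induction rule: rtranclp_induct)
      case (step v w)
      then have "fst (f (s, v)) = fst (f (s, w)) \<or> snd (f (s, v)) = snd (f (s, w))"
        using D.edge_same_line[OF hom'[of v w]] by blast
      with step False show ?case by auto
    qed simp
    then show ?thesis by blast
  qed
qed

text \<open>
  Statements on columns follow from statements on rows by exchanging the two coordinates.
\<close>

lemma swap_hom:
  assumes "\<And>p q. p \<in> C \<Longrightarrow> q \<in> C \<Longrightarrow> edge A B p q \<Longrightarrow> edge A' B' (f p) (f q)"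
  shows "p \<in> prod.swap ` C \<Longrightarrow> q \<in> prod.swap ` C \<Longrightarrow> edge B A p q \<Longrightarrow>
    edge A' B' (f (prod.swap p)) (f (prod.swap q))"
  using assms by (force simp: edge_def)

lemma col_in_line:
  assumes "linked_grid C A B" "linked_grid D A' B'"
    and "\<And>p. p \<in> C \<Longrightarrow> f p \<in> D"
    and "\<And>p q. p \<in> C \<Longrightarrow> q \<in> C \<Longrightarrow> edge A B p q \<Longrightarrow> edge A' B' (f p) (f q)"
  shows "(\<forall>s s'. (s, u) \<in> C \<longrightarrow> (s', u) \<in> C \<longrightarrow> fst (f (s, u)) = fst (f (s', u))) \<or>
         (\<forall>s s'. (s, u) \<in> C \<longrightarrow> (s', u) \<in> C \<longrightarrow> snd (f (s, u)) = snd (f (s', u)))"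
proof -
  have mem: "(x, y) \<in> prod.swap ` C \<longleftrightarrow> (y, x) \<in> C" for x y by force
  have "(\<forall>s s'. (u, s) \<in> prod.swap ` C \<longrightarrow> (u, s') \<in> prod.swap ` C \<longrightarrow>
            fst (f (prod.swap (u, s))) = fst (f (prod.swap (u, s')))) \<or>
        (\<forall>s s'. (u, s) \<in> prod.swap ` C \<longrightarrow> (u, s') \<in> prod.swap ` C \<longrightarrow>
            snd (f (prod.swap (u, s))) = snd (f (prod.swap (u, s'))))"
  proof (rule row_in_line[where f = "\<lambda>p. f (prod.swap p)", OF linked_grid_swap[OF assms(1)] assms(2)])
    show "f (prod.swap p) \<in> D" if "p \<in> prod.swap ` C" for p using that assms(3) by auto
    show "edge A' B' (f (prod.swap p)) (f (prod.swap q))"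
      if "p \<in> prod.swap ` C" "q \<in> prod.swap ` C" "edge B A p q" for p q
      using that swap_hom[where A = A and B = B and f = f and C = C and A' = A' and B' = B', OF assms(4)]
      by simp
  qed
  then show ?thesis by (simp add: mem)
qed

text \<open>
  Only adjacency of pairs enters; that such a map respects lines is the content of \<open>grid_iso_cases\<close>.
\<close>

definition grid_iso where
  "grid_iso C A B D A' B' f \<longleftrightarrow> bij_betw f C D \<and>
     (\<forall>p\<in>C. \<forall>q\<in>C. edge A B p q \<longleftrightarrow> edge A' B' (f p) (f q))"

lemma grid_iso_inv:
  assumes "grid_iso C A B D A' B' f"
  shows "grid_iso D A' B' C A B (inv_into C f)"
proof -
  have bij: "bij_betw f C D"
    and hom: "\<And>p q. p \<in> C \<Longrightarrow> q \<in> C \<Longrightarrow> edge A B p q \<longleftrightarrow> edge A' B' (f p) (f q)"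
    using assms by (auto simp: grid_iso_def)
  have "inv_into C f p \<in> C \<and> f (inv_into C f p) = p" if "p \<in> D" for p
    using that bij by (auto simp: bij_betw_def inv_into_into f_inv_into_f)
  with hom show ?thesis
    using bij_betw_inv_into[OF bij] by (auto simp: grid_iso_def)
qed

lemma grid_iso_dom_swap:
  assumes "grid_iso C A B D A' B' f"
  shows "grid_iso (prod.swap ` C) B A D A' B' (f \<circ> prod.swap)"
proof -
  have "bij_betw prod.swap (prod.swap ` C) C"
    by (rule bij_betw_byWitness[where f' = prod.swap]) auto
  moreover have "edge B A p q = edge A B (prod.swap p) (prod.swap q)" for p q
    by (auto simp: edge_def)
  ultimately show ?thesis
    using assms by (auto simp: grid_iso_def bij_betw_trans)
qed

lemma grid_iso_cod_swap:
  assumes "grid_iso C A B D A' B' f"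
  shows "grid_iso C A B (prod.swap ` D) B' A' (prod.swap \<circ> f)"
proof -
  have "bij_betw prod.swap D (prod.swap ` D)"
    by (rule bij_betw_byWitness[where f' = prod.swap]) auto
  moreover have "edge A' B' p q = edge B' A' (prod.swap p) (prod.swap q)" for p q
    by (auto simp: edge_def)
  ultimately show ?thesis
    using assms by (auto simp: grid_iso_def bij_betw_trans)
qed

definition rows_to_rows :: "('a \<times> 'b) set \<Rightarrow> ('a \<times> 'b \<Rightarrow> 'c \<times> 'd) \<Rightarrow> bool" where
  "rows_to_rows C f \<longleftrightarrow> (\<forall>p\<in>C. \<forall>q\<in>C. fst p = fst q \<longrightarrow> fst (f p) = fst (f q))"

definition cols_to_cols :: "('a \<times> 'b) set \<Rightarrow> ('a \<times> 'b \<Rightarrow> 'c \<times> 'd) \<Rightarrow> bool" where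
  "cols_to_cols C f \<longleftrightarrow> (\<forall>p\<in>C. \<forall>q\<in>C. snd p = snd q \<longrightarrow> snd (f p) = snd (f q))"

lemma rows_to_rowsD:
  "rows_to_rows C f \<Longrightarrow> p \<in> C \<Longrightarrow> q \<in> C \<Longrightarrow> fst p = fst q \<Longrightarrow> fst (f p) = fst (f q)"
  unfolding rows_to_rows_def by blast

text \<open>
  Suppose that row \<open>s\<close> goes into a row while column \<open>u\<close> does not go into a column. Then the row that contains
  the image of \<open>(s, u)\<close> contains the images of two pairs of row \<open>s\<close> and of a further pair of column \<open>u\<close>.
  The inverse map sends that row into a line, but no line contains these three pairs.
\<close>

lemma row_forces_col:
  assumes C: "linked_grid C A B" and D: "linked_grid D A' B'" and f: "grid_iso C A B D A' B' f"
    and row: "\<And>u u'. (s, u) \<in> C \<Longrightarrow> (s, u') \<in> C \<Longrightarrow> fst (f (s, u)) = fst (f (s, u'))"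
    and p: "(s, u) \<in> C" and q: "(s', u) \<in> C"
  shows "snd (f (s, u)) = snd (f (s', u))"
proof (cases "s = s'")
  case False
  interpret C: linked_grid C A B by fact
  have fD: "\<And>p. p \<in> C \<Longrightarrow> f p \<in> D" and inj: "inj_on f C"
    and hom: "\<And>p q. p \<in> C \<Longrightarrow> q \<in> C \<Longrightarrow> edge A B p q \<Longrightarrow> edge A' B' (f p) (f q)"
    using f by (auto simp: grid_iso_def bij_betw_def)
  have iD: "\<And>p. p \<in> D \<Longrightarrow> inv_into C f p \<in> C" and
    ihom: "\<And>p q. p \<in> D \<Longrightarrow> q \<in> D \<Longrightarrow> edge A' B' p q \<Longrightarrow> edge A B (inv_into C f p) (inv_into C f q)"
    using grid_iso_inv[OF f] by (auto simp: grid_iso_def bij_betw_def)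
  obtain v where v: "(s, v) \<in> C" "v \<noteq> u" using C.rows.nontrivial[OF p] by blast
  obtain t w where tw: "f (s, u) = (t, w)" by fastforce
  show ?thesis
  proof (rule ccontr)
    assume "snd (f (s, u)) \<noteq> snd (f (s', u))"
    then have "fst (f (s, u)) = fst (f (s', u))"
      using col_in_line[where f = f and u = u, OF C D fD hom] p q by blast
    moreover have "fst (f (s, v)) = fst (f (s, u))" using row p v by blast
    ultimately obtain w' w'' where w: "f (s', u) = (t, w')" "f (s, v) = (t, w'')"
      using tw by (metis fst_conv surj_pair)
    have inD: "(t, w) \<in> D" "(t, w') \<in> D" "(t, w'') \<in> D" using fD p q v tw w by metis+
    have inv: "inv_into C f (t, w) = (s, u)" "inv_into C f (t, w') = (s', u)" "inv_into C f (t, w'') = (s, v)"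
      using inv_into_f_f[OF inj] p q v tw w by metis+
    from row_in_line[where f = "inv_into C f" and s = t, OF D C iD ihom] inD inv have
      "fst (s, u) = fst (s', u) \<or> snd (s, u) = snd (s, v)" by metis
    with False v show False by simp
  qed
qed simp

text \<open>
  One row that goes into a row forces the columns that meet it to go into columns, and these force
  the remaining rows, since any row shares a column with the given one.
\<close>

lemma rows_to_rows_from_one:
  assumes C: "linked_grid C A B" and D: "linked_grid D A' B'" and f: "grid_iso C A B D A' B' f"
    and row: "\<And>u u'. (s, u) \<in> C \<Longrightarrow> (s, u') \<in> C \<Longrightarrow> fst (f (s, u)) = fst (f (s, u'))"
    and s: "s \<in> fst ` C"
  shows "rows_to_rows C f \<and> cols_to_cols C f"
proof -
  interpret C: linked_grid C A B by fact
  have mem: "(x, y) \<in> prod.swap ` C \<longleftrightarrow> (y, x) \<in> C" for x y by force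
  have fD: "\<And>p. p \<in> C \<Longrightarrow> f p \<in> D"
    and hom: "\<And>p q. p \<in> C \<Longrightarrow> q \<in> C \<Longrightarrow> edge A B p q \<Longrightarrow> edge A' B' (f p) (f q)"
    using f by (auto simp: grid_iso_def bij_betw_def)
  have col: "snd (f (a, u)) = snd (f (b, u))" if "(s, u) \<in> C" "(a, u) \<in> C" "(b, u) \<in> C" for a b u
    using row_forces_col[OF C D f row] that by metis
  have rowall: "fst (f (r, u)) = fst (f (r, v))" if "(r, u) \<in> C" "(r, v) \<in> C" for r u v
  proof -
    have "r \<in> fst ` C" using that by force
    then obtain w where w: "(s, w) \<in> C" "(r, w) \<in> C" using C.rows.common s by blast
    have iso: "grid_iso (prod.swap ` C) B A (prod.swap ` D) B' A' (prod.swap \<circ> (f \<circ> prod.swap))"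
      using grid_iso_cod_swap grid_iso_dom_swap f by blast
    have "fst ((prod.swap \<circ> (f \<circ> prod.swap)) (w, a)) = fst ((prod.swap \<circ> (f \<circ> prod.swap)) (w, b))"
      if "(w, a) \<in> prod.swap ` C" "(w, b) \<in> prod.swap ` C" for a b
      using that col[OF w(1), of a b] by (simp add: mem)
    note forced = row_forces_col[where s = w, OF linked_grid_swap[OF C] linked_grid_swap[OF D] iso this]
    have "fst (f (r, w)) = fst (f (r, x))" if "(r, x) \<in> C" for x
      using forced[of r x] w(2) that by (simp add: mem)
    from this[OF that(1)] this[OF that(2)] show ?thesis by simp
  qed
  have colall: "snd (f (a, u)) = snd (f (b, u))" if "(a, u) \<in> C" "(b, u) \<in> C" for a b u
    using row_forces_col[OF C D f rowall that] .
  show ?thesis by (auto simp: rows_to_rows_def cols_to_cols_def intro: rowall colall)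
qed

lemma grid_iso_dichotomy:
  assumes C: "linked_grid C A B" and D: "linked_grid D A' B'" and f: "grid_iso C A B D A' B' f"
  shows "rows_to_rows C f \<and> cols_to_cols C f \<or>
    rows_to_rows C (prod.swap \<circ> f) \<and> cols_to_cols C (prod.swap \<circ> f)"
proof (cases "C = {}")
  case False
  then obtain s where s: "s \<in> fst ` C" by blast
  have fD: "\<And>p. p \<in> C \<Longrightarrow> f p \<in> D"
    and hom: "\<And>p q. p \<in> C \<Longrightarrow> q \<in> C \<Longrightarrow> edge A B p q \<Longrightarrow> edge A' B' (f p) (f q)"
    using f by (auto simp: grid_iso_def bij_betw_def)
  from row_in_line[where f = f and s = s, OF C D fD hom] show ?thesis
  proof
    assume "\<forall>u u'. (s, u) \<in> C \<longrightarrow> (s, u') \<in> C \<longrightarrow> fst (f (s, u)) = fst (f (s, u'))"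
    then have "\<And>u u'. (s, u) \<in> C \<Longrightarrow> (s, u') \<in> C \<Longrightarrow> fst (f (s, u)) = fst (f (s, u'))" by blast
    from rows_to_rows_from_one[OF C D f this s] show ?thesis by blast
  next
    assume "\<forall>u u'. (s, u) \<in> C \<longrightarrow> (s, u') \<in> C \<longrightarrow> snd (f (s, u)) = snd (f (s, u'))"
    then have "\<And>u u'. (s, u) \<in> C \<Longrightarrow> (s, u') \<in> C \<Longrightarrow>
        fst ((prod.swap \<circ> f) (s, u)) = fst ((prod.swap \<circ> f) (s, u'))"
      unfolding comp_def fst_swap by blast
    from rows_to_rows_from_one[OF C linked_grid_swap[OF D] grid_iso_cod_swap[OF f] this s]
    show ?thesis by blast
  qed
qed (auto simp: rows_to_rows_def cols_to_cols_def)

text \<open>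
  A map that sends rows to rows and columns to columns acts on the two components separately. The same
  applied to the inverse map makes the two component maps bijective and shows that membership in the
  grid is reflected.
\<close>

lemma factor_through_coordinates:
  assumes f: "bij_betw f C D"
    and r: "rows_to_rows C f" "cols_to_cols C f"
    and i: "rows_to_rows D (inv_into C f)" "cols_to_cols D (inv_into C f)"
  shows "\<exists>\<phi> \<psi>. bij_betw \<phi> (fst ` C) (fst ` D) \<and> bij_betw \<psi> (snd ` C) (snd ` D) \<and>
     (\<forall>p\<in>C. f p = map_prod \<phi> \<psi> p) \<and>
     (\<forall>s\<in>fst ` C. \<forall>u\<in>snd ` C. (s, u) \<in> C \<longleftrightarrow> (\<phi> s, \<psi> u) \<in> D)"
proof -
  have *: "\<exists>\<phi> \<psi>. \<forall>p\<in>E. g p = map_prod \<phi> \<psi> p"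
    if "rows_to_rows E g" "cols_to_cols E g"
    for E :: "('x \<times> 'y) set" and g :: "'x \<times> 'y \<Rightarrow> 'z \<times> 'w"
  proof (intro exI ballI)
    fix p assume p: "p \<in> E"
    define q r where "q = (SOME q. q \<in> E \<and> fst q = fst p)" and "r = (SOME q. q \<in> E \<and> snd q = snd p)"
    have q: "q \<in> E \<and> fst q = fst p" unfolding q_def by (rule someI[of _ p]) (use p in simp)
    have r: "r \<in> E \<and> snd r = snd p" unfolding r_def by (rule someI[of _ p]) (use p in simp)
    have "fst (g q) = fst (g p)" using that(1) p q unfolding rows_to_rows_def by blast
    moreover have "snd (g r) = snd (g p)" using that(2) p r unfolding cols_to_cols_def by blast
    ultimately show "g p = map_prod (\<lambda>s. fst (g (SOME q. q \<in> E \<and> fst q = s)))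
        (\<lambda>u. snd (g (SOME q. q \<in> E \<and> snd q = u))) p"
      unfolding q_def r_def by (simp add: prod_eq_iff)
  qed
  obtain \<phi> \<psi> where fp: "\<And>p. p \<in> C \<Longrightarrow> f p = (\<phi> (fst p), \<psi> (snd p))"
    using *[OF r] by (auto simp: map_prod_def case_prod_beta)
  obtain \<phi>' \<psi>' where ip: "\<And>p. p \<in> D \<Longrightarrow> inv_into C f p = (\<phi>' (fst p), \<psi>' (snd p))"
    using *[OF i] by (auto simp: map_prod_def case_prod_beta)
  have inv: "inv_into C f (f p) = p" if "p \<in> C" for p
    using that f by (simp add: bij_betw_def)
  have inv': "f (inv_into C f p) = p" "inv_into C f p \<in> C" if "p \<in> D" for p
    using that f by (auto simp: bij_betw_def f_inv_into_f inv_into_into)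
  have fD: "f p \<in> D" if "p \<in> C" for p using that f by (auto simp: bij_betw_def)
  have 1: "\<phi>' (\<phi> (fst p)) = fst p \<and> \<psi>' (\<psi> (snd p)) = snd p" if "p \<in> C" for p
    using inv[OF that] ip[OF fD[OF that]] fp[OF that] by (cases p) simp
  have 2: "\<phi> (\<phi>' (fst p)) = fst p \<and> \<psi> (\<psi>' (snd p)) = snd p" if "p \<in> D" for p
    using inv'(1)[OF that] ip[OF that] fp[OF inv'(2)[OF that]] by (cases p) simp
  have img: "\<phi> (fst p) \<in> fst ` D \<and> \<psi> (snd p) \<in> snd ` D" if "p \<in> C" for p
    using fD[OF that] fp[OF that] by force
  have img': "\<phi>' (fst p) \<in> fst ` C \<and> \<psi>' (snd p) \<in> snd ` C" if "p \<in> D" for p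
    using inv'(2)[OF that] ip[OF that] by force
  have "bij_betw \<phi> (fst ` C) (fst ` D)"
    by (rule bij_betw_byWitness[where f' = \<phi>']) (use 1 2 img img' in auto)
  moreover have "bij_betw \<psi> (snd ` C) (snd ` D)"
    by (rule bij_betw_byWitness[where f' = \<psi>']) (use 1 2 img img' in auto)
  moreover have "\<forall>s\<in>fst ` C. \<forall>u\<in>snd ` C. (s, u) \<in> C \<longleftrightarrow> (\<phi> s, \<psi> u) \<in> D"
  proof (intro ballI iffI)
    fix s u assume "s \<in> fst ` C" "u \<in> snd ` C" and D: "(\<phi> s, \<psi> u) \<in> D"
    then have "\<phi>' (\<phi> s) = s" "\<psi>' (\<psi> u) = u" using 1 by auto
    then have "inv_into C f (\<phi> s, \<psi> u) = (s, u)" using ip[OF D] by simp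
    then show "(s, u) \<in> C" using inv'(2)[OF D] by simp
  next
    fix s u assume "(s, u) \<in> C"
    then show "(\<phi> s, \<psi> u) \<in> D" using fD fp by fastforce
  qed
  ultimately show ?thesis using fp by (intro exI[of _ \<phi>] exI[of _ \<psi>]) auto
qed

text \<open>
  The component maps of a grid isomorphism that sends rows to rows: they preserve and reflect membership
  in the grid as well as adjacency of the components.
\<close>

definition product_iso where
  "product_iso C A B D A' B' \<phi> \<psi> \<longleftrightarrow>
     bij_betw \<phi> (fst ` C) (fst ` D) \<and> bij_betw \<psi> (snd ` C) (snd ` D) \<and>
     (\<forall>s\<in>fst ` C. \<forall>u\<in>snd ` C. (s, u) \<in> C \<longleftrightarrow> (\<phi> s, \<psi> u) \<in> D) \<and>
     (\<forall>s\<in>fst ` C. \<forall>s'\<in>fst ` C. A s s' \<longleftrightarrow> A' (\<phi> s) (\<phi> s')) \<and>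
     (\<forall>u\<in>snd ` C. \<forall>u'\<in>snd ` C. B u u' \<longleftrightarrow> B' (\<psi> u) (\<psi> u'))"

text \<open>
  The alternative, that the inverse turns rows into columns, fails on two pairs of a single row.
\<close>

lemma inverse_rows_to_rows:
  assumes C: "linked_grid C A B" and D: "linked_grid D A' B'" and f: "grid_iso C A B D A' B' f"
    and r: "rows_to_rows C f" "cols_to_cols C f"
  shows "rows_to_rows D (inv_into C f) \<and> cols_to_cols D (inv_into C f)"
proof (cases "C = {}")
  case True
  then have "D = {}" using f by (simp add: grid_iso_def bij_betw_def)
  then show ?thesis by (simp add: rows_to_rows_def cols_to_cols_def)
next
  case False
  interpret C: linked_grid C A B by fact
  have inv: "inv_into C f (f p) = p" "f p \<in> D" if "p \<in> C" for p
    using that f by (auto simp add: bij_betw_def grid_iso_def)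
  from False obtain s u where su: "(s, u) \<in> C" by fastforce
  then obtain v where v: "(s, v) \<in> C" "v \<noteq> u" using C.rows.nontrivial by blast
  have "\<not> rows_to_rows D (prod.swap \<circ> inv_into C f)"
  proof
    assume "rows_to_rows D (prod.swap \<circ> inv_into C f)"
    moreover have "fst (f (s, u)) = fst (f (s, v))" using rows_to_rowsD[OF r(1) su v(1)] by simp
    ultimately have "fst (prod.swap (inv_into C f (f (s, u)))) = fst (prod.swap (inv_into C f (f (s, v))))"
      using rows_to_rowsD[OF _ inv(2)[OF su] inv(2)[OF v(1)], of "prod.swap \<circ> inv_into C f"]
      unfolding comp_def by blast
    then show False using inv(1) su v by simp
  qed
  then show ?thesis using grid_iso_dichotomy[OF D C grid_iso_inv[OF f]] by blast
qed

text \<open>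
  Adjacency of two first components is visible on pairs that have a common second component.
\<close>

lemma grid_iso_rows_to_rows_product:
  assumes C: "linked_grid C A B" and D: "linked_grid D A' B'" and f: "grid_iso C A B D A' B' f"
    and r: "rows_to_rows C f" "cols_to_cols C f"
  shows "\<exists>\<phi> \<psi>. product_iso C A B D A' B' \<phi> \<psi> \<and> (\<forall>p\<in>C. f p = map_prod \<phi> \<psi> p)"
proof -
  interpret C: linked_grid C A B by fact
  interpret D: linked_grid D A' B' by fact
  have bij: "bij_betw f C D" using f by (simp add: grid_iso_def)
  obtain \<phi> \<psi> where *: "bij_betw \<phi> (fst ` C) (fst ` D)" "bij_betw \<psi> (snd ` C) (snd ` D)"
     "\<forall>p\<in>C. f p = map_prod \<phi> \<psi> p"
     "\<forall>s\<in>fst ` C. \<forall>u\<in>snd ` C. (s, u) \<in> C \<longleftrightarrow> (\<phi> s, \<psi> u) \<in> D"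
    using factor_through_coordinates[OF bij r] inverse_rows_to_rows[OF C D f r] by blast
  have edge: "edge A B (s, u) (s', u') \<longleftrightarrow> edge A' B' (\<phi> s, \<psi> u) (\<phi> s', \<psi> u')"
    if "(s, u) \<in> C" "(s', u') \<in> C" for s u s' u'
    using that f *(3) unfolding grid_iso_def by fastforce
  have "A s s' \<longleftrightarrow> A' (\<phi> s) (\<phi> s')" if "s \<in> fst ` C" "s' \<in> fst ` C" for s s'
  proof -
    obtain u where "(s, u) \<in> C" "(s', u) \<in> C" using C.rows.common \<open>s \<in> fst ` C\<close> \<open>s' \<in> fst ` C\<close> by blast
    then show ?thesis using edge[of s u s' u] C.rows.irrefl D.rows.irrefl by (simp add: edge_def)
  qed
  moreover have "B u u' \<longleftrightarrow> B' (\<psi> u) (\<psi> u')" if "u \<in> snd ` C" "u' \<in> snd ` C" for u u'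
  proof -
    have "u \<in> fst ` prod.swap ` C" "u' \<in> fst ` prod.swap ` C" using that by (auto simp: image_image)
    then obtain s where "(s, u) \<in> C" "(s, u') \<in> C" using C.cols.common[of u u'] by auto
    then show ?thesis using edge[of s u s u'] C.cols.irrefl D.cols.irrefl by (simp add: edge_def)
  qed
  ultimately have "product_iso C A B D A' B' \<phi> \<psi>" using * by (simp add: product_iso_def)
  with *(3) show ?thesis by blast
qed

theorem grid_iso_cases:
  assumes C: "linked_grid C A B" and D: "linked_grid D A' B'" and f: "grid_iso C A B D A' B' f"
  obtains (rows) \<phi> \<psi> where "product_iso C A B D A' B' \<phi> \<psi>" "\<forall>p\<in>C. f p = map_prod \<phi> \<psi> p"
    | (cols) \<phi> \<psi> where "product_iso C A B (prod.swap ` D) B' A' \<phi> \<psi>"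
        "\<forall>p\<in>C. f p = twisted_prod \<phi> \<psi> p"
proof -
  from grid_iso_dichotomy[OF C D f] show thesis
  proof
    assume "rows_to_rows C f \<and> cols_to_cols C f"
    then show thesis using grid_iso_rows_to_rows_product[OF C D f] rows by blast
  next
    assume "rows_to_rows C (prod.swap \<circ> f) \<and> cols_to_cols C (prod.swap \<circ> f)"
    then obtain \<phi> \<psi> where *: "product_iso C A B (prod.swap ` D) B' A' \<phi> \<psi>"
        "\<forall>p\<in>C. (prod.swap \<circ> f) p = map_prod \<phi> \<psi> p"
      using grid_iso_rows_to_rows_product[OF C linked_grid_swap[OF D] grid_iso_cod_swap[OF f]] by blast
    have "f p = twisted_prod \<phi> \<psi> p" if "p \<in> C" for p
    proof -
      have "f p = prod.swap (map_prod \<phi> \<psi> p)" using *(2) that by (metis comp_apply swap_swap)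
      then show ?thesis by (cases p) (simp add: twisted_prod_def)
    qed
    with * show thesis using cols by blast
  qed
qed

section \<open>Grassmannians and complements\<close>

context fin_dim_space
begin

abbreviation adj :: "'v set \<Rightarrow> 'v set \<Rightarrow> bool" where "adj \<equiv> adjacent_subspaces scale"

lemma adj_iff:
  "adj P T \<longleftrightarrow> sub P \<and> sub T \<and> dim P = Suc (dim (P \<inter> T)) \<and> dim T = Suc (dim (P \<inter> T))"
  unfolding adjacent_subspaces_def has_dim_iff using sub_Int by auto

lemma adj_sym: "adj P T \<Longrightarrow> adj T P"
  by (auto simp: adj_iff Int_commute)

lemma adj_irrefl: "\<not> adj P P"
  by (simp add: adj_iff)

lemma Gr_eqI: "P \<in> Gr d \<Longrightarrow> T \<in> Gr d \<Longrightarrow> P \<subseteq> T \<Longrightarrow> P = T"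
  using dim_eq_imp_eq[of P T] by (simp add: Gr_iff)

lemma Gr_Int_less:
  assumes "P \<in> Gr d" "T \<in> Gr d" "P \<noteq> T" shows "dim (P \<inter> T) < d"
proof -
  have "\<not> P \<subseteq> T" using Gr_eqI assms by blast
  then have "P \<inter> T \<subset> P" by blast
  then show ?thesis using dim_less[of "P \<inter> T" P] assms sub_Int by (simp add: Gr_iff)
qed

lemma adj_if_common_lower:
  assumes "P \<in> Gr (Suc d)" "T \<in> Gr (Suc d)" "P \<noteq> T" "H \<in> Gr d" "H \<subseteq> P" "H \<subseteq> T"
  shows "adj P T"
proof -
  have "dim H \<le> dim (P \<inter> T)" using assms sub_Int by (intro dim_mono) (auto simp: Gr_iff)
  then show ?thesis using Gr_Int_less[OF assms(1-3)] assms by (auto simp: adj_iff Gr_iff)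
qed

lemma adj_if_common_upper:
  assumes "P \<in> Gr d" "T \<in> Gr d" "P \<noteq> T" "R \<in> Gr (Suc d)" "P \<subseteq> R" "T \<subseteq> R"
  shows "adj P T"
proof -
  have sub: "sub P" "sub T" "sub R" using assms by (auto simp: Gr_iff)
  have "dim (ssum P T) \<le> dim R"
    using assms sub by (intro dim_mono sub_ssum ssum_least) auto
  then show ?thesis
    using Gr_Int_less[OF assms(1-3)] assms sub dim_ssum[OF sub(1,2)] by (auto simp: adj_iff Gr_iff)
qed

lemma adj_ssum: "adj P T \<Longrightarrow> P \<in> Gr d \<Longrightarrow> ssum P T \<in> Gr (Suc d)"
  using dim_ssum[of P T] by (auto simp: adj_iff Gr_iff sub_ssum)

lemma adj_Int: "adj P T \<Longrightarrow> P \<in> Gr (Suc d) \<Longrightarrow> P \<inter> T \<in> Gr d"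
  by (auto simp: adj_iff Gr_iff sub_Int)

lemma adjoin_Gr: "P \<in> Gr d \<Longrightarrow> v \<notin> P \<Longrightarrow> adjoin v P \<in> Gr (Suc d)"
  by (simp add: Gr_iff sub_adjoin dim_adjoin)

lemma Gr_0: "Gr 0 = {{0}}"
  using dim_eq_0 by (auto simp: Gr_iff)

lemma Gr_n: "Gr n = {UNIV}"
proof -
  have "S \<in> Gr n \<longleftrightarrow> S = UNIV" for S by (metis Gr_iff dim_eq_n sub_UNIV)
  then show ?thesis by blast
qed

lemma Gr_ex_vector:
  assumes "S \<in> Gr d" "T \<in> Gr e" "e < d" shows "\<exists>v. v \<in> S \<and> v \<notin> T"
  using dim_mono[of S T] assms by (auto simp: Gr_iff)

lemma Gr_ex_nonzero: "S \<in> Gr d \<Longrightarrow> 0 < d \<Longrightarrow> \<exists>v. v \<in> S \<and> v \<noteq> 0"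
  using Gr_ex_vector[of S d "{0}" 0] by (simp add: Gr_0)

lemma Gr_outside: "S \<in> Gr d \<Longrightarrow> d < n \<Longrightarrow> \<exists>v. v \<notin> S"
  using Gr_ex_vector[of UNIV n S d] by (simp add: Gr_n)

lemma Gr_ex_upper:
  assumes "S \<in> Gr d" "d \<le> e" "e \<le> n" shows "\<exists>T\<in>Gr e. S \<subseteq> T"
  using intermediate_subspace[of S UNIV e] assms by (auto simp: Gr_iff)

lemma Gr_ex_lower:
  assumes "S \<in> Gr d" "e \<le> d" shows "\<exists>T\<in>Gr e. T \<subseteq> S"
  using intermediate_subspace[of "{0}" S e] assms sub_0 by (auto simp: Gr_iff)

lemma two_subspaces_not_cover:
  assumes "sub A" "sub B" "A \<noteq> UNIV" "B \<noteq> UNIV" shows "\<exists>v. v \<notin> A \<and> v \<notin> B"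
proof (rule ccontr)
  assume no: "\<not> ?thesis"
  obtain a where a: "a \<notin> A" using assms by blast
  obtain b where b: "b \<notin> B" using assms by blast
  have "a \<in> B" "b \<in> A" using no a b by auto
  then have "a + b \<notin> A" "a + b \<notin> B"
    using a b sub_diff[OF assms(1) _ \<open>b \<in> A\<close>, of "a + b"] sub_diff[OF assms(2) _ \<open>a \<in> B\<close>, of "a + b"] by force+
  with no show False by (metis)
qed

lemma Int_0D: "A \<inter> B = {0} \<Longrightarrow> x \<in> A \<Longrightarrow> x \<in> B \<Longrightarrow> x = 0"
  by blast

lemma Int_0I: "sub A \<Longrightarrow> sub B \<Longrightarrow> (\<And>x. x \<in> A \<Longrightarrow> x \<in> B \<Longrightarrow> x = 0) \<Longrightarrow> A \<inter> B = {0}"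
  using sub_0 by blast

lemma Int_adjoin_0:
  assumes "sub A" "sub U" "adjoin v A \<inter> U = {0}" "v \<notin> A"
  shows "A \<inter> adjoin v U = {0}"
proof (rule Int_0I)
  fix x assume x: "x \<in> A" "x \<in> adjoin v U"
  then obtain c where c: "x - scale c v \<in> U" by (auto simp: adjoin_def)
  have "x \<in> adjoin v A" using x(1) subset_adjoin[of A v] by blast
  then have "x - scale c v \<in> adjoin v A"
    using sub_diff[OF sub_adjoin] sub_scale[OF sub_adjoin mem_adjoin] assms(1) by blast
  then have eq: "x = scale c v" using Int_0D[OF assms(3)] c by (metis eq_iff_diff_eq_0)
  then have "c = 0" using x(1) sub_scale_iff[OF assms(1)] assms(4) by blast
  with eq show "x = 0" by simp
qed (use assms sub_adjoin in auto)

text \<open>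
  As long as \<open>A + P\<close> is a proper subspace, a vector outside it can be adjoined to \<open>P\<close>.
\<close>

lemma complement_containing:
  assumes "A \<in> Gr i" "sub P" "A \<inter> P = {0}"
  shows "\<exists>U\<in>Gr (n - i). P \<subseteq> U \<and> A \<inter> U = {0}"
  using assms(2,3)
proof (induction "n - dim P" arbitrary: P rule: less_induct)
  case less
  have A: "sub A" "dim A = i" using assms(1) by (auto simp: Gr_iff)
  have dims: "dim (ssum A P) = i + dim P"
    using dim_ssum[OF A(1) less.prems(1)] less.prems(2) A by simp
  show ?case
  proof (cases "ssum A P = UNIV")
    case True
    then have "dim P = n - i" using dims by simp
    then have "P \<in> Gr (n - i)" using less.prems(1) by (simp add: Gr_iff)
    then show ?thesis using less.prems(2) by blast
  next
    case False
    then obtain v where v: "v \<notin> ssum A P" by blast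
    have vP: "v \<notin> P" using v ssum_upper2[OF A(1), of P] by blast
    have "A \<inter> adjoin v P = {0}"
    proof (rule Int_0I[OF A(1) sub_adjoin[OF less.prems(1)]])
      fix x assume x: "x \<in> A" "x \<in> adjoin v P"
      then obtain c where c: "x - scale c v \<in> P" by (auto simp: adjoin_def)
      have "scale c v = x + - (x - scale c v)" by simp
      then have "scale c v \<in> ssum A P"
        unfolding ssum_iff using x(1) sub_minus[OF less.prems(1) c] by blast
      then have "c = 0" using sub_scale_iff[OF sub_ssum[OF A(1) less.prems(1)]] v by blast
      with c x less.prems show "x = 0" by auto
    qed
    moreover have "n - dim (adjoin v P) < n - dim P"
      using dim_adjoin[OF less.prems(1) vP] dim_le[OF sub_adjoin[OF less.prems(1)], of v] by simp
    ultimately obtain U where "U \<in> Gr (n - i)" "adjoin v P \<subseteq> U" "A \<inter> U = {0}"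
      using less.hyps sub_adjoin[OF less.prems(1)] by blast
    then show ?thesis using subset_adjoin[of P v] by blast
  qed
qed

text \<open>
  Two proper subspaces do not cover the space. Adjoin a vector outside both \<open>A\<close> and \<open>B\<close> to each of them; a common
  complement of the larger spaces becomes one of \<open>A\<close> and \<open>B\<close> when that vector is put back.
\<close>

lemma common_complement:
  assumes "A \<in> Gr i" "B \<in> Gr i" "i \<le> n"
  shows "\<exists>U\<in>Gr (n - i). A \<inter> U = {0} \<and> B \<inter> U = {0}"
  using assms
proof (induction "n - i" arbitrary: i A B)
  case 0
  then have "n - i = 0" by simp
  then show ?case using Gr_0 sub_0 0 by (auto simp: Gr_iff)
next
  case (Suc d)
  have AB: "sub A" "sub B" "A \<noteq> UNIV" "B \<noteq> UNIV" using Suc by (auto simp: Gr_iff)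
  then obtain v where v: "v \<notin> A" "v \<notin> B" using two_subspaces_not_cover by blast
  have "d = n - Suc i" "Suc i \<le> n" using Suc by auto
  from Suc.hyps(1)[OF this(1) adjoin_Gr[OF Suc.prems(1) v(1)] adjoin_Gr[OF Suc.prems(2) v(2)] this(2)]
  obtain U where U: "U \<in> Gr (n - Suc i)" "adjoin v A \<inter> U = {0}" "adjoin v B \<inter> U = {0}" by blast
  have subU: "sub U" using U by (simp add: Gr_iff)
  have "v \<noteq> 0" using v sub_0[OF AB(1)] by auto
  then have "v \<notin> U" using Int_0D[OF U(2) mem_adjoin[OF AB(1)]] by blast
  then have "adjoin v U \<in> Gr (n - i)" using adjoin_Gr[OF U(1)] Suc by (simp add: Suc_diff_Suc)
  then show ?case using Int_adjoin_0[OF AB(1) subU U(2) v(1)] Int_adjoin_0[OF AB(2) subU U(3) v(2)] by blast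
qed

text \<open>
  Grow \<open>D\<close> and \<open>adjoin u D\<close> in parallel by the same vectors until the latter is all of \<open>U\<close>.
\<close>

lemma hyperplane_avoiding:
  assumes "sub D" "sub U" "D \<subseteq> U" "u \<in> U" "u \<notin> D"
  shows "\<exists>H. sub H \<and> D \<subseteq> H \<and> H \<subseteq> U \<and> u \<notin> H \<and> dim U = Suc (dim H)"
  using sub_adjoin[OF assms(1), of u] assms(2) adjoin_least[OF assms(2,3,4)]
proof (induction rule: subspace_extend_induct)
  case base
  then show ?case using assms dim_adjoin subset_adjoin by blast
next
  case (step R v)
  then obtain H where H: "sub H" "D \<subseteq> H" "H \<subseteq> R" "u \<notin> H" "dim R = Suc (dim H)" by blast
  have uR: "u \<in> R" using step(2) mem_adjoin[OF assms(1)] by blast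
  have vR: "v \<notin> R" using step by blast
  then have vH: "v \<notin> H" using H by blast
  have "u \<notin> adjoin v H"
  proof
    assume "u \<in> adjoin v H"
    then have "v \<in> adjoin u H" using adjoin_exchange H by blast
    moreover have "adjoin u H \<subseteq> R" using adjoin_least[OF step(1) H(3) uR] .
    ultimately show False using step by blast
  qed
  moreover have "adjoin v H \<subseteq> adjoin v R"
    using adjoin_least[OF sub_adjoin[OF step(1)] _ mem_adjoin[OF step(1)]] H(3) subset_adjoin[of R v]
    by (meson subset_trans)
  moreover have "dim (adjoin v R) = Suc (dim (adjoin v H))"
    using dim_adjoin[OF step(1) vR] dim_adjoin[OF H(1) vH] H(5) by simp
  moreover have "D \<subseteq> adjoin v H" using H(2) subset_adjoin[of H v] by blast
  ultimately show ?case using sub_adjoin[OF H(1)] by blast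
qed

text \<open>
  Keep the hyperplane \<open>H\<close> of a complement \<open>U\<close> of \<open>S\<close> and move one vector \<open>u\<close> of \<open>U\<close> outside \<open>H\<close> by a vector of \<open>S\<close>.
  Since \<open>u\<close> is still congruent modulo \<open>S\<close> to a vector of the new space, this is again a complement.
\<close>

lemma tilt_complement:
  assumes "sub S" "U \<in> Gr (Suc d)" "S \<inter> U = {0}" "H \<in> Gr d" "H \<subseteq> U" "u \<in> U" "u \<notin> H" "x \<in> S"
  shows "adjoin (u + x) H \<in> Gr (Suc d) \<and> S \<inter> adjoin (u + x) H = {0}"
proof
  have sub: "sub H" "sub U" using assms by (auto simp: Gr_iff)
  have "u + x \<notin> H"
  proof
    assume "u + x \<in> H"
    then have "u + x - u \<in> U" using assms sub_diff[OF sub(2)] by blast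
    then have "x = 0" using Int_0D[OF assms(3)] assms by simp
    with \<open>u + x \<in> H\<close> assms show False by simp
  qed
  then show "adjoin (u + x) H \<in> Gr (Suc d)" using adjoin_Gr assms by blast
  show "S \<inter> adjoin (u + x) H = {0}"
  proof (rule Int_0I[OF assms(1) sub_adjoin[OF sub(1)]])
    fix y assume y: "y \<in> S" "y \<in> adjoin (u + x) H"
    then obtain c where c: "y - scale c (u + x) \<in> H" by (auto simp: adjoin_def)
    have "y - scale c x = (y - scale c (u + x)) + scale c u" by (simp add: scale_simps)
    moreover have "(y - scale c (u + x)) + scale c u \<in> U"
      using c assms sub_add[OF sub(2)] sub_scale[OF sub(2)] by blast
    moreover have "y - scale c x \<in> S" using y assms sub_diff sub_scale by blast
    ultimately have "y - scale c x = 0" using Int_0D[OF assms(3)] by metis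
    then have eq: "y = scale c x" by simp
    then have "- scale c u \<in> H" using c by (simp add: scale_simps)
    then have "scale c u \<in> H" using sub_minus[OF sub(1)] by force
    then have "c = 0" using sub_scale_iff[OF sub(1)] assms by blast
    with eq show "y = 0" by simp
  qed
qed

text \<open>
  The linking complement \<open>W\<close> contains \<open>U \<inter> U''\<close>, which makes it equal or adjacent to \<open>U''\<close>, and is contained in
  \<open>U + U'\<close>, which makes it equal or adjacent to \<open>U'\<close>. In terms of linear maps from \<open>U\<close> to \<open>S\<close>, whose graphs are
  the complements, \<open>U'\<close> and \<open>U''\<close> belong to maps of rank one, and \<open>W\<close> to a map of rank one with the image
  of the first and the kernel of the second.
\<close>

lemma complements_linked:
  assumes "S \<in> Gr k" "U \<in> Gr (n - k)" "U' \<in> Gr (n - k)" "U'' \<in> Gr (n - k)" "k \<le> n"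
    "S \<inter> U = {0}" "adj U U'" "adj U U''"
  shows "\<exists>W\<in>Gr (n - k). S \<inter> W = {0} \<and> adj U W \<and> (W = U' \<or> adj W U') \<and> (W = U'' \<or> adj W U'')"
proof -
  obtain d where d: "n - k = Suc d" using assms by (auto simp: adj_iff Gr_iff)
  have sub: "sub S" "sub U" "sub U'" "sub U''" using assms by (auto simp: Gr_iff)
  define H where "H = U \<inter> U''"
  have H: "H \<in> Gr d" "H \<subseteq> U" "H \<subseteq> U''" using adj_Int[OF assms(8)] assms d by (auto simp: H_def)
  obtain u where u: "u \<in> U" "u \<notin> H" using Gr_ex_vector[OF _ H(1)] assms d by (metis lessI)
  have UU: "ssum U U' \<in> Gr (Suc (n - k))" using adj_ssum[OF assms(7,2)] .
  \<comment> \<open>the dimensions of \<open>S\<close> and \<open>U + U'\<close> add up to \<open>n + 1\<close>\<close>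
  have "dim (S \<inter> ssum U U') \<noteq> 0"
    using dim_ssum[of S "ssum U U'"] dim_le[OF sub_ssum[of S "ssum U U'"]] UU assms
    by (auto simp: Gr_iff)
  then have "S \<inter> ssum U U' \<noteq> {0}" by auto
  then obtain x where x: "x \<in> S" "x \<in> ssum U U'" "x \<noteq> 0"
    using sub_0[OF sub(1)] sub_0[OF sub_ssum[OF sub(2,3)]] by blast
  define W where "W = adjoin (u + x) H"
  have W: "W \<in> Gr (Suc d)" "S \<inter> W = {0}"
    using tilt_complement[OF sub(1) _ assms(6) H(1,2) u x(1)] assms d by (auto simp: W_def)
  have HW: "H \<subseteq> W" by (simp add: W_def subset_adjoin)
  have "W \<noteq> U"
  proof
    assume "W = U"
    then have "u + x \<in> U" using mem_adjoin[of H "u + x"] H by (simp add: W_def Gr_iff)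
    then have "x \<in> U" using sub_diff[OF sub(2), of "u + x" u] u by simp
    with x Int_0D[OF assms(6)] show False by blast
  qed
  then have "adj U W" using adj_if_common_lower[OF _ W(1) _ H(1,2) HW] assms d by metis
  moreover have "W = U'' \<or> adj W U''" using adj_if_common_lower[OF W(1) _ _ H(1) HW H(3)] assms d by metis
  moreover have "W \<subseteq> ssum U U'"
    unfolding W_def
  proof (rule adjoin_least)
    show "H \<subseteq> ssum U U'" using H(2) ssum_upper1[OF sub(3), of U] by blast
    have "u \<in> ssum U U'" using u ssum_upper1[OF sub(3), of U] by blast
    with x show "u + x \<in> ssum U U'" using sub_add sub_ssum sub by blast
  qed (use sub sub_ssum in blast)
  then have "W = U' \<or> adj W U'"
    using adj_if_common_upper[OF _ assms(3) _ UU] W(1) d ssum_upper2[OF sub(2), of U'] by metis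
  ultimately show ?thesis using W d by auto
qed

text \<open>
  Unless \<open>U = U'\<close>, one can tilt \<open>U\<close> about a hyperplane that contains \<open>U \<inter> U'\<close> so that it catches a further vector
  of \<open>U'\<close>.
\<close>

lemma complements_connected:
  assumes "S \<in> Gr k" "U \<in> Gr (n - k)" "U' \<in> Gr (n - k)" "k \<le> n" "S \<inter> U = {0}" "S \<inter> U' = {0}"
  shows "(\<lambda>V W. adj V W \<and> (V \<in> Gr (n - k) \<and> S \<inter> V = {0}) \<and> (W \<in> Gr (n - k) \<and> S \<inter> W = {0}))\<^sup>*\<^sup>* U U'"
    (is "?R\<^sup>*\<^sup>* U U'")
  using assms(2,5)
proof (induction "n - dim (U \<inter> U')" arbitrary: U rule: less_induct)
  case less
  show ?case
  proof (cases "U = U'")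
    case False
    have sub: "sub S" "sub U" "sub U'" using assms less by (auto simp: Gr_iff)
    have "\<not> U' \<subseteq> U" using Gr_eqI[OF assms(3) less.prems(1)] False by blast
    then obtain u' where u': "u' \<in> U'" "u' \<notin> U" by blast
    have "ssum S U = UNIV" using Gr_ssum_Int_0[OF assms(1) less.prems(1) assms(4)] less.prems by simp
    then obtain s u where su: "s \<in> S" "u \<in> U" "u' = s + u" by (metis UNIV_I ssum_iff)
    have "u \<notin> U'"
    proof
      assume "u \<in> U'"
      then have "u' - u \<in> U'" using u' sub_diff sub by blast
      then have "s = 0" using Int_0D[OF assms(6)] su by simp
      with su u' show False by simp
    qed
    then obtain H where H: "sub H" "U \<inter> U' \<subseteq> H" "H \<subseteq> U" "u \<notin> H" "dim U = Suc (dim H)"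
      using hyperplane_avoiding[OF sub_Int[OF sub(2,3)] sub(2) Int_lower1 su(2)] by blast
    define d where "d = dim H"
    have d: "H \<in> Gr d" "U \<in> Gr (Suc d)" "n - k = Suc d" using H sub less.prems by (auto simp: d_def Gr_iff)
    define W where "W = adjoin u' H"
    have u'_eq: "u' = u + s" using su by (simp add: add.commute)
    have W: "W \<in> Gr (Suc d)" "S \<inter> W = {0}"
      using tilt_complement[OF sub(1) d(2) less.prems(2) d(1) H(3) su(2) H(4) su(1)] u'_eq by (auto simp: W_def)
    have u'W: "u' \<in> W" by (simp add: W_def mem_adjoin H(1))
    have HW: "H \<subseteq> W" by (simp add: W_def subset_adjoin)
    have "adj U W" using adj_if_common_lower[OF d(2) W(1) _ d(1) H(3) HW] u'W u' by blast
    then have step: "?R U W" using less.prems W d by simp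
    have subW: "sub W" using W by (simp add: Gr_iff)
    have "U \<inter> U' \<subset> W \<inter> U'" using H(2) HW u' u'W by blast
    then have "dim (U \<inter> U') < dim (W \<inter> U')" using dim_less sub_Int sub subW by simp
    moreover have "dim (W \<inter> U') \<le> n" using dim_le sub_Int sub subW by simp
    ultimately have "?R\<^sup>*\<^sup>* W U'" using less.hyps[of W] W d by simp
    with step show ?thesis by (rule converse_rtranclp_into_rtranclp)
  qed simp
qed

text \<open>
  If \<open>x\<close> and \<open>u\<close> are nonzero vectors of \<open>S\<close> and \<open>U\<close>, then \<open>u + x\<close> lies in neither and can be put into
  another complement of \<open>S\<close>.
\<close>

lemma second_complement:
  assumes "S \<in> Gr k" "U \<in> Gr (n - k)" "S \<inter> U = {0}" "0 < k" "k < n"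
  shows "\<exists>U'\<in>Gr (n - k). S \<inter> U' = {0} \<and> U' \<noteq> U"
proof -
  have sub: "sub S" "sub U" using assms by (auto simp: Gr_iff)
  obtain x where x: "x \<in> S" "x \<noteq> 0" using Gr_ex_nonzero assms by blast
  obtain u where u: "u \<in> U" "u \<noteq> 0" using Gr_ex_nonzero[OF assms(2)] assms by auto
  have uS: "u + x \<notin> S"
    using sub_diff[OF sub(1), of "u + x" x] x u Int_0D[OF assms(3)] by auto
  have uU: "u + x \<notin> U"
    using sub_diff[OF sub(2), of "u + x" u] x u Int_0D[OF assms(3)] by auto
  have "S \<inter> adjoin (u + x) {0} = {0}"
  proof (rule Int_0I[OF sub(1) sub_adjoin[OF sub_zero]])
    fix y assume "y \<in> S" "y \<in> adjoin (u + x) {0}"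
    then obtain c where "y = scale c (u + x)" "scale c (u + x) \<in> S" by (auto simp: adjoin_def)
    then show "y = 0" using sub_scale_iff[OF sub(1)] uS by (cases "c = 0") auto
  qed
  then obtain U' where U': "U' \<in> Gr (n - k)" "adjoin (u + x) {0} \<subseteq> U'" "S \<inter> U' = {0}"
    using complement_containing[OF assms(1) sub_adjoin[OF sub_zero]] by blast
  then have "u + x \<in> U'" using mem_adjoin[OF sub_zero] by blast
  then show ?thesis using U' uU by blast
qed

lemma complementary_pairs_swap:
  "k \<le> n \<Longrightarrow> prod.swap ` complementary_pairs scale n k = complementary_pairs scale n (n - k)"
proof -
  assume k: "k \<le> n"
  have "(x, y) \<in> prod.swap ` complementary_pairs scale n k \<longleftrightarrow> (y, x) \<in> complementary_pairs scale n k" for x y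
    by force
  then show ?thesis using k complementary_pairs_iff[of k] complementary_pairs_iff[of "n - k"] by auto
qed

lemma complementary_pairs_fst:
  assumes "k \<le> n" shows "fst ` complementary_pairs scale n k = Gr k"
proof
  show "fst ` complementary_pairs scale n k \<subseteq> Gr k" using complementary_pairs_iff[OF assms] by auto
  show "Gr k \<subseteq> fst ` complementary_pairs scale n k"
  proof
    fix S assume "S \<in> Gr k"
    then obtain U where "(S, U) \<in> complementary_pairs scale n k"
      using complementary_pairs_iff[OF assms] common_complement[of S k S] assms by blast
    then show "S \<in> fst ` complementary_pairs scale n k" by force
  qed
qed

lemma complementary_pairs_snd:
  assumes "k \<le> n" shows "snd ` complementary_pairs scale n k = Gr (n - k)"
proof -
  have "snd ` complementary_pairs scale n k = fst ` prod.swap ` complementary_pairs scale n k"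
    by (simp add: image_image)
  then show ?thesis using complementary_pairs_fst[of "n - k"] complementary_pairs_swap assms by simp
qed

lemma linked_rows_complementary_pairs:
  assumes "0 < k" "k < n"
  shows "linked_rows (complementary_pairs scale n k) adj"
proof
  have k: "k \<le> n" using assms by simp
  note cp = complementary_pairs_iff[OF k]
  let ?C = "complementary_pairs scale n k"
  show "\<not> adj u u" for u by (rule adj_irrefl)
  show "adj u u' \<Longrightarrow> adj u' u" for u u' by (rule adj_sym)
  show "\<exists>w. (s, w) \<in> ?C \<and> adj u w \<and> (w = u' \<or> adj w u') \<and> (w = u'' \<or> adj w u'')"
    if "(s, u) \<in> ?C" "(s, u') \<in> ?C" "(s, u'') \<in> ?C" "adj u u'" "adj u u''" for s u u' u''
  proof -
    have c: "s \<in> Gr k" "u \<in> Gr (n - k)" "u' \<in> Gr (n - k)" "u'' \<in> Gr (n - k)" "s \<inter> u = {0}"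
      using that cp by auto
    from complements_linked[OF c(1-4) k c(5) that(4,5)] obtain w where
      "w \<in> Gr (n - k)" "s \<inter> w = {0}" "adj u w" "w = u' \<or> adj w u'" "w = u'' \<or> adj w u''" by blast
    moreover from this have "(s, w) \<in> ?C" using cp c by simp
    ultimately show ?thesis by blast
  qed
  show "(\<lambda>v w. adj v w \<and> (s, v) \<in> ?C \<and> (s, w) \<in> ?C)\<^sup>*\<^sup>* u u'"
    if "(s, u) \<in> ?C" "(s, u') \<in> ?C" for s u u'
  proof -
    have c: "s \<in> Gr k" "u \<in> Gr (n - k)" "u' \<in> Gr (n - k)" "s \<inter> u = {0}" "s \<inter> u' = {0}"
      using that cp by auto
    have "(s, v) \<in> ?C \<longleftrightarrow> v \<in> Gr (n - k) \<and> s \<inter> v = {0}" for v using cp c by simp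
    then show ?thesis using complements_connected[OF c(1-3) k c(4,5)] by simp
  qed
  show "\<exists>u'. (s, u') \<in> ?C \<and> u' \<noteq> u" if "(s, u) \<in> ?C" for s u
  proof -
    have c: "s \<in> Gr k" "u \<in> Gr (n - k)" "s \<inter> u = {0}" using that cp by auto
    from second_complement[OF this assms] show ?thesis using cp c(1) by auto
  qed
  show "\<exists>u. (s, u) \<in> ?C \<and> (s', u) \<in> ?C" if "s \<in> fst ` ?C" "s' \<in> fst ` ?C" for s s'
  proof -
    have "s \<in> Gr k" "s' \<in> Gr k" using that complementary_pairs_fst[OF k] by auto
    from common_complement[OF this k] this show ?thesis using cp by auto
  qed
qed

lemma linked_grid_complementary_pairs:
  assumes "0 < k" "k < n"
  shows "linked_grid (complementary_pairs scale n k) adj adj"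
  using linked_rows_complementary_pairs[of k] linked_rows_complementary_pairs[of "n - k"]
    complementary_pairs_swap[of k] assms by (simp add: linked_grid_def)

text \<open>
  Two subspaces of equal dimension are complements of one and the same subspace.
\<close>

lemma Gr_connected:
  assumes "A \<in> Gr i" "B \<in> Gr i" "i \<le> n"
  shows "(\<lambda>V W. adj V W \<and> V \<in> Gr i \<and> W \<in> Gr i)\<^sup>*\<^sup>* A B"
proof -
  obtain U where U: "U \<in> Gr (n - i)" "A \<inter> U = {0}" "B \<inter> U = {0}"
    using common_complement assms by blast
  have "(\<lambda>V W. adj V W \<and> (V \<in> Gr i \<and> U \<inter> V = {0}) \<and> (W \<in> Gr i \<and> U \<inter> W = {0}))\<^sup>*\<^sup>* A B"
    using complements_connected[OF U(1), of A B] assms U by (simp add: Int_commute)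
  then show ?thesis by (rule rtranclp_mono[THEN predicate2D, rotated]) blast
qed

text \<open>
  A vector of \<open>U'\<close> outside \<open>U\<close> is contained in some complement of \<open>U\<close>, and this is not a complement of \<open>U'\<close>.
\<close>

lemma complements_determine:
  assumes "U \<in> Gr (n - k)" "U' \<in> Gr (n - k)" "k \<le> n"
    and "\<And>S. S \<in> Gr k \<Longrightarrow> S \<inter> U = {0} \<Longrightarrow> S \<inter> U' = {0}"
  shows "U = U'"
proof (rule ccontr)
  assume "U \<noteq> U'"
  then obtain v where v: "v \<in> U'" "v \<notin> U" using Gr_eqI[OF assms(2,1)] by blast
  have sub: "sub U" "sub U'" using assms by (auto simp: Gr_iff)
  have "U \<inter> adjoin v {0} = {0}"
  proof (rule Int_0I[OF sub(1) sub_adjoin[OF sub_zero]])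
    fix y assume "y \<in> U" "y \<in> adjoin v {0}"
    then obtain c where "y = scale c v" "scale c v \<in> U" by (auto simp: adjoin_def)
    then show "y = 0" using sub_scale_iff[OF sub(1)] v by (cases "c = 0") auto
  qed
  then obtain S where S: "S \<in> Gr k" "adjoin v {0} \<subseteq> S" "U \<inter> S = {0}"
    using complement_containing[OF assms(1) sub_adjoin[OF sub_zero], of v] diff_diff_cancel[OF assms(3)] by auto
  have "v \<in> S" using S mem_adjoin[OF sub_zero] by blast
  moreover have "S \<inter> U' = {0}" using assms(4) S by blast
  ultimately have "v = 0" using v by blast
  with v sub_0[OF sub(1)] show False by simp
qed

text \<open>
  The space \<open>Z \<inter> (X + Y)\<close> is a proper subspace of \<open>Z\<close> and contains the hyperplanes \<open>X \<inter> Z\<close> and \<open>Y \<inter> Z\<close> of \<open>Z\<close>, so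
  all three coincide.
\<close>

lemma clique_third:
  assumes "adj X Y" "adj X Z" "adj Y Z" "\<not> Z \<subseteq> ssum X Y"
  shows "X \<inter> Z = X \<inter> Y \<and> Y \<inter> Z = X \<inter> Y"
proof -
  have sub: "sub X" "sub Y" "sub Z" using assms by (auto simp: adj_iff)
  define e where "e = dim (X \<inter> Y)"
  have dims: "dim Z = Suc e" "dim (X \<inter> Y) = e" "dim (X \<inter> Z) = e" "dim (Y \<inter> Z) = e"
    using assms by (auto simp: adj_iff e_def)
  define M where "M = Z \<inter> ssum X Y"
  have subM: "sub M" using sub by (simp add: M_def sub_Int sub_ssum)
  have "M \<subset> Z" using assms(4) by (auto simp: M_def)
  then have "dim M \<le> e" using dim_less[OF subM sub(3)] dims by simp
  moreover have "X \<inter> Z \<subseteq> M" "Y \<inter> Z \<subseteq> M"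
    using ssum_upper1[OF sub(2), of X] ssum_upper2[OF sub(1), of Y] by (auto simp: M_def)
  ultimately have "X \<inter> Z = M" "Y \<inter> Z = M"
    using dim_eq_imp_eq[OF _ subM] sub_Int sub dims by auto
  then have "X \<inter> Z \<subseteq> X \<inter> Y" "Y \<inter> Z \<subseteq> X \<inter> Y" by blast+
  then show ?thesis using dim_eq_imp_eq[of "X \<inter> Z" "X \<inter> Y"] dim_eq_imp_eq[of "Y \<inter> Z" "X \<inter> Y"]
      sub_Int sub dims by simp
qed

text \<open>
  If some \<open>Z0\<close> in the clique does not contain \<open>X \<inter> Y\<close>, then it lies in \<open>X + Y\<close> by \<open>clique_third\<close>. If some \<open>Z\<close> were not
  in \<open>X + Y\<close>, then \<open>Z\<close> would meet \<open>X\<close> in \<open>X \<inter> Y\<close> and also in \<open>X \<inter> Z0\<close>, so \<open>Z0\<close> would contain \<open>X \<inter> Y\<close> after all.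
\<close>

lemma clique_star_or_top:
  assumes Q: "Q \<subseteq> Gr (Suc d)" and clique: "\<And>X Y. X \<in> Q \<Longrightarrow> Y \<in> Q \<Longrightarrow> X \<noteq> Y \<Longrightarrow> adj X Y"
    and XY: "X \<in> Q" "Y \<in> Q" "X \<noteq> Y"
  shows "(\<exists>H\<in>Gr d. \<forall>Z\<in>Q. H \<subseteq> Z) \<or> (\<exists>R\<in>Gr (Suc (Suc d)). \<forall>Z\<in>Q. Z \<subseteq> R)"
proof (rule ccontr)
  assume no: "\<not> ?thesis"
  have a: "adj X Y" using clique XY by blast
  have "X \<inter> Y \<in> Gr d" using adj_Int[OF a] Q XY by blast
  then obtain Z0 where Z0: "Z0 \<in> Q" "\<not> X \<inter> Y \<subseteq> Z0" using no by blast
  have "ssum X Y \<in> Gr (Suc (Suc d))" using adj_ssum[OF a] Q XY by blast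
  then obtain Z where Z: "Z \<in> Q" "\<not> Z \<subseteq> ssum X Y" using no by blast
  have sub: "sub X" "sub Y" "sub Z0" using XY Z0 Q by (auto simp: Gr_iff)
  have "Z0 \<noteq> X" "Z0 \<noteq> Y" using Z0 by blast+
  have "Z \<noteq> X" "Z \<noteq> Y" using Z(2) ssum_upper1[OF sub(2), of X] ssum_upper2[OF sub(1), of Y] by blast+
  have Z0in: "Z0 \<subseteq> ssum X Y"
    using clique_third[OF a, of Z0] clique Z0 XY \<open>Z0 \<noteq> X\<close> \<open>Z0 \<noteq> Y\<close> by blast
  have "Z \<noteq> Z0" using Z0in Z by blast
  have eq: "X \<inter> Z = X \<inter> Y"
    using clique_third[OF a, of Z] clique Z XY \<open>Z \<noteq> X\<close> \<open>Z \<noteq> Y\<close> by blast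
  have "ssum X Z0 \<subseteq> ssum X Y"
    using ssum_least[OF sub_ssum[OF sub(1,2)] ssum_upper1[OF sub(2)] Z0in] .
  then have "\<not> Z \<subseteq> ssum X Z0" using Z by blast
  then have "X \<inter> Z = X \<inter> Z0"
    using clique_third[of X Z0 Z] clique Z Z0 XY \<open>Z0 \<noteq> X\<close> \<open>Z \<noteq> X\<close> \<open>Z \<noteq> Z0\<close> by metis
  with eq Z0 show False by blast
qed

end

section \<open>Orthogonality and the dual space\<close>

text \<open>
  The opposite ring turns right vector spaces, such as the dual space, into left vector spaces.
\<close>

datatype 'k opp = Opp (the_opp: 'k)

lemma the_opp_eq_0: "the_opp x = 0 \<longleftrightarrow> x = Opp 0"
  by (cases x) simp

instantiation opp :: (division_ring) division_ring
begin

definition "0 = Opp 0"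
definition "1 = Opp 1"
definition "x + y = Opp (the_opp x + the_opp y)"
definition "x - y = Opp (the_opp x - the_opp y)"
definition "- x = Opp (- the_opp x)"
definition "x * y = Opp (the_opp y * the_opp x)"
definition "inverse x = Opp (inverse (the_opp x))"
definition "divide x y = Opp (inverse (the_opp y) * the_opp x)"

instance
  by standard
    (auto simp: zero_opp_def one_opp_def plus_opp_def minus_opp_def uminus_opp_def times_opp_def
      inverse_opp_def divide_opp_def algebra_simps the_opp_eq_0 opp.expand)

end

lemma the_opp_simps [simp]:
  "the_opp 0 = 0" "the_opp 1 = 1" "the_opp (x + y) = the_opp x + the_opp y"
  "the_opp (x * y) = the_opp y * the_opp x"
  by (simp_all add: zero_opp_def one_opp_def plus_opp_def times_opp_def)

lemma the_opp_eq_0_iff [simp]: "the_opp x = 0 \<longleftrightarrow> x = 0"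
  by (simp add: the_opp_eq_0 zero_opp_def)

text \<open>
  A nondegenerate pairing between two spaces, reduced to the relation that the product vanishes. In this
  form the two sides play symmetric parts, although their scalars belong to different rings. A vector
  imposes at most one linear condition on the other space: that is the meaning of the two assumptions
  on codimension.
\<close>

locale orthogonality =
  V: fin_dim_space s1 n + W: fin_dim_space s2 n
  for s1 :: "'k::division_ring \<Rightarrow> 'v::ab_group_add \<Rightarrow> 'v"
    and s2 :: "'l::division_ring \<Rightarrow> 'w::ab_group_add \<Rightarrow> 'w"
    and n :: nat +
  fixes R :: "'v \<Rightarrow> 'w \<Rightarrow> bool"
  assumes sub_right: "W.sub {w. R v w}"
    and sub_left: "V.sub {v. R v w}"
    and codim_right: "\<exists>t. W.adjoin t {w. R v w} = UNIV"
    and codim_left: "\<exists>t. V.adjoin t {v. R v w} = UNIV"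
    and nondegenerate_right: "(\<And>v. R v w) \<Longrightarrow> w = 0"
    and nondegenerate_left: "(\<And>w. R v w) \<Longrightarrow> v = 0"

lemma orthogonality_swap: "orthogonality s1 s2 n R \<Longrightarrow> orthogonality s2 s1 n (\<lambda>w v. R v w)"
  by (simp add: orthogonality_def orthogonality_axioms_def)

definition perp :: "('v \<Rightarrow> 'w \<Rightarrow> bool) \<Rightarrow> 'v set \<Rightarrow> 'w set" where
  "perp R S = {w. \<forall>v\<in>S. R v w}"

context orthogonality begin

lemma sub_perp: "W.sub (perp R S)"
  using sub_right unfolding is_subspace_def perp_def by auto

lemma perp_adjoin:
  assumes "V.sub S" shows "perp R (V.adjoin v S) = perp R S \<inter> {w. R v w}"
proof (intro equalityI subsetI)
  fix w assume "w \<in> perp R (V.adjoin v S)"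
  then show "w \<in> perp R S \<inter> {w. R v w}"
    using V.subset_adjoin[of S v] V.mem_adjoin[OF assms, of v] by (auto simp: perp_def)
next
  fix w assume w: "w \<in> perp R S \<inter> {w. R v w}"
  then have "S \<subseteq> {u. R u w}" "v \<in> {u. R u w}" by (auto simp: perp_def)
  then have "V.adjoin v S \<subseteq> {u. R u w}" using V.adjoin_least[OF sub_left] by blast
  then show "w \<in> perp R (V.adjoin v S)" by (auto simp: perp_def)
qed

text \<open>
  The vectors orthogonal to \<open>v\<close> form a hyperplane or the whole space, so intersecting with them lowers a
  dimension by at most one.
\<close>

lemma dim_perp_adjoin:
  assumes "V.sub S" shows "W.dim (perp R S) \<le> Suc (W.dim (perp R (V.adjoin v S)))"
proof (cases "perp R S \<subseteq> {w. R v w}")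
  case True
  then show ?thesis using perp_adjoin[OF assms] by (simp add: Int_absorb2)
next
  case False
  then obtain p where p: "p \<in> perp R S" "p \<notin> {w. R v w}" by blast
  obtain t where "W.adjoin t {w. R v w} = UNIV" using codim_right by blast
  then have "perp R S = W.adjoin p (perp R S \<inter> {w. R v w})"
    using W.adjoin_Int[where v = t, OF sub_perp sub_right _ p] by simp
  then show ?thesis
    using W.dim_adjoin[OF sub_perp, of p "V.adjoin v S"] p perp_adjoin[OF assms, of v] by simp
qed

lemma dim_perp_mono:
  assumes "V.sub S" "V.sub T" "S \<subseteq> T"
  shows "W.dim (perp R S) + V.dim S \<le> W.dim (perp R T) + V.dim T"
proof -
  define c where "c = W.dim (perp R S) + V.dim S"
  have "c \<le> W.dim (perp R T) + V.dim T"
    using assms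
  proof (induction rule: V.subspace_extend_induct)
    case (step Q v)
    then show ?case using dim_perp_adjoin[of Q v] V.dim_adjoin[of Q v] by simp
  qed (simp add: c_def)
  then show ?thesis by (simp add: c_def)
qed

text \<open>
  Between \<open>{0}\<close> and the whole space there are \<open>n\<close> steps, in which the dimension of the orthogonal
  space falls from \<open>n\<close> to \<open>0\<close> while each step lowers it by at most one. So every step lowers it by exactly one.
\<close>

lemma dim_perp:
  assumes "V.sub S" shows "W.dim (perp R S) + V.dim S = n"
proof -
  have "R 0 w" for w using V.sub_0[OF sub_left] by blast
  then have "perp R {0} = UNIV" by (auto simp: perp_def)
  moreover have "perp R UNIV = {0}"
    using nondegenerate_right W.sub_0[OF sub_right] by (auto simp: perp_def)
  ultimately show ?thesis
    using dim_perp_mono[OF V.sub_zero assms] dim_perp_mono[OF assms V.sub_UNIV] V.sub_0[OF assms] by simp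
qed

lemma perp_Gr: "S \<in> V.Gr i \<Longrightarrow> perp R S \<in> W.Gr (n - i)"
  using dim_perp[of S] sub_perp by (auto simp: V.Gr_iff W.Gr_iff)

lemma perp_perp:
  assumes "V.sub S" shows "perp (\<lambda>w v. R v w) (perp R S) = S"
proof -
  interpret D: orthogonality s2 s1 n "\<lambda>w v. R v w" using orthogonality_swap orthogonality_axioms .
  have "V.dim (perp (\<lambda>w v. R v w) (perp R S)) = V.dim S"
    using D.dim_perp[OF sub_perp, of S] dim_perp[OF assms] by simp
  moreover have "S \<subseteq> perp (\<lambda>w v. R v w) (perp R S)" by (auto simp: perp_def)
  ultimately show ?thesis using V.dim_eq_imp_eq[OF assms D.sub_perp, of "perp R S"] by simp
qed

lemma perp_subset_iff:
  assumes "V.sub S" "V.sub T" shows "perp R S \<subseteq> perp R T \<longleftrightarrow> T \<subseteq> S"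
proof
  assume "perp R S \<subseteq> perp R T"
  then have "perp (\<lambda>w v. R v w) (perp R T) \<subseteq> perp (\<lambda>w v. R v w) (perp R S)" by (auto simp: perp_def)
  then show "T \<subseteq> S" using perp_perp assms by simp
qed (auto simp: perp_def)

lemma perp_ssum:
  assumes "V.sub S" "V.sub T" shows "perp R (V.ssum S T) = perp R S \<inter> perp R T"
proof (intro equalityI subsetI)
  fix w assume "w \<in> perp R (V.ssum S T)"
  then show "w \<in> perp R S \<inter> perp R T"
    using V.ssum_upper1[OF assms(2), of S] V.ssum_upper2[OF assms(1), of T] by (auto simp: perp_def)
next
  fix w assume "w \<in> perp R S \<inter> perp R T"
  then have "V.ssum S T \<subseteq> {u. R u w}"
    by (intro V.ssum_least[OF sub_left]) (auto simp: perp_def)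
  then show "w \<in> perp R (V.ssum S T)" by (auto simp: perp_def)
qed

lemma dim_perp_Int:
  assumes "V.sub S" "V.sub T"
  shows "W.dim (perp R S \<inter> perp R T) + V.dim (V.ssum S T) = n"
  using dim_perp[OF V.sub_ssum[OF assms]] perp_ssum[OF assms] by simp

text \<open>
  The intersection of the orthogonal spaces is the orthogonal space of the sum, so that its dimension is
  governed by \<open>dim_ssum\<close>.
\<close>

lemma adj_perp_iff:
  assumes "S \<in> V.Gr i" "T \<in> V.Gr i"
  shows "W.adj (perp R S) (perp R T) \<longleftrightarrow> V.adj S T"
proof -
  have s: "V.sub S" "V.sub T" "V.dim S = i" "V.dim T = i" using assms by (auto simp: V.Gr_iff)
  show ?thesis
    unfolding V.adj_iff W.adj_iff
    using s sub_perp dim_perp[OF s(1)] dim_perp[OF s(2)] dim_perp_Int[OF s(1,2)] V.dim_ssum[OF s(1,2)] by auto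
qed

lemma perp_Int_0_iff:
  assumes "S \<in> V.Gr i" "T \<in> V.Gr (n - i)" "i \<le> n"
  shows "perp R S \<inter> perp R T = {0} \<longleftrightarrow> S \<inter> T = {0}"
proof -
  have s: "V.sub S" "V.sub T" "V.dim S + V.dim T = n" using assms by (auto simp: V.Gr_iff)
  have "W.dim (perp R S \<inter> perp R T) = 0 \<longleftrightarrow> V.dim (S \<inter> T) = 0"
    using dim_perp_Int[OF s(1,2)] V.dim_ssum[OF s(1,2)] s(3) by linarith
  then show ?thesis using W.dim_eq_0[OF W.sub_Int[OF sub_perp sub_perp]] V.dim_eq_0[OF V.sub_Int[OF s(1,2)]] by simp
qed

lemma bij_perp:
  assumes "i \<le> n" shows "bij_betw (perp R) (V.Gr i) (W.Gr (n - i))"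
proof -
  interpret D: orthogonality s2 s1 n "\<lambda>w v. R v w" using orthogonality_swap orthogonality_axioms .
  show ?thesis
  proof (rule bij_betw_byWitness[where f' = "perp (\<lambda>w v. R v w)"])
    show "\<forall>S\<in>V.Gr i. perp (\<lambda>w v. R v w) (perp R S) = S" using perp_perp V.Gr_iff by blast
    show "\<forall>T\<in>W.Gr (n - i). perp R (perp (\<lambda>w v. R v w) T) = T" using D.perp_perp W.Gr_iff by blast
    show "perp R ` V.Gr i \<subseteq> W.Gr (n - i)" using perp_Gr by blast
    show "perp (\<lambda>w v. R v w) ` W.Gr (n - i) \<subseteq> V.Gr i"
      using D.perp_Gr[of _ "n - i"] assms by auto
  qed
qed

end

text \<open>
  A functional is determined by its values on a basis, which can be read as the coordinates of a vector.
  Transported to vectors, the right multiplication of functionals becomes right multiplication of the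
  coordinates. The evaluation of functionals becomes the pairing \<open>\<beta>\<close>.
\<close>

theorem (in fin_dim_space) dual_exists:
  shows "\<exists>(s2 :: 'k opp \<Rightarrow> 'v \<Rightarrow> 'v) (\<beta> :: 'v \<Rightarrow> 'v \<Rightarrow> 'k).
    orthogonality scale s2 n (\<lambda>v w. \<beta> v w = 0) \<and>
    (\<forall>v v' w. \<beta> (v + v') w = \<beta> v w + \<beta> v' w) \<and> (\<forall>a v w. \<beta> (scale a v) w = a * \<beta> v w) \<and>
    (\<forall>v w w'. \<beta> v (w + w') = \<beta> v w + \<beta> v w') \<and> (\<forall>x v w. \<beta> v (s2 x w) = \<beta> v w * the_opp x) \<and>
    (\<forall>\<phi>\<in>dual_space scale. \<exists>w. \<phi> = (\<lambda>v. \<beta> v w))"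
proof -
  obtain B where B: "is_basis scale B UNIV" "card B = n" using dim_UNIV by (auto simp: has_dim_def)
  have fin: "finite B" and ran: "UNIV = range (\<lambda>c. \<Sum>b\<in>B. scale (c b) b)"
    and ind: "\<And>c. (\<Sum>b\<in>B. scale (c b) b) = 0 \<Longrightarrow> \<forall>b\<in>B. c b = 0"
    using B by (auto simp: is_basis_def)
  have "\<exists>c. v = (\<Sum>b\<in>B. scale (c b) b)" for v using ran by blast
  then obtain c where c: "\<And>v. v = (\<Sum>b\<in>B. scale (c v b) b)" by metis
  have uniq: "d b = e b" if "(\<Sum>b\<in>B. scale (d b) b) = (\<Sum>b\<in>B. scale (e b) b)" "b \<in> B" for d e b
  proof -
    have "(\<Sum>b\<in>B. scale (d b - e b) b) = 0" using that(1) by (simp add: scale_diff_left sum_subtractf)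
    from ind[OF this] that(2) show ?thesis by simp
  qed
  have coord: "c (\<Sum>b\<in>B. scale (d b) b) b = d b" if "b \<in> B" for d b
    by (rule uniq[OF _ that]) (rule c[symmetric])
  have eqI: "v = w" if "\<And>b. b \<in> B \<Longrightarrow> c v b = c w b" for v w
    using c[of v] c[of w] that sum.cong[of B B "\<lambda>b. scale (c v b) b" "\<lambda>b. scale (c w b) b"] by simp
  have c_add: "c (v + w) b = c v b + c w b" if "b \<in> B" for v w b
  proof -
    have "v + w = (\<Sum>b\<in>B. scale (c v b + c w b) b)"
      using c[of v] c[of w] by (simp add: scale_left_distrib sum.distrib)
    then show ?thesis using coord[OF that, of "\<lambda>b. c v b + c w b"] by simp
  qed
  have scale_sum: "scale a (\<Sum>b\<in>A. g b) = (\<Sum>b\<in>A. scale a (g b))" if "finite A" for a A and g :: "'v \<Rightarrow> 'v"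
    using that by (induction A rule: finite_induct) (auto simp: scale_right_distrib)
  have c_scale: "c (scale a v) b = a * c v b" if "b \<in> B" for a v b
  proof -
    have "scale a v = (\<Sum>b\<in>B. scale (a * c v b) b)"
      using c[of v] scale_sum[OF fin, of a "\<lambda>b. scale (c v b) b"] by (simp add: scale_scale)
    then show ?thesis using coord[OF that, of "\<lambda>b. a * c v b"] by simp
  qed
  have c_basis: "c b' b = (if b = b' then 1 else 0)" if "b \<in> B" "b' \<in> B" for b b'
  proof -
    have "(\<Sum>b\<in>B. scale (if b = b' then 1 else 0) b) = (\<Sum>b\<in>B. if b = b' then b else 0)"
      by (rule sum.cong) (auto simp: scale_one)
    also have "\<dots> = b'" using fin that by simp
    finally show ?thesis using coord[OF that(1), of "\<lambda>b. if b = b' then 1 else 0"] by simp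
  qed
  \<comment> \<open>right multiplication of the coordinates, a left action of the opposite ring\<close>
  define s2 where "s2 = (\<lambda>x w. \<Sum>b\<in>B. scale (c w b * the_opp x) b)"
  have c_s2: "c (s2 x w) b = c w b * the_opp x" if "b \<in> B" for x w b
    unfolding s2_def using coord[OF that, of "\<lambda>b. c w b * the_opp x"] .
  define \<beta> where "\<beta> = (\<lambda>v w. \<Sum>b\<in>B. c v b * c w b)"
  have b_add1: "\<beta> (v + v') w = \<beta> v w + \<beta> v' w" for v v' w
    unfolding \<beta>_def sum.distrib[symmetric] by (rule sum.cong) (auto simp: c_add distrib_right)
  have b_add2: "\<beta> v (w + w') = \<beta> v w + \<beta> v w'" for v w w'
    unfolding \<beta>_def sum.distrib[symmetric] by (rule sum.cong) (auto simp: c_add distrib_left)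
  have b_s1: "\<beta> (scale a v) w = a * \<beta> v w" for a v w
    unfolding \<beta>_def sum_distrib_left by (rule sum.cong) (auto simp: c_scale mult.assoc)
  have b_s2: "\<beta> v (s2 x w) = \<beta> v w * the_opp x" for x v w
    unfolding \<beta>_def sum_distrib_right by (rule sum.cong) (auto simp: c_s2 mult.assoc)
  have b_basis1: "\<beta> b w = c w b" if "b \<in> B" for b w
  proof -
    have "\<beta> b w = (\<Sum>b'\<in>B. if b' = b then c w b' else 0)"
      unfolding \<beta>_def by (rule sum.cong) (auto simp: c_basis that)
    then show ?thesis using fin that by simp
  qed
  have b_basis2: "\<beta> v b = c v b" if "b \<in> B" for b v
  proof -
    have "\<beta> v b = (\<Sum>b'\<in>B. if b' = b then c v b' else 0)"
      unfolding \<beta>_def by (rule sum.cong) (auto simp: c_basis that)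
    then show ?thesis using fin that by simp
  qed
  have c_0: "c 0 b = 0" if "b \<in> B" for b using c_scale[OF that, of 0 0] by simp
  have b_01: "\<beta> 0 w = 0" for w using b_s1[of 0 0 w] by simp
  have b_02: "\<beta> v 0 = 0" for v using b_add2[of v 0 0] by simp
  interpret W: left_vector_space s2
  proof
    fix x y v w
    show "s2 x (v + w) = s2 x v + s2 x w" by (rule eqI) (simp add: c_s2 c_add distrib_right)
    show "s2 (x + y) v = s2 x v + s2 y v" by (rule eqI) (simp add: c_s2 c_add distrib_left)
    show "s2 x (s2 y v) = s2 (x * y) v" by (rule eqI) (simp add: c_s2 mult.assoc)
    show "s2 1 v = v" by (rule eqI) (simp add: c_s2)
  qed
  have s2_basis: "s2 x b = scale (the_opp x) b" if "b \<in> B" for x b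
    by (rule eqI) (auto simp: c_s2 c_scale c_basis that)
  have sum_s2: "(\<Sum>b\<in>B. s2 (d b) b) = (\<Sum>b\<in>B. scale (the_opp (d b)) b)" for d
    by (rule sum.cong) (auto simp: s2_basis)
  have "is_basis s2 B UNIV"
    unfolding is_basis_def
  proof (intro conjI allI impI)
    show "finite B" by (rule fin)
    have "v \<in> range (\<lambda>d. \<Sum>b\<in>B. s2 (d b) b)" for v
      by (rule range_eqI[where x = "\<lambda>b. Opp (c v b)"]) (simp add: sum_s2 c[symmetric])
    then show "UNIV = range (\<lambda>d. \<Sum>b\<in>B. s2 (d b) b)" by blast
    fix d assume "(\<Sum>b\<in>B. s2 (d b) b) = 0"
    then show "\<forall>b\<in>B. d b = 0" using ind[of "\<lambda>b. the_opp (d b)"] by (simp add: sum_s2)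
  qed
  then have dim2: "has_dim s2 UNIV n" using B(2) by (auto simp: has_dim_def)
  interpret W: fin_dim_space s2 n by unfold_locales (rule dim2)
  have "orthogonality scale s2 n (\<lambda>v w. \<beta> v w = 0)"
  proof
    fix v w :: 'v
    show "is_subspace s2 {w. \<beta> v w = 0}" by (auto simp: is_subspace_def b_02 b_add2 b_s2)
    show "is_subspace scale {v. \<beta> v w = 0}" by (auto simp: is_subspace_def b_01 b_add1 b_s1)
    show "\<exists>t. W.adjoin t {w. \<beta> v w = 0} = UNIV"
    proof (cases "\<exists>t. \<beta> v t \<noteq> 0")
      case True
      then obtain t where t: "\<beta> v t \<noteq> 0" by blast
      have "\<beta> v (u - s2 (Opp (inverse (\<beta> v t) * \<beta> v u)) t) = 0" for u
      proof -
        let ?x = "s2 (Opp (inverse (\<beta> v t) * \<beta> v u)) t"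
        have "\<beta> v ?x = \<beta> v u" using t by (simp add: b_s2 mult.assoc[symmetric])
        then show ?thesis using b_add2[of v "u - ?x" ?x] by simp
      qed
      then show ?thesis by (auto simp: W.adjoin_def)
    next
      case False
      then show ?thesis by (auto simp: W.adjoin_def)
    qed
    show "\<exists>t. adjoin t {v. \<beta> v w = 0} = UNIV"
    proof (cases "\<exists>t. \<beta> t w \<noteq> 0")
      case True
      then obtain t where t: "\<beta> t w \<noteq> 0" by blast
      have "\<beta> (u - scale (\<beta> u w * inverse (\<beta> t w)) t) w = 0" for u
      proof -
        let ?x = "scale (\<beta> u w * inverse (\<beta> t w)) t"
        have "\<beta> ?x w = \<beta> u w" using t by (simp add: b_s1 mult.assoc)
        then show ?thesis using b_add1[of "u - ?x" ?x w] by simp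
      qed
      then show ?thesis by (auto simp: adjoin_def)
    next
      case False
      then show ?thesis by (auto simp: adjoin_def)
    qed
    show "w = 0" if "\<And>v. \<beta> v w = 0"
      by (rule eqI) (use that b_basis1 c_0 in metis)
    show "v = 0" if "\<And>w. \<beta> v w = 0"
      by (rule eqI) (use that b_basis2 c_0 in metis)
  qed
  moreover have "\<exists>w. \<phi> = (\<lambda>v. \<beta> v w)" if \<phi>: "\<phi> \<in> dual_space scale" for \<phi>
  proof -
    have add: "\<phi> (x + y) = \<phi> x + \<phi> y" and sc: "\<phi> (scale a x) = a * \<phi> x" for x y a
      using \<phi> by (auto simp: dual_space_def)
    have \<phi>_0: "\<phi> 0 = 0" using sc[of 0 0] by simp
    have \<phi>_sum: "\<phi> (\<Sum>b\<in>A. g b) = (\<Sum>b\<in>A. \<phi> (g b))" if "finite A" for A and g :: "'v \<Rightarrow> 'v"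
      using that by (induction A rule: finite_induct) (auto simp: add \<phi>_0)
    define w where "w = (\<Sum>b\<in>B. scale (\<phi> b) b)"
    have "\<phi> v = \<beta> v w" for v
    proof -
      have "\<phi> v = \<phi> (\<Sum>b\<in>B. scale (c v b) b)" using c[of v] by simp
      also have "\<dots> = (\<Sum>b\<in>B. c v b * \<phi> b)" by (simp add: \<phi>_sum[OF fin] sc)
      also have "\<dots> = \<beta> v w" unfolding \<beta>_def w_def by (rule sum.cong) (auto simp: coord)
      finally show ?thesis .
    qed
    then show ?thesis by blast
  qed
  ultimately show ?thesis using b_add1 b_add2 b_s1 b_s2 by blast
qed

section \<open>The fundamental theorem of projective geometry\<close>

context left_vector_space begin

definition line :: "'v \<Rightarrow> 'v set" where
  "line x = {z. \<exists>a. z = scale a x}"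

definition span2 :: "'v \<Rightarrow> 'v \<Rightarrow> 'v set" where
  "span2 x y = {z. \<exists>a b. z = scale a x + scale b y}"

text \<open>
  Independence is stated by coefficients, which makes it visibly symmetric in the three vectors.
\<close>

definition indep3 :: "'v \<Rightarrow> 'v \<Rightarrow> 'v \<Rightarrow> bool" where
  "indep3 x y z \<longleftrightarrow> (\<forall>a b c. scale a x + scale b y + scale c z = 0 \<longrightarrow> a = 0 \<and> b = 0 \<and> c = 0)"

definition indep2 :: "'v \<Rightarrow> 'v \<Rightarrow> bool" where
  "indep2 x y \<longleftrightarrow> (\<forall>a b. scale a x + scale b y = 0 \<longrightarrow> a = 0 \<and> b = 0)"

lemma span2_self: "span2 x x = line x"
proof -
  have "\<exists>b c. scale a x = scale b x + scale c x" for a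
    by (rule exI[of _ a], rule exI[of _ 0]) simp
  moreover have "\<exists>c. scale a x + scale b x = scale c x" for a b
    by (rule exI[of _ "a + b"]) (simp add: scale_left_distrib)
  ultimately show ?thesis unfolding span2_def line_def by blast
qed

lemma lineI: "scale a x \<in> line x"
  by (auto simp: line_def)

lemma span2I: "scale a x + scale b y \<in> span2 x y"
  by (auto simp: span2_def)

lemma line_self: "x \<in> line x"
  using lineI[of 1 x] by (simp add: scale_one)

lemma line_sym: "x \<in> line y \<Longrightarrow> x \<noteq> 0 \<Longrightarrow> y \<in> line x"
  using lineI[of "inverse _" x] unfolding line_def by (auto simp: scale_scale) (metis scale_cancel scale_scale)

lemma line_trans: "x \<in> line y \<Longrightarrow> y \<in> line z \<Longrightarrow> x \<in> line z"
  by (auto simp: line_def scale_scale)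

lemma zero_in_line: "0 \<in> line x"
  using lineI[of 0 x] by simp

lemma span2_commute: "span2 x y = span2 y x"
  unfolding span2_def by (metis add.commute)

lemma sub_span2: "sub (span2 x y)"
  unfolding is_subspace_def
proof (intro conjI ballI allI)
  show "0 \<in> span2 x y" unfolding span2_def by (auto intro!: exI[of _ 0])
next
  fix u v assume "u \<in> span2 x y" "v \<in> span2 x y"
  then obtain a b c d where "u = scale a x + scale b y" "v = scale c x + scale d y"
    by (auto simp: span2_def)
  then have "u + v = scale (a + c) x + scale (b + d) y" by (simp add: scale_simps algebra_simps)
  then show "u + v \<in> span2 x y" unfolding span2_def by blast
next
  fix c u assume "u \<in> span2 x y"
  then obtain a b where "u = scale a x + scale b y" by (auto simp: span2_def)
  then have "scale c u = scale (c * a) x + scale (c * b) y" by (simp add: scale_simps scale_scale)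
  then show "scale c u \<in> span2 x y" unfolding span2_def by blast
qed

lemma span2_mem1: "x \<in> span2 x y"
  using span2I[of 1 x 0 y] by (simp add: scale_one)

lemma span2_mem2: "y \<in> span2 x y"
  using span2_mem1 span2_commute by blast

lemma span2_least: "sub S \<Longrightarrow> x \<in> S \<Longrightarrow> y \<in> S \<Longrightarrow> span2 x y \<subseteq> S"
  using sub_add sub_scale by (auto simp: span2_def)

lemma sub_line: "sub (line x)"
  using sub_span2[of x x] by (simp add: span2_self)

lemma line_least: "sub S \<Longrightarrow> x \<in> S \<Longrightarrow> line x \<subseteq> S"
  using sub_scale by (auto simp: line_def)

lemma indep2_iff: "indep2 x y \<longleftrightarrow> x \<noteq> 0 \<and> y \<notin> line x"
proof
  assume i: "indep2 x y"
  have "x \<noteq> 0" using i[unfolded indep2_def, rule_format, of 1 0] by (auto simp: scale_one)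
  moreover have "y \<notin> line x"
  proof
    assume "y \<in> line x"
    then obtain a where "y = scale a x" by (auto simp: line_def)
    then show False using i[unfolded indep2_def, rule_format, of a "- 1"] by (simp add: scale_one)
  qed
  ultimately show "x \<noteq> 0 \<and> y \<notin> line x" ..
next
  assume *: "x \<noteq> 0 \<and> y \<notin> line x"
  show "indep2 x y"
    unfolding indep2_def
  proof (intro allI impI)
    fix a b assume eq: "scale a x + scale b y = 0"
    have "b = 0"
    proof (rule ccontr)
      assume "b \<noteq> 0"
      have "scale b y = scale (- a) x" using eq by (simp add: eq_neg_iff_add_eq_0 add.commute)
      then have "scale b y \<in> line x" using lineI by metis
      then show False using sub_scale_iff[OF sub_line] \<open>b \<noteq> 0\<close> * by blast
    qed
    with eq * show "a = 0 \<and> b = 0" by simp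
  qed
qed

text \<open>
  In this form independence is obtained when vectors are chosen one after the other.
\<close>

lemma indep3_iff: "indep3 x y z \<longleftrightarrow> indep2 x y \<and> z \<notin> span2 x y"
proof
  assume i: "indep3 x y z"
  have "indep2 x y"
    unfolding indep2_def
  proof (intro allI impI)
    fix a b assume "scale a x + scale b y = 0"
    then show "a = 0 \<and> b = 0" using i[unfolded indep3_def, rule_format, of a b 0] by simp
  qed
  moreover have "z \<notin> span2 x y"
  proof
    assume "z \<in> span2 x y"
    then obtain a b where "z = scale a x + scale b y" by (auto simp: span2_def)
    then show False using i[unfolded indep3_def, rule_format, of a b "- 1"] by (simp add: scale_one)
  qed
  ultimately show "indep2 x y \<and> z \<notin> span2 x y" ..
next
  assume *: "indep2 x y \<and> z \<notin> span2 x y"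
  show "indep3 x y z"
    unfolding indep3_def
  proof (intro allI impI)
    fix a b c assume eq: "scale a x + scale b y + scale c z = 0"
    have c: "c = 0"
    proof (rule ccontr)
      assume "c \<noteq> 0"
      have "scale c z + (scale a x + scale b y) = 0" using eq by (simp only: add.commute)
      then have "scale c z = - (scale a x + scale b y)" by (rule iffD2[OF eq_neg_iff_add_eq_0])
      also have "\<dots> = scale (- a) x + scale (- b) y" by simp
      finally have "scale c z \<in> span2 x y" using span2I by metis
      then show False using sub_scale_iff[OF sub_span2] \<open>c \<noteq> 0\<close> * by blast
    qed
    with eq * show "a = 0 \<and> b = 0 \<and> c = 0" by (simp add: indep2_def)
  qed
qed

lemma indep2_sym: "indep2 x y \<Longrightarrow> indep2 y x"
  unfolding indep2_def by (metis add.commute)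

lemma indep3_swap: "indep3 x y z \<Longrightarrow> indep3 x z y"
  unfolding indep3_def by (metis add.assoc add.commute)

lemma indep3_rotate: "indep3 x y z \<Longrightarrow> indep3 z x y"
  unfolding indep3_def by (metis add.assoc add.commute)

lemma indep3_imp_indep2: "indep3 x y z \<Longrightarrow> indep2 x y \<and> indep2 x z \<and> indep2 y z"
  using indep3_iff indep3_rotate indep3_swap by blast

lemma indep2_coeff_eq:
  assumes "indep2 x y" "scale a x + scale b y = scale a' x + scale b' y"
  shows "a = a' \<and> b = b'"
proof -
  have "scale (a - a') x + scale (b - b') y = (scale a x + scale b y) - (scale a' x + scale b' y)"
    by (simp add: scale_diff_left)
  also have "\<dots> = 0" using assms(2) by simp
  finally show ?thesis using assms(1) unfolding indep2_def by (metis eq_iff_diff_eq_0)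
qed

lemma indep3_coeff_eq:
  assumes "indep3 x y z"
    "scale a x + scale b y + scale c z = scale a' x + scale b' y + scale c' z"
  shows "a = a' \<and> b = b' \<and> c = c'"
proof -
  have "scale (a - a') x + scale (b - b') y + scale (c - c') z
      = (scale a x + scale b y + scale c z) - (scale a' x + scale b' y + scale c' z)"
    by (simp add: scale_diff_left)
  also have "\<dots> = 0" using assms(2) by simp
  finally show ?thesis using assms(1) unfolding indep3_def by (metis eq_iff_diff_eq_0)
qed

end

text \<open>
  Semilinear bijections between spaces over possibly different division rings, with the companion
  isomorphism of rings.
\<close>

definition semilinear_bij where
  "semilinear_bij s1 s2 l \<longleftrightarrow> bij l \<and> (\<forall>x y. l (x + y) = l x + l y) \<and>
     (\<exists>\<sigma>. bij \<sigma> \<and> \<sigma> 1 = 1 \<and> (\<forall>a b. \<sigma> (a + b) = \<sigma> a + \<sigma> b) \<and> (\<forall>a b. \<sigma> (a * b) = \<sigma> a * \<sigma> b) \<and>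
       (\<forall>a x. l (s1 a x) = s2 (\<sigma> a) (l x)))"

text \<open>
  A collineation between two projective spaces, given by a choice \<open>F x\<close> of a vector that spans the
  image of the point spanned by \<open>x\<close>. The assumption \<open>F_span2\<close> says that collinearity is preserved and reflected;
  the last one, that the dimension exceeds two.
\<close>

locale collineation =
  V: left_vector_space s1 + W: left_vector_space s2
  for s1 :: "'k::division_ring \<Rightarrow> 'v::ab_group_add \<Rightarrow> 'v"
    and s2 :: "'l::division_ring \<Rightarrow> 'w::ab_group_add \<Rightarrow> 'w" +
  fixes F :: "'v \<Rightarrow> 'w"
  assumes F_0: "F x = 0 \<longleftrightarrow> x = 0"
    and F_span2: "z \<in> V.span2 x y \<longleftrightarrow> F z \<in> W.span2 (F x) (F y)"
    and F_onto: "\<exists>x. w \<in> W.line (F x)"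
    and not_plane: "\<exists>z. z \<notin> V.span2 x y"
begin

text \<open>
  The vector \<open>x'\<close> spans the image of the point spanned by \<open>x\<close>.
\<close>

definition rep :: "'v \<Rightarrow> 'w \<Rightarrow> bool" where
  "rep x x' \<longleftrightarrow> x' \<noteq> 0 \<and> x' \<in> W.line (F x)"

text \<open>
  Representatives \<open>x'\<close> and \<open>y'\<close> are matched if they could be the values at \<open>x\<close> and \<open>y\<close> of one additive map that
  induces the collineation.
\<close>

definition matched :: "'v \<Rightarrow> 'w \<Rightarrow> 'v \<Rightarrow> 'w \<Rightarrow> bool" where
  "matched x x' y y' \<longleftrightarrow> rep x x' \<and> rep y y' \<and> x' + y' \<in> W.line (F (x + y))"

lemma matched_sym: "matched x x' y y' \<Longrightarrow> matched y y' x x'"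
  by (auto simp: matched_def add.commute)

lemma F_line: "z \<in> V.line x \<longleftrightarrow> F z \<in> W.line (F x)"
  using F_span2[of z x x] by (simp add: V.span2_self W.span2_self)

lemma rep_F: "x \<noteq> 0 \<Longrightarrow> rep x (F x)"
  using W.line_self F_0 by (simp add: rep_def)

lemma rep_nonzero: "rep x x' \<Longrightarrow> x \<noteq> 0"
  using F_0[of 0] by (auto simp: rep_def W.line_def)

lemma rep_line: "rep x x' \<Longrightarrow> F x \<in> W.line x'"
  using W.line_sym rep_def by blast

lemma rep_span2:
  assumes "rep x x'" "rep y y'"
  shows "W.span2 x' y' = W.span2 (F x) (F y)"
proof
  have "x' \<in> W.span2 (F x) (F y)" "y' \<in> W.span2 (F x) (F y)"
    using assms W.line_least[OF W.sub_span2] W.span2_mem1 W.span2_mem2 unfolding rep_def by blast+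
  then show "W.span2 x' y' \<subseteq> W.span2 (F x) (F y)" using W.span2_least[OF W.sub_span2] by blast
  have "F x \<in> W.span2 x' y'" "F y \<in> W.span2 x' y'"
    using rep_line assms W.line_least[OF W.sub_span2] W.span2_mem1 W.span2_mem2 by blast+
  then show "W.span2 (F x) (F y) \<subseteq> W.span2 x' y'" using W.span2_least[OF W.sub_span2] by blast
qed

lemma rep_span2_iff:
  assumes "rep x x'" "rep y y'" "rep z z'"
  shows "z' \<in> W.span2 x' y' \<longleftrightarrow> z \<in> V.span2 x y"
proof -
  have "z' \<in> S \<longleftrightarrow> F z \<in> S" if "W.sub S" for S
    using W.line_least[OF that] rep_line[OF assms(3)] assms(3) unfolding rep_def by blast
  then show ?thesis using rep_span2[OF assms(1,2)] F_span2[of z x y] W.sub_span2 by simp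
qed

lemma rep_indep2:
  assumes "V.indep2 x y" "rep x x'" "rep y y'" shows "W.indep2 x' y'"
  using assms rep_span2_iff[of x x' x x' y y'] by (simp add: V.indep2_iff W.indep2_iff V.span2_self W.span2_self rep_def)

lemma rep_indep3:
  assumes "V.indep3 x y z" "rep x x'" "rep y y'" "rep z z'" shows "W.indep3 x' y' z'"
  using assms rep_span2_iff[of x x' y y' z z'] rep_indep2[of x y] by (simp add: V.indep3_iff W.indep3_iff)

text \<open>
  The point spanned by \<open>x + y\<close> lies on the line through the points of \<open>x\<close> and \<open>y\<close> and differs from both; so does its
  image. A vector spanning the image is therefore a combination of \<open>x'\<close> and \<open>F y\<close> with nonzero
  coefficients, and can be rescaled to have coefficient one at \<open>x'\<close>.
\<close>

lemma matched_ex: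
  assumes "V.indep2 x y" "rep x x'" shows "\<exists>y'. matched x x' y y'"
proof -
  have y0: "y \<noteq> 0" using V.indep2_sym[OF assms(1)] V.indep2_iff by blast
  have "x + y \<noteq> 0" using assms(1) unfolding V.indep2_def by (metis V.scale_one one_neq_zero)
  then have rxy: "rep (x + y) (F (x + y))" by (rule rep_F)
  have "x + y \<in> V.span2 x y" using V.sub_add[OF V.sub_span2] V.span2_mem1 V.span2_mem2 by blast
  then have "F (x + y) \<in> W.span2 x' (F y)"
    using rep_span2_iff[OF assms(2) rep_F[OF y0] rxy] by blast
  then obtain a b where ab: "F (x + y) = s2 a x' + s2 b (F y)" by (auto simp: W.span2_def)
  have "a \<noteq> 0"
  proof
    assume "a = 0"
    then have "F (x + y) \<in> W.line (F y)" using ab by (auto simp: W.line_def)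
    then have "x + y \<in> V.line y" using F_line by blast
    then have "x + y - y \<in> V.line y" using V.sub_diff[OF V.sub_line] V.line_self by blast
    then show False using V.indep2_sym[OF assms(1)] V.indep2_iff by simp
  qed
  moreover have "b \<noteq> 0"
  proof
    assume "b = 0"
    then have "F (x + y) \<in> W.line x'" using ab by (auto simp: W.line_def)
    then have "F (x + y) \<in> W.line (F x)" using W.line_trans assms(2) rep_def by blast
    then have "x + y \<in> V.line x" using F_line by blast
    then have "x + y - x \<in> V.line x" using V.sub_diff[OF V.sub_line] V.line_self by blast
    then show False using assms(1) V.indep2_iff by simp
  qed
  moreover define y' where "y' = s2 (inverse a * b) (F y)"
  ultimately have "rep y y'" using F_0 y0 by (auto simp: rep_def W.line_def)
  moreover have "x' + y' = s2 (inverse a) (F (x + y))"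
    using \<open>a \<noteq> 0\<close> by (simp add: ab y'_def W.scale_simps W.scale_scale W.scale_one)
  then have "x' + y' \<in> W.line (F (x + y))" by (auto simp: W.line_def)
  ultimately show ?thesis using assms(2) matched_def by blast
qed

lemma matched_unique:
  assumes "V.indep2 x y" "matched x x' y y'" "matched x x' y y''" shows "y' = y''"
proof -
  have r: "rep x x'" "rep y y'" "rep y y''" using assms by (auto simp: matched_def)
  have i: "W.indep2 x' y'" using rep_indep2[OF assms(1) r(1,2)] .
  have "x' + y' \<noteq> 0" using i unfolding W.indep2_def by (metis W.scale_one one_neq_zero)
  then have "rep (x + y) (x' + y')" using assms(2) by (simp add: matched_def rep_def)
  then have "x' + y'' \<in> W.line (x' + y')"
    using rep_line assms(3) W.line_trans unfolding matched_def by blast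
  then obtain d where d: "x' + y'' = s2 d (x' + y')" by (auto simp: W.line_def)
  have "y'' \<in> W.line y'" using r(3) rep_line[OF r(2)] W.line_trans unfolding rep_def by blast
  then obtain c where c: "y'' = s2 c y'" by (auto simp: W.line_def)
  have "s2 1 x' + s2 c y' = s2 d x' + s2 d y'" using d c by (simp add: W.scale_one W.scale_simps)
  from W.indep2_coeff_eq[OF i this] have "c = 1" by simp
  with c show ?thesis by (simp add: W.scale_one)
qed

text \<open>
  The vector \<open>e + x + y\<close> lies on the plane of \<open>e + x\<close> and \<open>y\<close> and also on that of \<open>e + y\<close> and \<open>x\<close>. The images of these
  two planes meet in the multiples of \<open>e' + x' + y'\<close>.
\<close>

lemma matched_triangle:
  assumes i: "V.indep3 e x y" and cx: "matched e e' x x'" and cy: "matched e e' y y'"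
  shows "matched x x' y y'" "matched e e' (x + y) (x' + y')"
proof -
  have r: "rep e e'" "rep x x'" "rep y y'" using cx cy by (auto simp: matched_def)
  have i': "W.indep3 e' x' y'" using rep_indep3[OF i r] .
  have nz: "e' + x' \<noteq> 0" "e' + y' \<noteq> 0"
    using W.indep3_imp_indep2[OF i'] unfolding W.indep2_def by (metis W.scale_one one_neq_zero)+
  have rex: "rep (e + x) (e' + x')" "rep (e + y) (e' + y')"
    using nz cx cy by (auto simp: rep_def matched_def)
  have i2: "V.indep2 e (x + y)"
    unfolding V.indep2_def
  proof (intro allI impI)
    fix a b assume "s1 a e + s1 b (x + y) = 0"
    then have "s1 a e + s1 b x + s1 b y = 0" by (simp add: V.scale_simps add.assoc)
    then show "a = 0 \<and> b = 0" using i unfolding V.indep3_def by blast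
  qed
  \<comment> \<open>it turns out that \<open>z' = x' + y'\<close>\<close>
  obtain z' where z': "matched e e' (x + y) z'" using matched_ex[OF i2 r(1)] by blast
  have rz: "rep (x + y) z'" using z' by (simp add: matched_def)
  have "e' + z' \<noteq> 0"
    using rep_indep2[OF i2 r(1) rz] unfolding W.indep2_def by (metis W.scale_one one_neq_zero)
  then have rg: "rep (e + (x + y)) (e' + z')" using z' by (simp add: matched_def rep_def)
  have "e + (x + y) = (e + x) + y" by (simp add: add.assoc)
  then have "e + (x + y) \<in> V.span2 (e + x) y"
    using V.sub_add[OF V.sub_span2 V.span2_mem1 V.span2_mem2] by metis
  then have "e' + z' \<in> W.span2 (e' + x') y'" using rep_span2_iff[OF rex(1) r(3) rg] by blast
  then obtain a b where ab: "e' + z' = s2 a (e' + x') + s2 b y'" by (auto simp: W.span2_def)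
  have "e + (x + y) = (e + y) + x" by (simp add: algebra_simps)
  then have "e + (x + y) \<in> V.span2 (e + y) x"
    using V.sub_add[OF V.sub_span2 V.span2_mem1 V.span2_mem2] by metis
  then have "e' + z' \<in> W.span2 (e' + y') x'" using rep_span2_iff[OF rex(2) r(2) rg] by blast
  then obtain c d where cd: "e' + z' = s2 c (e' + y') + s2 d x'" by (auto simp: W.span2_def)
  have "x + y \<in> V.span2 x y"
    using V.sub_add[OF V.sub_span2 V.span2_mem1 V.span2_mem2] .
  then have "z' \<in> W.span2 x' y'" using rep_span2_iff[OF r(2,3) rz] by blast
  then obtain p q where pq: "z' = s2 p x' + s2 q y'" by (auto simp: W.span2_def)
  have "s2 1 e' + s2 p x' + s2 q y' = s2 a e' + s2 a x' + s2 b y'"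
    using ab pq by (simp add: W.scale_one W.scale_simps add.assoc)
  from W.indep3_coeff_eq[OF i' this] have 1: "a = 1" "p = a" by auto
  have "s2 1 e' + s2 p x' + s2 q y' = s2 c e' + s2 d x' + s2 c y'"
    using cd pq by (simp add: W.scale_one W.scale_simps algebra_simps)
  from W.indep3_coeff_eq[OF i' this] have 2: "c = 1" "q = c" by auto
  have "z' = x' + y'" using pq 1 2 by (simp add: W.scale_one)
  then show "matched e e' (x + y) (x' + y')" using z' by simp
  show "matched x x' y y'" using rz \<open>z' = x' + y'\<close> r by (simp add: matched_def rep_def)
qed

lemma ex_indep3: "V.indep2 x y \<Longrightarrow> \<exists>z. V.indep3 x y z"
  using not_plane V.indep3_iff by blast

text \<open>
  Fix \<open>e\<close> with image \<open>F e\<close> and match all vectors off the line of \<open>e\<close> with it. The vectors on that line are matched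
  with a second vector \<open>e2\<close> instead. All remaining pairs are then matched by \<open>matched_triangle\<close>, if
  necessary with the help of a vector outside their plane.
\<close>

lemma ex_lift:
  "\<exists>l. l 0 = 0 \<and> (\<forall>x. x \<noteq> 0 \<longrightarrow> rep x (l x)) \<and> (\<forall>x y. V.indep2 x y \<longrightarrow> matched x (l x) y (l y))"
proof -
  obtain e where "e \<notin> V.span2 0 0" using not_plane by blast
  then have e: "e \<noteq> 0" using V.sub_0[OF V.sub_span2] by blast
  obtain e2 where e2: "e2 \<notin> V.line e" using not_plane[of e e] V.span2_self by auto
  have ie: "V.indep2 e e2" using e e2 V.indep2_iff by blast
  obtain e2' where e2': "matched e (F e) e2 e2'" using matched_ex[OF ie rep_F[OF e]] by blast
  define l where "l = (\<lambda>x. if x = 0 then 0 else if x \<notin> V.line e then SOME y'. matched e (F e) x y'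
      else SOME y'. matched e2 e2' x y')"
  have off: "matched e (F e) x (l x)" if "x \<notin> V.line e" for x
  proof -
    have "V.indep2 e x" using that e V.indep2_iff by blast
    then have "matched e (F e) x (SOME y'. matched e (F e) x y')" using matched_ex rep_F[OF e] someI_ex by metis
    moreover have "x \<noteq> 0" using that V.zero_in_line by metis
    ultimately show ?thesis using that by (simp add: l_def)
  qed
  have le2: "l e2 = e2'" using matched_unique[OF ie off[OF e2] e2'] .
  have on: "matched e2 (l e2) x (l x)" if x: "x \<in> V.line e" "x \<noteq> 0" for x
  proof -
    have "x \<notin> V.line e2"
    proof
      assume "x \<in> V.line e2"
      then have "e2 \<in> V.line x" using V.line_sym x by blast
      then show False using e2 V.line_trans x by blast
    qed
    moreover have "e2 \<noteq> 0" using e2 V.zero_in_line by metis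
    ultimately have "V.indep2 e2 x" using V.indep2_iff by blast
    moreover have "rep e2 e2'" using e2' by (simp add: matched_def)
    ultimately have "matched e2 e2' x (SOME y'. matched e2 e2' x y')" using matched_ex someI_ex by metis
    then show ?thesis using x le2 by (simp add: l_def)
  qed
  \<comment> \<open>independent of \<open>e\<close>\<close>
  have C1: "matched x (l x) y (l y)" if "V.indep3 e x y" for x y
  proof -
    have "x \<notin> V.line e" "y \<notin> V.line e" using V.indep3_imp_indep2[OF that] V.indep2_iff by auto
    then show ?thesis using matched_triangle(1)[OF that off off] by blast
  qed
  \<comment> \<open>in a common plane with \<open>e\<close>, but off its line: use a vector \<open>z\<close> outside the plane\<close>
  have C2: "matched x (l x) y (l y)" if xy: "x \<notin> V.line e" "y \<notin> V.line e" "V.indep2 x y" for x y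
  proof (cases "y \<in> V.span2 e x")
    case False
    then show ?thesis using C1 V.indep3_iff V.indep2_iff e xy by blast
  next
    case True
    obtain z where z: "z \<notin> V.span2 e x" using not_plane by blast
    have "V.span2 e y \<subseteq> V.span2 e x" "V.span2 x y \<subseteq> V.span2 e x"
      using V.span2_least[OF V.sub_span2] True V.span2_mem1 V.span2_mem2 by blast+
    then have i: "V.indep3 e x z" "V.indep3 e y z" "V.indep3 x y z"
      using z V.indep3_iff V.indep2_iff e xy by blast+
    show ?thesis
      using matched_triangle(1)[OF V.indep3_rotate[OF i(3)] matched_sym[OF C1[OF i(1)]] matched_sym[OF C1[OF i(2)]]] .
  qed
  \<comment> \<open>one of the vectors on the line of \<open>e\<close>, where \<open>e2\<close> takes the part of \<open>e\<close>\<close>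
  have C3: "matched y (l y) x (l x)" if xy: "y \<in> V.line e" "y \<noteq> 0" "x \<notin> V.line e" for x y
  proof -
    have ye: "V.span2 y v \<subseteq> V.span2 e v" for v
      using V.span2_least[OF V.sub_span2] V.line_least[OF V.sub_span2 V.span2_mem1, of e v] xy
        V.span2_mem2 by blast
    have iy: "V.indep2 y v" if "v \<notin> V.line e" for v
      using that xy V.indep2_iff V.line_trans by blast
    have C4: "matched y (l y) v (l v)" if v: "v \<notin> V.span2 e e2" for v
    proof -
      have "v \<notin> V.line e" using v V.line_least[OF V.sub_span2 V.span2_mem1, of e e2] by blast
      moreover have "v \<notin> V.line e2" using v V.line_least[OF V.sub_span2 V.span2_mem2, of e2 e] by blast
      ultimately have c: "matched e2 (l e2) v (l v)"
        using C2[OF e2] V.indep2_iff e2 V.zero_in_line by metis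
      have "V.indep3 y e2 v" using iy[OF e2] ye v V.indep3_iff by blast
      then have "V.indep3 e2 y v" using V.indep3_rotate V.indep3_swap by blast
      then show ?thesis using matched_triangle(1)[OF _ on[OF xy(1,2)] c] by blast
    qed
    show ?thesis
    proof (cases "x \<in> V.span2 e e2")
      case True
      obtain z where z: "z \<notin> V.span2 e e2" using not_plane by blast
      have ze: "z \<notin> V.line e" using z V.line_least[OF V.sub_span2 V.span2_mem1, of e e2] by blast
      have "V.span2 e x \<subseteq> V.span2 e e2"
        using V.span2_least[OF V.sub_span2] True V.span2_mem1 by blast
      then have z': "z \<notin> V.span2 y x" using z ye by blast
      then have i: "V.indep3 y x z" using iy[OF xy(3)] V.indep3_iff by blast
      then have "V.indep2 x z" using V.indep3_imp_indep2 by blast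
      then have "matched x (l x) z (l z)" using C2[OF xy(3) ze] by blast
      then show ?thesis
        using matched_triangle(1)[OF V.indep3_rotate[OF i] matched_sym[OF C4[OF z]] matched_sym] by blast
    qed (use C4 in blast)
  qed
  have "matched x (l x) y (l y)" if i: "V.indep2 x y" for x y
  proof -
    have nz: "x \<noteq> 0" "y \<noteq> 0" using i V.indep2_sym V.indep2_iff by blast+
    have "\<not> (x \<in> V.line e \<and> y \<in> V.line e)"
      using V.line_sym[OF _ nz(1)] V.line_trans i V.indep2_iff by metis
    then show ?thesis
      using C2[OF _ _ i] C3[of x y] matched_sym[OF C3[of y x]] nz by blast
  qed
  moreover have "rep x (l x)" if "x \<noteq> 0" for x
    using off[of x] on[of x] that unfolding matched_def by blast
  moreover have "l 0 = 0" by (simp add: l_def)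
  ultimately show ?thesis by blast
qed

text \<open>
  The lift of \<open>ex_lift\<close> is additive on independent vectors by \<open>matched_triangle\<close>, and then on all vectors.
  It maps the multiples of \<open>x\<close> to multiples of \<open>l x\<close>; additivity shows that the factor depends on the
  scalar only.
\<close>

theorem fundamental_theorem: "\<exists>l. semilinear_bij s1 s2 l \<and> (\<forall>x. l x \<in> W.line (F x))"
proof -
  obtain l where l0: "l 0 = 0" and rep: "\<And>x. x \<noteq> 0 \<Longrightarrow> rep x (l x)"
    and matched: "\<And>x y. V.indep2 x y \<Longrightarrow> matched x (l x) y (l y)"
    using ex_lift by blast
  have add2: "l (x + y) = l x + l y" if i: "V.indep2 x y" for x y
  proof -
    obtain z where z: "V.indep3 x y z" using ex_indep3[OF i] by blast
    have z': "V.indep3 z x y" using V.indep3_rotate[OF z] .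
    have "V.indep2 z (x + y)"
      unfolding V.indep2_def
    proof (intro allI impI)
      fix a b assume "s1 a z + s1 b (x + y) = 0"
      then have "s1 a z + s1 b x + s1 b y = 0" by (simp add: V.scale_simps add.assoc)
      then show "a = 0 \<and> b = 0" using z' unfolding V.indep3_def by blast
    qed
    moreover have "matched z (l z) (x + y) (l x + l y)"
      using matched_triangle(2)[OF z' matched matched] V.indep3_imp_indep2[OF z'] by blast
    ultimately show ?thesis using matched_unique matched by blast
  qed
  have add: "l (x + y) = l x + l y" for x y
  proof (cases "x = 0 \<or> y = 0 \<or> V.indep2 x y")
    case True
    then show ?thesis using l0 add2 by auto
  next
    case False
    then have nz: "x \<noteq> 0" "y \<noteq> 0" and y: "y \<in> V.line x" using V.indep2_iff by auto
    obtain z where z: "z \<notin> V.line x" using not_plane[of x x] V.span2_self by auto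
    have iz: "V.indep2 v z" if "v \<in> V.line x" "v \<noteq> 0" for v
      using that z V.indep2_iff V.line_trans by blast
    have xyl: "x + y \<in> V.line x" using V.sub_add[OF V.sub_line V.line_self y] .
    \<comment> \<open>compute \<open>l (x + y + z)\<close> in two ways for a vector \<open>z\<close> off the line of \<open>x\<close> and \<open>y\<close>\<close>
    have "l (x + y) + l z = l (x + y + z)"
      using add2[OF iz[OF xyl]] l0 by (cases "x + y = 0") auto
    also have "\<dots> = l (x + (y + z))" by (simp add: add.assoc)
    also have "\<dots> = l x + l (y + z)"
    proof (rule add2)
      have "y + z \<notin> V.line x" using V.sub_diff[OF V.sub_line _ y, of "y + z"] z by auto
      then show "V.indep2 x (y + z)" using nz V.indep2_iff by blast
    qed
    also have "l (y + z) = l y + l z" using add2[OF iz[OF y nz(2)]] .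
    finally show ?thesis by (simp add: algebra_simps)
  qed
  have lnz: "l x \<noteq> 0" if "x \<noteq> 0" for x using rep[OF that] by (simp add: rep_def)
  have inj: "inj l"
  proof (rule injI)
    fix x y assume "l x = l y"
    moreover have "l x = l (x - y) + l y" using add[of "x - y" y] by simp
    ultimately have "l (x - y) = 0" by simp
    then have "x - y = 0" using lnz by blast
    then show "x = y" by simp
  qed
  have lline: "l x \<in> W.line (F x)" for x
    using rep[of x] l0 W.zero_in_line by (cases "x = 0") (auto simp: rep_def)
  have i2l: "W.indep2 (l x) (l y)" if "V.indep2 x y" for x y
    using rep_indep2[OF that] rep that V.indep2_iff V.indep2_sym by metis
  have "\<exists>c. l (s1 a x) = s2 c (l x)" if "x \<noteq> 0" for a x
  proof -
    have "s1 a x \<in> V.line x" by (auto simp: V.line_def)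
    then have "F (s1 a x) \<in> W.line (F x)" using F_line by blast
    then have "l (s1 a x) \<in> W.line (F x)" using lline W.line_trans by blast
    then have "l (s1 a x) \<in> W.line (l x)" using rep_line[OF rep[OF that]] W.line_trans by blast
    then show ?thesis by (simp add: W.line_def)
  qed
  then obtain g where g: "\<And>a x. x \<noteq> 0 \<Longrightarrow> l (s1 a x) = s2 (g x a) (l x)" by metis
  have g_indep: "g x a = g y a" if i: "V.indep2 x y" for x y a
  proof -
    have nz: "x \<noteq> 0" "y \<noteq> 0" using i V.indep2_sym V.indep2_iff by blast+
    have nz': "x + y \<noteq> 0" using i unfolding V.indep2_def by (metis V.scale_one one_neq_zero)
    have "s2 (g x a) (l x) + s2 (g y a) (l y) = l (s1 a x + s1 a y)" using g nz add by simp
    also have "\<dots> = l (s1 a (x + y))" by (simp add: V.scale_simps)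
    also have "\<dots> = s2 (g (x + y) a) (l x) + s2 (g (x + y) a) (l y)"
      using g[OF nz'] add by (simp add: W.scale_simps)
    finally show ?thesis using W.indep2_coeff_eq[OF i2l[OF i]] by metis
  qed
  obtain e where "e \<notin> V.span2 0 0" using not_plane by blast
  then have e: "e \<noteq> 0" using V.sub_0[OF V.sub_span2] by blast
  obtain e2 where e2: "e2 \<notin> V.line e" using not_plane[of e e] V.span2_self by auto
  have ie: "V.indep2 e e2" using e e2 V.indep2_iff by blast
  define \<sigma> where "\<sigma> = g e"
  have g_eq: "g x a = \<sigma> a" if "x \<noteq> 0" for x a
  proof -
    obtain z where z: "z \<notin> V.span2 e x" using not_plane by blast
    have "z \<notin> V.line e" "z \<notin> V.line x"
      using z V.line_least[OF V.sub_span2 V.span2_mem1, of e x]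
        V.line_least[OF V.sub_span2 V.span2_mem2, of x e] by blast+
    then have "V.indep2 e z" "V.indep2 x z" using that e V.indep2_iff by blast+
    then show ?thesis using g_indep unfolding \<sigma>_def by metis
  qed
  have semi: "l (s1 a x) = s2 (\<sigma> a) (l x)" for a x
    using g[of x a] g_eq[of x a] l0 by (cases "x = 0") auto
  have le: "l e \<noteq> 0" using lnz e by blast
  have cancel: "c = d" if "s2 c (l e) = s2 d (l e)" for c d
  proof -
    have "s2 (c - d) (l e) = 0" using that by (simp add: W.scale_diff_left)
    then show ?thesis using le by simp
  qed
  have "\<sigma> 1 = 1" using semi[of 1 e] by (intro cancel) (simp add: V.scale_one W.scale_one)
  moreover have "\<sigma> (a + b) = \<sigma> a + \<sigma> b" for a b
    by (intro cancel) (simp add: W.scale_left_distrib V.scale_left_distrib add flip: semi)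
  moreover have \<sigma>_mult: "\<sigma> (a * b) = \<sigma> a * \<sigma> b" for a b
  proof (rule cancel)
    have "s2 (\<sigma> (a * b)) (l e) = l (s1 a (s1 b e))" by (simp add: V.scale_scale flip: semi)
    also have "\<dots> = s2 (\<sigma> a * \<sigma> b) (l e)" by (simp add: semi W.scale_scale)
    finally show "s2 (\<sigma> (a * b)) (l e) = s2 (\<sigma> a * \<sigma> b) (l e)" .
  qed
  moreover have "inj \<sigma>"
  proof (rule injI)
    fix a b assume "\<sigma> a = \<sigma> b"
    then have "l (s1 a e) = l (s1 b e)" using semi by simp
    then have "s1 (a - b) e = 0" using injD[OF inj] by (simp add: V.scale_diff_left)
    then show "a = b" using e by simp
  qed
  moreover have surj_\<sigma>: "\<exists>a. \<sigma> a = b" for b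
  proof -
    have i': "W.indep2 (l e) (l e2)" using i2l[OF ie] .
    \<comment> \<open>the point spanned by \<open>l e + b (l e2)\<close> has a preimage, which lies on the line through \<open>e\<close> and \<open>e2\<close>\<close>
    obtain w where w: "l e + s2 b (l e2) \<in> W.line (F w)" using F_onto by blast
    have "s2 1 (l e) + s2 b (l e2) \<noteq> 0"
      using i' unfolding W.indep2_def by (metis one_neq_zero)
    then have nz: "l e + s2 b (l e2) \<noteq> 0" by (simp add: W.scale_one)
    then have rw: "rep w (l e + s2 b (l e2))" using w by (simp add: rep_def)
    have r: "rep e (l e)" "rep e2 (l e2)" using rep ie V.indep2_iff V.indep2_sym by blast+
    have "l e + s2 b (l e2) \<in> W.span2 (l e) (l e2)"
      using W.sub_add[OF W.sub_span2 W.span2_mem1 W.sub_scale[OF W.sub_span2 W.span2_mem2]] .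
    then have "w \<in> V.span2 e e2" using rep_span2_iff[OF r rw] by blast
    then obtain c d where cd: "w = s1 c e + s1 d e2" by (auto simp: V.span2_def)
    have lw: "l w = s2 (\<sigma> c) (l e) + s2 (\<sigma> d) (l e2)" using cd add semi by simp
    have "l e + s2 b (l e2) \<in> W.line (l w)"
      using w rep_line[OF rep[OF rep_nonzero[OF rw]]] W.line_trans by blast
    then obtain t where "l e + s2 b (l e2) = s2 t (l w)" by (auto simp: W.line_def)
    then have "s2 1 (l e) + s2 b (l e2) = s2 (t * \<sigma> c) (l e) + s2 (t * \<sigma> d) (l e2)"
      using lw by (simp add: W.scale_one W.scale_simps W.scale_scale)
    from W.indep2_coeff_eq[OF i' this] have *: "t * \<sigma> c = 1" "b = t * \<sigma> d" by auto
    have "c \<noteq> 0"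
    proof
      assume "c = 0"
      then have "\<sigma> c = 0" using semi[of 0 e] l0 le by simp
      with * show False by simp
    qed
    have "\<sigma> (inverse c) * \<sigma> c = 1" using \<open>\<sigma> 1 = 1\<close> \<sigma>_mult[of "inverse c" c] \<open>c \<noteq> 0\<close> by simp
    then have "t = \<sigma> (inverse c)"
      using * by (metis mult.assoc mult_1_right mult_cancel_right zero_neq_one mult_zero_right)
    then have "b = \<sigma> (inverse c * d)" using * \<sigma>_mult by simp
    then show ?thesis by blast
  qed
  moreover have "surj l"
  proof -
    have "\<exists>x. l x = w" for w
    proof (cases "w = 0")
      case False
      obtain x where x: "w \<in> W.line (F x)" using F_onto by blast
      then have rx: "rep x w" using False by (simp add: rep_def)
      have "w \<in> W.line (l x)"
        using x rep_line[OF rep[OF rep_nonzero[OF rx]]] W.line_trans by blast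
      then obtain c where "w = s2 c (l x)" by (auto simp: W.line_def)
      moreover obtain a where "\<sigma> a = c" using surj_\<sigma> by blast
      ultimately show ?thesis using semi by metis
    qed (use l0 in blast)
    then show ?thesis by (metis surj_def)
  qed
  ultimately have "semilinear_bij s1 s2 l"
    unfolding semilinear_bij_def using inj add semi by (auto simp: bij_def surj_def intro!: exI[of _ \<sigma>]; metis)
  then show ?thesis using lline by blast
qed

end

section \<open>Bijections between Grassmannians\<close>

context fin_dim_space begin

lemma line_eq_adjoin: "line x = adjoin x {0}"
  by (auto simp: line_def adjoin_def)

lemma line_Gr: "x \<noteq> 0 \<Longrightarrow> line x \<in> Gr 1"
  using adjoin_Gr[of "{0}" 0 x] by (simp add: line_eq_adjoin Gr_0)

lemma Gr_1_line: "P \<in> Gr 1 \<Longrightarrow> x \<in> P \<Longrightarrow> x \<noteq> 0 \<Longrightarrow> P = line x"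
  using Gr_eqI[OF line_Gr, of x P] line_least[of P x] by (simp add: Gr_iff)

lemma Gr_1_obtain:
  assumes "P \<in> Gr 1" obtains x where "x \<noteq> 0" "P = line x"
  using Gr_ex_nonzero[OF assms] Gr_1_line[OF assms] by auto

lemma line_subset_iff: "sub S \<Longrightarrow> line x \<subseteq> S \<longleftrightarrow> x \<in> S"
  using line_least line_self by blast

lemma point_Int_0_iff:
  assumes "P \<in> Gr 1" "sub H" shows "P \<inter> H = {0} \<longleftrightarrow> \<not> P \<subseteq> H"
proof -
  obtain x where x: "x \<noteq> 0" "P = line x" using Gr_1_obtain[OF assms(1)] .
  show ?thesis
  proof
    assume "P \<inter> H = {0}"
    then show "\<not> P \<subseteq> H" using x line_self by blast
  next
    assume "\<not> P \<subseteq> H"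
    then have "x \<notin> H" using x line_subset_iff[OF assms(2)] by blast
    show "P \<inter> H = {0}"
    proof (rule Int_0I[OF _ assms(2)])
      fix y assume y: "y \<in> P" "y \<in> H"
      then obtain a where a: "y = scale a x" using x by (auto simp: line_def)
      then have "a = 0" using sub_scale_iff[OF assms(2)] \<open>x \<notin> H\<close> y by blast
      then show "y = 0" using a by simp
    qed (simp add: x sub_line)
  qed
qed

lemma dim_span2: "dim (span2 x y) \<le> 2"
proof -
  have le: "dim (adjoin v S) \<le> Suc (dim S)" if "sub S" for v S
  proof (cases "v \<in> S")
    case True
    then have "adjoin v S = S" using adjoin_least[OF that order_refl] subset_adjoin by blast
    then show ?thesis by simp
  qed (simp add: dim_adjoin that)
  define S where "S = adjoin y (adjoin x {0})"
  have "sub S" "x \<in> S" "y \<in> S"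
    using sub_adjoin mem_adjoin[OF sub_zero] mem_adjoin[OF sub_adjoin[OF sub_zero]]
      subset_adjoin[of "adjoin x {0}" y] by (auto simp: S_def)
  then have "dim (span2 x y) \<le> dim S" using dim_mono[OF sub_span2] span2_least by blast
  also have "\<dots> \<le> 2"
    using le[OF sub_adjoin[OF sub_zero], of y x] le[OF sub_zero, of x] by (simp add: S_def)
  finally show ?thesis .
qed

text \<open>
  A characterisation of collinearity by the subspaces of one dimension \<open>i\<close>. It is used with \<open>i = 2\<close> for
  lines and with \<open>i = n - 1\<close> for hyperplanes.
\<close>

lemma span2_eq_Inter:
  assumes "2 \<le> i" "i < n"
  shows "z \<in> span2 x y \<longleftrightarrow> (\<forall>H\<in>Gr i. x \<in> H \<longrightarrow> y \<in> H \<longrightarrow> z \<in> H)"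
proof
  assume "z \<in> span2 x y"
  then show "\<forall>H\<in>Gr i. x \<in> H \<longrightarrow> y \<in> H \<longrightarrow> z \<in> H"
    using span2_least by (meson Gr_iff subsetD)
next
  assume all: "\<forall>H\<in>Gr i. x \<in> H \<longrightarrow> y \<in> H \<longrightarrow> z \<in> H"
  show "z \<in> span2 x y"
  proof (rule ccontr)
    assume "z \<notin> span2 x y"
    then obtain H0 where H0: "sub H0" "span2 x y \<subseteq> H0" "z \<notin> H0" "n = Suc (dim H0)"
      using hyperplane_avoiding[OF sub_span2 sub_UNIV subset_UNIV UNIV_I] dim_UNIV_eq by metis
    have "\<exists>H. sub H \<and> span2 x y \<subseteq> H \<and> H \<subseteq> H0 \<and> dim H = i"
      by (rule intermediate_subspace[OF sub_span2 H0(1,2)]) (use dim_span2[of x y] H0(4) assms in simp_all)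
    then obtain H where "H \<in> Gr i" "span2 x y \<subseteq> H" "H \<subseteq> H0" by (auto simp: Gr_iff)
    then show False using all H0(3) span2_mem1[of x y] span2_mem2[of y x] by blast
  qed
qed

lemma Gr_vector_below:
  assumes "X \<in> Gr (Suc d)" "0 < d" "x \<in> X" shows "\<exists>A\<in>Gr d. x \<in> A \<and> A \<subseteq> X"
proof (cases "x = 0")
  case True
  obtain A where A: "A \<in> Gr d" "A \<subseteq> X" using Gr_ex_lower[OF assms(1), of d] by auto
  then have "0 \<in> A" using sub_0 by (simp add: Gr_iff)
  then show ?thesis using A True by blast
next
  case False
  have X: "sub X" "dim X = Suc d" using assms by (auto simp: Gr_iff)
  have l: "sub (line x)" "dim (line x) = 1" using line_Gr[OF False] by (auto simp: Gr_iff)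
  have "\<exists>A. sub A \<and> line x \<subseteq> A \<and> A \<subseteq> X \<and> dim A = d"
    by (rule intermediate_subspace[OF l(1) X(1) line_least[OF X(1) assms(3)]]) (use l X assms in simp_all)
  then obtain A where "A \<in> Gr d" "line x \<subseteq> A" "A \<subseteq> X" by (auto simp: Gr_iff)
  then show ?thesis using line_self[of x] by blast
qed

lemma Gr_two:
  assumes "0 < i" "i < n" shows "\<exists>A\<in>Gr i. \<exists>B\<in>Gr i. A \<noteq> B"
proof -
  obtain d where d: "i = Suc d" using assms by (cases i) auto
  have "{0} \<in> Gr 0" by (simp add: Gr_0)
  then obtain H where H: "H \<in> Gr d" using Gr_ex_upper[of "{0}" 0 d] assms d by auto
  then obtain v where v: "v \<notin> H" using Gr_outside[of H d] assms d by auto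
  have A: "adjoin v H \<in> Gr i" using adjoin_Gr[OF H v] d by simp
  then obtain w where w: "w \<notin> adjoin v H" using Gr_outside[of "adjoin v H" i] assms by auto
  then have "w \<notin> H" using subset_adjoin[of H v] by blast
  then have "adjoin w H \<in> Gr i" using adjoin_Gr[OF H] d by simp
  moreover have "w \<in> adjoin w H" using mem_adjoin H by (simp add: Gr_iff)
  ultimately show ?thesis using A w by blast
qed

text \<open>
  A subspace is the intersection of the subspaces covering it, if these are not the whole space.
\<close>

lemma star_determines:
  assumes "A \<in> Gr k" "B \<in> Gr k" "Suc k < n"
    and "\<And>X. X \<in> Gr (Suc k) \<Longrightarrow> A \<subseteq> X \<Longrightarrow> B \<subseteq> X"
  shows "A = B"
proof (rule ccontr)
  assume "A \<noteq> B"
  then obtain b where b: "b \<in> B" "b \<notin> A" using Gr_eqI[OF assms(2,1)] by blast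
  have A: "sub A" using assms by (simp add: Gr_iff)
  obtain v where v: "v \<notin> adjoin b A" using Gr_outside[OF adjoin_Gr[OF assms(1) b(2)]] assms by blast
  then have vA: "v \<notin> A" using subset_adjoin[of A b] by blast
  have "b \<in> adjoin v A" using assms(4)[OF adjoin_Gr[OF assms(1) vA] subset_adjoin] b by blast
  then show False using adjoin_exchange[OF A _ b(2)] v by blast
qed

lemma top_determines:
  assumes "C \<in> Gr (Suc (Suc k))" "C' \<in> Gr (Suc (Suc k))"
    and "\<And>X. X \<in> Gr (Suc k) \<Longrightarrow> X \<subseteq> C \<Longrightarrow> X \<subseteq> C'"
  shows "C = C'"
proof (rule Gr_eqI[OF assms(1,2)], rule subsetI)
  fix c assume "c \<in> C"
  then obtain X where "X \<in> Gr (Suc k)" "c \<in> X" "X \<subseteq> C" using Gr_vector_below[OF assms(1)] by blast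
  then show "c \<in> C'" using assms(3) by blast
qed

lemma Gr_lower_avoiding:
  assumes "C \<in> Gr (Suc d)" "a \<in> C" "a \<noteq> 0" shows "\<exists>H\<in>Gr d. H \<subseteq> C \<and> a \<notin> H"
proof -
  have C: "sub C" "dim C = Suc d" using assms by (auto simp: Gr_iff)
  have "{0} \<subseteq> C" "a \<notin> {0}" using sub_0[OF C(1)] assms by auto
  from hyperplane_avoiding[OF sub_zero C(1) this(1) assms(2) this(2)] obtain H where
    H: "sub H" "H \<subseteq> C" "a \<notin> H" "dim C = Suc (dim H)" by blast
  then have "H \<in> Gr d" using C by (simp add: Gr_iff)
  then show ?thesis using H by blast
qed

lemma top_two:
  assumes "C \<in> Gr (Suc (Suc k))"
  shows "\<exists>X\<in>Gr (Suc k). \<exists>Y\<in>Gr (Suc k). X \<subseteq> C \<and> Y \<subseteq> C \<and> X \<noteq> Y"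
proof -
  obtain X where X: "X \<in> Gr (Suc k)" "X \<subseteq> C" using Gr_ex_lower[OF assms, of "Suc k"] by auto
  obtain a where a: "a \<in> X" "a \<noteq> 0" using Gr_ex_nonzero[OF X(1)] by auto
  obtain Y where "Y \<in> Gr (Suc k)" "Y \<subseteq> C" "a \<notin> Y" using Gr_lower_avoiding[OF assms _ a(2)] a X by blast
  then show ?thesis using a X by blast
qed

lemma top_not_in_star:
  assumes "C \<in> Gr (Suc (Suc k))" "A \<in> Gr k" "0 < k"
  shows "\<exists>X\<in>Gr (Suc k). X \<subseteq> C \<and> \<not> A \<subseteq> X"
proof -
  obtain a where a: "a \<in> A" "a \<noteq> 0" using Gr_ex_nonzero[OF assms(2,3)] by blast
  show ?thesis
  proof (cases "a \<in> C")
    case True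
    then show ?thesis using Gr_lower_avoiding[OF assms(1) True a(2)] a by blast
  next
    case False
    obtain X where "X \<in> Gr (Suc k)" "X \<subseteq> C" using Gr_ex_lower[OF assms(1), of "Suc k"] by auto
    then show ?thesis using False a by blast
  qed
qed

end

locale two_spaces = V: fin_dim_space s1 n + W: fin_dim_space s2 n
  for s1 :: "'k::division_ring \<Rightarrow> 'v::ab_group_add \<Rightarrow> 'v"
    and s2 :: "'l::division_ring \<Rightarrow> 'w::ab_group_add \<Rightarrow> 'w" and n :: nat

lemma two_spaces_swap: "two_spaces s1 s2 n \<Longrightarrow> two_spaces s2 s1 n"
  by (simp add: two_spaces_def)

context two_spaces begin

lemma semilinear_image_flag:
  assumes l: "semilinear_bij s1 s2 l" and "V.flag S d"
  shows "W.flag (l ` S) d"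
proof -
  obtain \<sigma> where bij: "bij l" and add: "\<And>x y. l (x + y) = l x + l y"
    and s: "surj \<sigma>" and semi: "\<And>a x. l (s1 a x) = s2 (\<sigma> a) (l x)"
    using l unfolding semilinear_bij_def bij_def by blast
  have l0: "l 0 = 0" using add[of 0 0] by simp
  show ?thesis
    using assms(2)
  proof (induction rule: V.flag.induct)
    case flag_0
    then show ?case using W.flag_0 l0 by simp
  next
    case (flag_Suc S d v)
    have "l ` V.adjoin v S = W.adjoin (l v) (l ` S)"
    proof (intro equalityI subsetI)
      fix y assume "y \<in> l ` V.adjoin v S"
      then obtain x a where x: "y = l x" "x - s1 a v \<in> S" by (auto simp: V.adjoin_def)
      have "l x = l (x - s1 a v) + s2 (\<sigma> a) (l v)" by (simp flip: add semi)
      then have "y - s2 (\<sigma> a) (l v) = l (x - s1 a v)" using x by simp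
      then have "y - s2 (\<sigma> a) (l v) \<in> l ` S" using x(2) by (metis imageI)
      then show "y \<in> W.adjoin (l v) (l ` S)" by (auto simp: W.adjoin_def)
    next
      fix y assume "y \<in> W.adjoin (l v) (l ` S)"
      then obtain b x where x: "y - s2 b (l v) = l x" "x \<in> S" by (auto simp: W.adjoin_def)
      obtain a where a: "\<sigma> a = b" using s by (metis surj_def)
      have "y = l (x + s1 a v)" using x a by (simp add: add semi algebra_simps)
      moreover have "x + s1 a v \<in> V.adjoin v S" using x by (auto simp: V.adjoin_def intro!: exI[of _ a])
      ultimately show "y \<in> l ` V.adjoin v S" by blast
    qed
    moreover have "l v \<notin> l ` S" using flag_Suc.hyps(2) bij by (simp add: inj_image_mem_iff bij_is_inj)
    ultimately show ?case using W.flag_Suc[OF flag_Suc.IH] by simp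
  qed
qed

lemma semilinear_image_Gr:
  "semilinear_bij s1 s2 l \<Longrightarrow> S \<in> V.Gr i \<Longrightarrow> l ` S \<in> W.Gr i"
  using semilinear_image_flag[of l S i] V.flag_dim[of S] W.flag_sub[of "l ` S" i] W.flag_iff_dim[of "l ` S" i]
  by (simp add: V.Gr_iff W.Gr_iff)

text \<open>
  By \<open>span2_eq_Inter\<close> a map of points that respects incidence with the subspaces of dimension \<open>i\<close> respects
  collinearity.
\<close>

lemma linear_from_points:
  assumes \<phi>: "bij_betw \<phi> (V.Gr 1) (W.Gr 1)" and \<psi>: "bij_betw \<psi> (V.Gr i) (W.Gr i)"
    and inc: "\<And>P H. P \<in> V.Gr 1 \<Longrightarrow> H \<in> V.Gr i \<Longrightarrow> P \<subseteq> H \<longleftrightarrow> \<phi> P \<subseteq> \<psi> H"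
    and i: "2 \<le> i" "i < n"
  shows "\<exists>l. semilinear_bij s1 s2 l \<and> (\<forall>P\<in>V.Gr 1. \<phi> P = l ` P)"
proof -
  have "\<exists>w. w \<noteq> 0 \<and> \<phi> (V.line x) = W.line w" if "x \<noteq> 0" for x
  proof -
    have "\<phi> (V.line x) \<in> W.Gr 1" using V.line_Gr[OF that] \<phi> by (auto simp: bij_betw_def)
    then show ?thesis by (metis W.Gr_1_obtain)
  qed
  then obtain F' where F': "\<And>x. x \<noteq> 0 \<Longrightarrow> F' x \<noteq> 0 \<and> \<phi> (V.line x) = W.line (F' x)" by metis
  define F where "F = (\<lambda>x. if x = 0 then 0 else F' x)"
  have F: "\<phi> (V.line x) = W.line (F x)" if "x \<noteq> 0" for x using F' that by (simp add: F_def)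
  have F0: "F x = 0 \<longleftrightarrow> x = 0" for x using F' by (simp add: F_def)
  have mem: "x \<in> H \<longleftrightarrow> F x \<in> \<psi> H" if H: "H \<in> V.Gr i" for x H
  proof -
    have H': "\<psi> H \<in> W.Gr i" using \<psi> H by (auto simp: bij_betw_def)
    show ?thesis
    proof (cases "x = 0")
      case True
      moreover from this have "F x = 0" using F0 by blast
      ultimately show ?thesis using H H' V.sub_0 W.sub_0 by (simp add: V.Gr_iff W.Gr_iff)
    next
      case False
      then show ?thesis
        using inc[OF V.line_Gr[OF False] H] F[OF False] V.line_subset_iff[of H x] W.line_subset_iff[of "\<psi> H" "F x"] H H'
        by (simp add: V.Gr_iff W.Gr_iff)
    qed
  qed
  interpret C: collineation s1 s2 F
  proof
    fix x y z :: 'v and w :: 'w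
    show "F x = 0 \<longleftrightarrow> x = 0" by (rule F0)
    show "z \<in> V.span2 x y \<longleftrightarrow> F z \<in> W.span2 (F x) (F y)"
    proof -
      have "W.Gr i = \<psi> ` V.Gr i" using \<psi> by (simp add: bij_betw_def)
      then show ?thesis unfolding V.span2_eq_Inter[OF i] W.span2_eq_Inter[OF i] using mem by simp
    qed
    show "\<exists>x. w \<in> W.line (F x)"
    proof (cases "w = 0")
      case True
      then show ?thesis using W.zero_in_line by blast
    next
      case False
      then obtain P where P: "P \<in> V.Gr 1" "W.line w = \<phi> P"
        using W.line_Gr \<phi> unfolding bij_betw_def by (metis imageE)
      obtain x where "x \<noteq> 0" "P = V.line x" using V.Gr_1_obtain[OF P(1)] .
      then have "W.line w = W.line (F x)" using F P by simp
      then show ?thesis using W.line_self by metis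
    qed
    have "V.dim (V.span2 x y) \<noteq> V.dim UNIV" using V.dim_span2[of x y] i by simp
    then have "V.span2 x y \<noteq> UNIV" by metis
    then show "\<exists>z. z \<notin> V.span2 x y" by blast
  qed
  obtain l where l: "semilinear_bij s1 s2 l" "\<And>x. l x \<in> W.line (F x)" using C.fundamental_theorem by blast
  have "\<phi> P = l ` P" if P: "P \<in> V.Gr 1" for P
  proof -
    obtain x where x: "x \<noteq> 0" "P = V.line x" using V.Gr_1_obtain[OF P] .
    have lP: "l ` P \<in> W.Gr 1" using semilinear_image_Gr[OF l(1) P] .
    have "l ` P \<subseteq> \<phi> P"
    proof (rule subsetI, elim imageE)
      fix y u assume u: "y = l u" "u \<in> P"
      have "F u \<in> W.line (F x)" using C.F_line u x by blast
      then show "y \<in> \<phi> P" using l(2)[of u] W.line_trans u F[OF x(1)] x(2) by blast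
    qed
    moreover have "\<phi> P \<in> W.Gr 1" using P \<phi> by (auto simp: bij_betw_def)
    ultimately show ?thesis using W.Gr_eqI[OF lP] by blast
  qed
  then show ?thesis using l by blast
qed

text \<open>
  Bijections of two consecutive Grassmannians that preserve incidence. In the terminology of cliques,
  \<open>\<phi>\<close> sends tops to tops.
\<close>

definition inc_pair :: "nat \<Rightarrow> nat \<Rightarrow> ('v set \<Rightarrow> 'w set) \<Rightarrow> ('v set \<Rightarrow> 'w set) \<Rightarrow> bool" where
  "inc_pair k m \<phi> h \<longleftrightarrow> bij_betw \<phi> (V.Gr k) (W.Gr m) \<and> bij_betw h (V.Gr (Suc k)) (W.Gr (Suc m)) \<and>
     (\<forall>A\<in>V.Gr k. \<forall>C\<in>V.Gr (Suc k). A \<subseteq> C \<longleftrightarrow> \<phi> A \<subseteq> h C)"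

text \<open>
  The images of the members of a star form a clique. It lies in no top, because \<open>h\<close> would give a top that
  contains the star, and the members of a star span the space. So it lies in a star.
\<close>

lemma inc_pair_star:
  assumes p: "inc_pair (Suc k) (Suc m) \<phi> h" and n: "Suc (Suc k) < n" and A: "A \<in> V.Gr k"
  shows "\<exists>A'\<in>W.Gr m. \<forall>X\<in>V.Gr (Suc k). A \<subseteq> X \<longrightarrow> A' \<subseteq> \<phi> X"
proof -
  have \<phi>: "bij_betw \<phi> (V.Gr (Suc k)) (W.Gr (Suc m))"
    and h: "bij_betw h (V.Gr (Suc (Suc k))) (W.Gr (Suc (Suc m)))"
    and inc: "\<And>X C. X \<in> V.Gr (Suc k) \<Longrightarrow> C \<in> V.Gr (Suc (Suc k)) \<Longrightarrow> X \<subseteq> C \<longleftrightarrow> \<phi> X \<subseteq> h C"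
    using p by (auto simp: inc_pair_def)
  have \<phi>G: "\<phi> X \<in> W.Gr (Suc m)" if "X \<in> V.Gr (Suc k)" for X using \<phi> that by (auto simp: bij_betw_def)
  define Q where "Q = \<phi> ` {X \<in> V.Gr (Suc k). A \<subseteq> X}"
  have QG: "Q \<subseteq> W.Gr (Suc m)" using \<phi>G by (auto simp: Q_def)
  have clique: "W.adj Y Z" if YZ: "Y \<in> Q" "Z \<in> Q" "Y \<noteq> Z" for Y Z
  proof -
    obtain X X' where X: "X \<in> V.Gr (Suc k)" "X' \<in> V.Gr (Suc k)" "A \<subseteq> X" "A \<subseteq> X'" "Y = \<phi> X" "Z = \<phi> X'"
      using YZ(1,2) unfolding Q_def by blast
    then have "V.adj X X'" using V.adj_if_common_lower[OF X(1,2) _ A X(3,4)] YZ by blast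
    then have C: "V.ssum X X' \<in> V.Gr (Suc (Suc k))" using V.adj_ssum X by blast
    have "X \<subseteq> V.ssum X X'" "X' \<subseteq> V.ssum X X'"
      using V.ssum_upper1[of X' X] V.ssum_upper2[of X X'] X by (auto simp: V.Gr_iff)
    then have "Y \<subseteq> h (V.ssum X X')" "Z \<subseteq> h (V.ssum X X')" using inc X C by auto
    moreover have "h (V.ssum X X') \<in> W.Gr (Suc (Suc m))" using h C by (auto simp: bij_betw_def)
    ultimately show ?thesis using W.adj_if_common_upper[of Y "Suc m" Z] QG YZ by blast
  qed
  obtain v where v: "v \<notin> A" using V.Gr_outside[OF A] n by auto
  have X: "V.adjoin v A \<in> V.Gr (Suc k)" using V.adjoin_Gr[OF A v] .
  obtain w where w: "w \<notin> V.adjoin v A" using V.Gr_outside[OF X] n by auto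
  then have wA: "w \<notin> A" using V.subset_adjoin[of A v] by blast
  have X': "V.adjoin w A \<in> V.Gr (Suc k)" using V.adjoin_Gr[OF A wA] .
  have subA: "V.sub A" using A by (simp add: V.Gr_iff)
  have "V.adjoin v A \<noteq> V.adjoin w A" using w V.mem_adjoin[OF subA, of w] by blast
  then have ne: "\<phi> (V.adjoin v A) \<noteq> \<phi> (V.adjoin w A)" using \<phi> X X' by (auto simp: bij_betw_def inj_on_def)
  have inQ: "\<phi> (V.adjoin v A) \<in> Q" "\<phi> (V.adjoin w A) \<in> Q"
    unfolding Q_def using X X' V.subset_adjoin[of A] by blast+
  from W.clique_star_or_top[OF QG clique inQ ne] show ?thesis
  proof
    assume "\<exists>H\<in>W.Gr m. \<forall>Z\<in>Q. H \<subseteq> Z"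
    then show ?thesis by (auto simp: Q_def)
  next
    assume "\<exists>D\<in>W.Gr (Suc (Suc m)). \<forall>Z\<in>Q. Z \<subseteq> D"
    then obtain C where C: "C \<in> V.Gr (Suc (Suc k))" "\<forall>Z\<in>Q. Z \<subseteq> h C"
      using h unfolding bij_betw_def by (metis imageE)
    have sub: "X \<subseteq> C" if "X \<in> V.Gr (Suc k)" "A \<subseteq> X" for X
      using C inc that by (auto simp: Q_def)
    obtain u where u: "u \<notin> C" using V.Gr_outside[OF C(1)] n by auto
    have "A \<subseteq> C" using sub[OF X V.subset_adjoin] V.subset_adjoin[of A v] by blast
    then have "u \<notin> A" using u by blast
    then have "V.adjoin u A \<subseteq> C" using sub V.adjoin_Gr[OF A] V.subset_adjoin by blast
    then show ?thesis using u V.mem_adjoin[OF subA, of u] by blast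
  qed
qed

lemma inc_pair_inv:
  assumes "inc_pair k m \<phi> h"
  shows "two_spaces.inc_pair s2 s1 m k (inv_into (V.Gr k) \<phi>) (inv_into (V.Gr (Suc k)) h)"
proof -
  interpret I: two_spaces s2 s1 n using two_spaces_swap two_spaces_axioms .
  have \<phi>: "bij_betw \<phi> (V.Gr k) (W.Gr m)" and h: "bij_betw h (V.Gr (Suc k)) (W.Gr (Suc m))"
    and inc: "\<And>X C. X \<in> V.Gr k \<Longrightarrow> C \<in> V.Gr (Suc k) \<Longrightarrow> X \<subseteq> C \<longleftrightarrow> \<phi> X \<subseteq> h C"
    using assms by (auto simp: inc_pair_def)
  have "A \<subseteq> C \<longleftrightarrow> inv_into (V.Gr k) \<phi> A \<subseteq> inv_into (V.Gr (Suc k)) h C"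
    if "A \<in> W.Gr m" "C \<in> W.Gr (Suc m)" for A C
  proof -
    have "inv_into (V.Gr k) \<phi> A \<in> V.Gr k" "\<phi> (inv_into (V.Gr k) \<phi> A) = A"
      "inv_into (V.Gr (Suc k)) h C \<in> V.Gr (Suc k)" "h (inv_into (V.Gr (Suc k)) h C) = C"
      using \<phi> h that by (auto simp: bij_betw_def inv_into_into f_inv_into_f)
    then show ?thesis using inc by metis
  qed
  then show ?thesis unfolding I.inc_pair_def using \<phi> h bij_betw_inv_into by blast
qed

text \<open>
  The star of \<open>A\<close> goes into a star, whose centre is \<open>g A\<close>. The inverse pair gives a map in the other direction, and the
  two are inverse to each other because a star determines its centre.
\<close>

lemma inc_pair_descend:
  assumes p: "inc_pair (Suc k) (Suc m) \<phi> h" and n: "Suc (Suc k) < n" "Suc (Suc m) < n"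
  shows "\<exists>g. inc_pair k m g \<phi>"
proof -
  interpret I: two_spaces s2 s1 n using two_spaces_swap two_spaces_axioms .
  have \<phi>: "bij_betw \<phi> (V.Gr (Suc k)) (W.Gr (Suc m))" using p by (simp add: inc_pair_def)
  let ?i = "inv_into (V.Gr (Suc k)) \<phi>"
  have \<phi>G: "\<phi> X \<in> W.Gr (Suc m)" "?i (\<phi> X) = X" if "X \<in> V.Gr (Suc k)" for X
    using \<phi> that by (auto simp: bij_betw_def)
  have iG: "?i Y \<in> V.Gr (Suc k)" "\<phi> (?i Y) = Y" if "Y \<in> W.Gr (Suc m)" for Y
    using \<phi> that by (auto simp: bij_betw_def inv_into_into f_inv_into_f)
  have "\<exists>g. \<forall>A\<in>V.Gr k. g A \<in> W.Gr m \<and> (\<forall>X\<in>V.Gr (Suc k). A \<subseteq> X \<longrightarrow> g A \<subseteq> \<phi> X)"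
    by (rule bchoice) (use inc_pair_star[OF p n(1)] in blast)
  then obtain g where "\<forall>A\<in>V.Gr k. g A \<in> W.Gr m \<and> (\<forall>X\<in>V.Gr (Suc k). A \<subseteq> X \<longrightarrow> g A \<subseteq> \<phi> X)" ..
  then have g: "\<And>A. A \<in> V.Gr k \<Longrightarrow> g A \<in> W.Gr m"
    "\<And>A X. A \<in> V.Gr k \<Longrightarrow> X \<in> V.Gr (Suc k) \<Longrightarrow> A \<subseteq> X \<Longrightarrow> g A \<subseteq> \<phi> X" by simp_all
  have "\<exists>g. \<forall>A\<in>W.Gr m. g A \<in> V.Gr k \<and> (\<forall>Y\<in>W.Gr (Suc m). A \<subseteq> Y \<longrightarrow> g A \<subseteq> ?i Y)"
    by (rule bchoice) (use I.inc_pair_star[OF inc_pair_inv[OF p] n(2)] in blast)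
  then obtain g' where "\<forall>A\<in>W.Gr m. g' A \<in> V.Gr k \<and> (\<forall>Y\<in>W.Gr (Suc m). A \<subseteq> Y \<longrightarrow> g' A \<subseteq> ?i Y)" ..
  then have g': "\<And>A. A \<in> W.Gr m \<Longrightarrow> g' A \<in> V.Gr k"
    "\<And>A Y. A \<in> W.Gr m \<Longrightarrow> Y \<in> W.Gr (Suc m) \<Longrightarrow> A \<subseteq> Y \<Longrightarrow> g' A \<subseteq> ?i Y" by simp_all
  have g'g: "g' (g A) = A" if A: "A \<in> V.Gr k" for A
  proof (rule sym, rule V.star_determines[OF A g'(1)[OF g(1)[OF A]]])
    show "Suc k < n" using n by simp
    fix X assume X: "X \<in> V.Gr (Suc k)" "A \<subseteq> X"
    have "g' (g A) \<subseteq> ?i (\<phi> X)" using g'(2)[OF g(1)[OF A] \<phi>G(1)[OF X(1)] g(2)[OF A X]] .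
    then show "g' (g A) \<subseteq> X" using \<phi>G(2)[OF X(1)] by simp
  qed
  have gg': "g (g' A) = A" if A: "A \<in> W.Gr m" for A
  proof (rule sym, rule W.star_determines[OF A g(1)[OF g'(1)[OF A]]])
    show "Suc m < n" using n by simp
    fix Y assume Y: "Y \<in> W.Gr (Suc m)" "A \<subseteq> Y"
    have "g (g' A) \<subseteq> \<phi> (?i Y)" using g(2)[OF g'(1)[OF A] iG(1)[OF Y(1)] g'(2)[OF A Y]] .
    then show "g (g' A) \<subseteq> Y" using iG(2)[OF Y(1)] by simp
  qed
  have "bij_betw g (V.Gr k) (W.Gr m)"
    by (rule bij_betw_byWitness[where f' = g']) (use g g' g'g gg' in auto)
  moreover have "A \<subseteq> X \<longleftrightarrow> g A \<subseteq> \<phi> X" if A: "A \<in> V.Gr k" and X: "X \<in> V.Gr (Suc k)" for A X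
    using g(2)[OF A X] g'(2)[OF g(1)[OF A] \<phi>G(1)[OF X]] g'g[OF A] \<phi>G(2)[OF X] by auto
  ultimately show ?thesis using \<phi> by (auto simp: inc_pair_def)
qed

text \<open>
  Among the Grassmannians of proper subspaces only the one of dimension zero is a singleton.
\<close>

lemma bij_Gr_0:
  assumes "bij_betw g (V.Gr k) (W.Gr m)" "k < n" "m < n" shows "k = 0 \<longleftrightarrow> m = 0"
proof
  assume "k = 0"
  then have *: "W.Gr m = {g {0}}" using assms V.Gr_0 by (simp add: bij_betw_def)
  show "m = 0"
  proof (rule ccontr)
    assume "m \<noteq> 0"
    then show False using W.Gr_two[of m] assms * by auto
  qed
next
  assume "m = 0"
  then have *: "\<And>A. A \<in> V.Gr k \<Longrightarrow> g A = {0}" "inj_on g (V.Gr k)"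
    using assms W.Gr_0 by (auto simp: bij_betw_def)
  show "k = 0"
  proof (rule ccontr)
    assume "k \<noteq> 0"
    then show False using V.Gr_two[of k] assms * unfolding inj_on_def by (metis neq0_conv)
  qed
qed

text \<open>
  Descent by one dimension lowers both \<open>k\<close> and \<open>m\<close>, and by \<open>bij_Gr_0\<close> they reach \<open>0\<close> together. Points and lines
  provide \<open>l\<close>, and on the way up a subspace is covered by its subspaces of one dimension less.
\<close>

lemma inc_pair_linear:
  assumes "inc_pair k m \<phi> h" "0 < k" "0 < m" "Suc k < n" "Suc m < n"
  shows "m = k \<and> (\<exists>l. semilinear_bij s1 s2 l \<and> (\<forall>S\<in>V.Gr k. \<phi> S = l ` S))"
  using assms
proof (induction k arbitrary: m \<phi> h)
  case (Suc k)
  obtain m' where m': "m = Suc m'" using Suc.prems by (cases m) auto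
  obtain g where g: "inc_pair k m' g \<phi>"
    using inc_pair_descend[of k m' \<phi> h] Suc.prems m' by blast
  have gbij: "bij_betw g (V.Gr k) (W.Gr m')" using g by (simp add: inc_pair_def)
  have k0: "k = 0 \<longleftrightarrow> m' = 0" using bij_Gr_0[OF gbij] Suc.prems m' by simp
  show ?case
  proof (cases "k = 0")
    case True
    then have m: "m = 1" using k0 m' by simp
    have p: "bij_betw \<phi> (V.Gr 1) (W.Gr 1)" "bij_betw h (V.Gr 2) (W.Gr 2)"
      "\<And>P H. P \<in> V.Gr 1 \<Longrightarrow> H \<in> V.Gr 2 \<Longrightarrow> P \<subseteq> H \<longleftrightarrow> \<phi> P \<subseteq> h H"
      using Suc.prems(1) True m by (simp_all add: inc_pair_def numeral_2_eq_2)
    have "2 < n" using Suc.prems True by simp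
    then show ?thesis using linear_from_points[OF p] True m by simp
  next
    case False
    then obtain l where l: "m' = k" "semilinear_bij s1 s2 l" "\<And>S. S \<in> V.Gr k \<Longrightarrow> g S = l ` S"
      using Suc.IH[OF g] k0 Suc.prems m' by auto
    have "\<phi> X = l ` X" if X: "X \<in> V.Gr (Suc k)" for X
    proof -
      have lX: "l ` X \<in> W.Gr (Suc k)" using semilinear_image_Gr[OF l(2) X] .
      have \<phi>X: "\<phi> X \<in> W.Gr (Suc k)" using Suc.prems(1) m' l(1) X by (auto simp: inc_pair_def bij_betw_def)
      have "l ` X \<subseteq> \<phi> X"
      proof (rule subsetI, elim imageE)
        fix y x assume x: "y = l x" "x \<in> X"
        obtain A where A: "A \<in> V.Gr k" "x \<in> A" "A \<subseteq> X" using V.Gr_vector_below[OF X _ x(2)] False by auto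
        then have "g A \<subseteq> \<phi> X" using g X by (simp add: inc_pair_def)
        then show "y \<in> \<phi> X" using l(3)[OF A(1)] A(2) x(1) by blast
      qed
      then show ?thesis using W.Gr_eqI[OF lX \<phi>X] by blast
    qed
    then show ?thesis using l m' by blast
  qed
qed simp

definition adj_bij :: "nat \<Rightarrow> nat \<Rightarrow> ('v set \<Rightarrow> 'w set) \<Rightarrow> bool" where
  "adj_bij k m \<phi> \<longleftrightarrow> bij_betw \<phi> (V.Gr k) (W.Gr m) \<and>
     (\<forall>X\<in>V.Gr k. \<forall>Y\<in>V.Gr k. V.adj X Y \<longleftrightarrow> W.adj (\<phi> X) (\<phi> Y))"

text \<open>
  The top of \<open>C\<close> is the clique of all hyperplanes of \<open>C\<close>.
\<close>

definition top_to_top :: "nat \<Rightarrow> nat \<Rightarrow> ('v set \<Rightarrow> 'w set) \<Rightarrow> 'v set \<Rightarrow> bool" where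
  "top_to_top k m \<phi> C \<longleftrightarrow> (\<exists>D\<in>W.Gr (Suc m). \<forall>X\<in>V.Gr k. X \<subseteq> C \<longleftrightarrow> \<phi> X \<subseteq> D)"

definition top_to_star :: "nat \<Rightarrow> nat \<Rightarrow> ('v set \<Rightarrow> 'w set) \<Rightarrow> 'v set \<Rightarrow> bool" where
  "top_to_star k m \<phi> C \<longleftrightarrow> (\<exists>D\<in>W.Gr (m - 1). \<forall>X\<in>V.Gr k. X \<subseteq> C \<longleftrightarrow> D \<subseteq> \<phi> X)"

lemma adj_bij_mem: "adj_bij k m \<phi> \<Longrightarrow> X \<in> V.Gr k \<Longrightarrow> \<phi> X \<in> W.Gr m"
  by (auto simp: adj_bij_def bij_betw_def)

lemma adj_bij_inv:
  assumes "adj_bij k m \<phi>"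
  shows "two_spaces.adj_bij s2 s1 m k (inv_into (V.Gr k) \<phi>)"
proof -
  interpret I: two_spaces s2 s1 n using two_spaces_swap two_spaces_axioms .
  have bij: "bij_betw \<phi> (V.Gr k) (W.Gr m)"
    and adj: "\<And>X Y. X \<in> V.Gr k \<Longrightarrow> Y \<in> V.Gr k \<Longrightarrow> V.adj X Y \<longleftrightarrow> W.adj (\<phi> X) (\<phi> Y)"
    using assms by (auto simp: adj_bij_def)
  have "inv_into (V.Gr k) \<phi> Y \<in> V.Gr k" "\<phi> (inv_into (V.Gr k) \<phi> Y) = Y" if "Y \<in> W.Gr m" for Y
    using bij that by (auto simp: bij_betw_def inv_into_into f_inv_into_f)
  then show ?thesis unfolding I.adj_bij_def using adj bij_betw_inv_into[OF bij] by simp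
qed

text \<open>
  The preimage of the clique \<open>R\<close> is a clique, so it lies in a star or in a top. It contains the top of \<open>C\<close>, which lies in
  no star and in no other top.
\<close>

lemma top_image_maximal:
  assumes \<phi>: "adj_bij (Suc k) (Suc m) \<phi>" and k: "0 < k"
    and C: "C \<in> V.Gr (Suc (Suc k))"
    and R: "R \<subseteq> W.Gr (Suc m)" "\<And>Y Z. Y \<in> R \<Longrightarrow> Z \<in> R \<Longrightarrow> Y \<noteq> Z \<Longrightarrow> W.adj Y Z"
    and sub: "\<And>X. X \<in> V.Gr (Suc k) \<Longrightarrow> X \<subseteq> C \<Longrightarrow> \<phi> X \<in> R"
    and X: "X \<in> V.Gr (Suc k)" "\<phi> X \<in> R"
  shows "X \<subseteq> C"
proof -
  have inj: "inj_on \<phi> (V.Gr (Suc k))"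
    and adj: "\<And>X Y. X \<in> V.Gr (Suc k) \<Longrightarrow> Y \<in> V.Gr (Suc k) \<Longrightarrow> V.adj X Y \<longleftrightarrow> W.adj (\<phi> X) (\<phi> Y)"
    using \<phi> by (auto simp: adj_bij_def bij_betw_def)
  define Q where "Q = {Z \<in> V.Gr (Suc k). \<phi> Z \<in> R}"
  have QG: "Q \<subseteq> V.Gr (Suc k)" by (auto simp: Q_def)
  have clique: "V.adj Y Z" if "Y \<in> Q" "Z \<in> Q" "Y \<noteq> Z" for Y Z
    using that adj[of Y Z] R(2)[of "\<phi> Y" "\<phi> Z"] inj by (auto simp: Q_def inj_on_def)
  obtain X1 X2 where X1: "X1 \<in> V.Gr (Suc k)" "X1 \<subseteq> C"
    and X2: "X2 \<in> V.Gr (Suc k)" "X2 \<subseteq> C" and ne12: "X1 \<noteq> X2" using V.top_two[OF C] by blast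
  have in12: "X1 \<in> Q" "X2 \<in> Q" "X1 \<noteq> X2" using X1 X2 sub ne12 by (auto simp: Q_def)
  from V.clique_star_or_top[OF QG clique in12] show ?thesis
  proof
    assume "\<exists>H\<in>V.Gr k. \<forall>Z\<in>Q. H \<subseteq> Z"
    then obtain H where H: "H \<in> V.Gr k" "\<And>Z. Z \<in> Q \<Longrightarrow> H \<subseteq> Z" by blast
    obtain Z where "Z \<in> V.Gr (Suc k)" "Z \<subseteq> C" "\<not> H \<subseteq> Z" using V.top_not_in_star[OF C H(1) k] by blast
    then show ?thesis using H(2)[of Z] sub by (auto simp: Q_def)
  next
    assume "\<exists>D\<in>V.Gr (Suc (Suc k)). \<forall>Z\<in>Q. Z \<subseteq> D"
    then obtain D where D: "D \<in> V.Gr (Suc (Suc k))" "\<And>Z. Z \<in> Q \<Longrightarrow> Z \<subseteq> D" by blast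
    have "C = D" using V.top_determines[OF C D(1)] D(2) sub by (auto simp: Q_def)
    then show ?thesis using D(2) X by (auto simp: Q_def)
  qed
qed

lemma top_image:
  assumes \<phi>: "adj_bij (Suc k) (Suc m) \<phi>" and k: "0 < k"
    and C: "C \<in> V.Gr (Suc (Suc k))"
  shows "top_to_top (Suc k) (Suc m) \<phi> C \<or> top_to_star (Suc k) (Suc m) \<phi> C"
proof -
  have bij: "bij_betw \<phi> (V.Gr (Suc k)) (W.Gr (Suc m))"
    and adj: "\<And>X Y. X \<in> V.Gr (Suc k) \<Longrightarrow> Y \<in> V.Gr (Suc k) \<Longrightarrow> V.adj X Y \<longleftrightarrow> W.adj (\<phi> X) (\<phi> Y)"
    using \<phi> by (auto simp: adj_bij_def)
  have \<phi>G: "\<phi> X \<in> W.Gr (Suc m)" if "X \<in> V.Gr (Suc k)" for X using bij that by (auto simp: bij_betw_def)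
  define Q where "Q = \<phi> ` {X \<in> V.Gr (Suc k). X \<subseteq> C}"
  have QG: "Q \<subseteq> W.Gr (Suc m)" using \<phi>G by (auto simp: Q_def)
  have clique: "W.adj Y Z" if YZ: "Y \<in> Q" "Z \<in> Q" "Y \<noteq> Z" for Y Z
  proof -
    obtain X X' where X: "X \<in> V.Gr (Suc k)" "X' \<in> V.Gr (Suc k)" "X \<subseteq> C" "X' \<subseteq> C" "Y = \<phi> X" "Z = \<phi> X'"
      using YZ by (auto simp: Q_def)
    then have "V.adj X X'" using V.adj_if_common_upper[OF X(1,2) _ C X(3,4)] YZ by blast
    then show ?thesis using adj X by blast
  qed
  obtain X1 X2 where X1: "X1 \<in> V.Gr (Suc k)" "X1 \<subseteq> C"
    and X2: "X2 \<in> V.Gr (Suc k)" "X2 \<subseteq> C" and ne12: "X1 \<noteq> X2" using V.top_two[OF C] by blast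
  have ne: "\<phi> X1 \<noteq> \<phi> X2" using bij X1 X2 ne12 by (auto simp: bij_betw_def inj_on_def)
  have in12: "\<phi> X1 \<in> Q" "\<phi> X2 \<in> Q" using X1 X2 by (auto simp: Q_def)
  have inQ: "\<phi> X \<in> Q" if "X \<in> V.Gr (Suc k)" "X \<subseteq> C" for X using that by (auto simp: Q_def)
  from W.clique_star_or_top[OF QG clique in12 ne] show ?thesis
  proof
    assume "\<exists>H\<in>W.Gr m. \<forall>Z\<in>Q. H \<subseteq> Z"
    then obtain D where D: "D \<in> W.Gr m" "\<And>Z. Z \<in> Q \<Longrightarrow> D \<subseteq> Z" by blast
    have "X \<subseteq> C \<longleftrightarrow> D \<subseteq> \<phi> X" if X: "X \<in> V.Gr (Suc k)" for X
    proof
      assume "D \<subseteq> \<phi> X"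
      show "X \<subseteq> C"
      proof (rule top_image_maximal[OF \<phi> k C, where R = "{Y \<in> W.Gr (Suc m). D \<subseteq> Y}"])
        show "W.adj Y Z" if "Y \<in> {Y \<in> W.Gr (Suc m). D \<subseteq> Y}" "Z \<in> {Y \<in> W.Gr (Suc m). D \<subseteq> Y}" "Y \<noteq> Z" for Y Z
          using W.adj_if_common_lower[OF _ _ that(3) D(1)] that by blast
      qed (use D(2) inQ X \<open>D \<subseteq> \<phi> X\<close> \<phi>G in auto)
    qed (use D(2) inQ[OF X] in blast)
    then have "top_to_star (Suc k) (Suc m) \<phi> C" using D(1) by (auto simp: top_to_star_def)
    then show ?thesis ..
  next
    assume "\<exists>D\<in>W.Gr (Suc (Suc m)). \<forall>Z\<in>Q. Z \<subseteq> D"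
    then obtain D where D: "D \<in> W.Gr (Suc (Suc m))" "\<And>Z. Z \<in> Q \<Longrightarrow> Z \<subseteq> D" by blast
    have "X \<subseteq> C \<longleftrightarrow> \<phi> X \<subseteq> D" if X: "X \<in> V.Gr (Suc k)" for X
    proof
      assume "\<phi> X \<subseteq> D"
      show "X \<subseteq> C"
      proof (rule top_image_maximal[OF \<phi> k C, where R = "{Y \<in> W.Gr (Suc m). Y \<subseteq> D}"])
        show "W.adj Y Z" if "Y \<in> {Y \<in> W.Gr (Suc m). Y \<subseteq> D}" "Z \<in> {Y \<in> W.Gr (Suc m). Y \<subseteq> D}" "Y \<noteq> Z" for Y Z
          using W.adj_if_common_upper[OF _ _ that(3) D(1)] that by blast
      qed (use D(2) inQ X \<open>\<phi> X \<subseteq> D\<close> \<phi>G in auto)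
    qed (use D(2) inQ[OF X] in blast)
    then have "top_to_top (Suc k) (Suc m) \<phi> C" using D(1) by (auto simp: top_to_top_def)
    then show ?thesis ..
  qed
qed

text \<open>
  The tops of adjacent spaces share exactly one member. A top and a star that share a member share also
  other ones.
\<close>

lemma top_to_top_adjacent:
  assumes \<phi>: "adj_bij (Suc k) (Suc m) \<phi>"
    and C: "C \<in> V.Gr (Suc (Suc k))" and a: "V.adj C C'"
    and T: "top_to_top (Suc k) (Suc m) \<phi> C" and S: "top_to_star (Suc k) (Suc m) \<phi> C'"
  shows False
proof -
  have bij: "bij_betw \<phi> (V.Gr (Suc k)) (W.Gr (Suc m))" using \<phi> by (simp add: adj_bij_def)
  obtain D where D: "D \<in> W.Gr (Suc (Suc m))" "\<And>X. X \<in> V.Gr (Suc k) \<Longrightarrow> X \<subseteq> C \<longleftrightarrow> \<phi> X \<subseteq> D"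
    using T by (auto simp: top_to_top_def)
  obtain E where E: "E \<in> W.Gr m" "\<And>X. X \<in> V.Gr (Suc k) \<Longrightarrow> X \<subseteq> C' \<longleftrightarrow> E \<subseteq> \<phi> X"
    using S by (auto simp: top_to_star_def)
  have X0: "C \<inter> C' \<in> V.Gr (Suc k)" using V.adj_Int[OF a C] .
  have \<phi>X0: "\<phi> (C \<inter> C') \<in> W.Gr (Suc m)" using bij X0 by (auto simp: bij_betw_def)
  have le: "E \<subseteq> \<phi> (C \<inter> C')" "\<phi> (C \<inter> C') \<subseteq> D" using D(2)[OF X0] E(2)[OF X0] by auto
  obtain v where v: "v \<in> D" "v \<notin> \<phi> (C \<inter> C')" using W.Gr_ex_vector[OF D(1) \<phi>X0] by auto
  have vE: "v \<notin> E" using v le by blast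
  have sub: "W.sub D" "W.sub E" using D E by (auto simp: W.Gr_iff)
  have Y: "W.adjoin v E \<in> W.Gr (Suc m)" using W.adjoin_Gr[OF E(1) vE] .
  then obtain X where X: "X \<in> V.Gr (Suc k)" "\<phi> X = W.adjoin v E" using bij unfolding bij_betw_def by (metis imageE)
  have "\<phi> X \<subseteq> D" unfolding X(2) using W.adjoin_least[OF sub(1) _ v(1)] le by blast
  moreover have "E \<subseteq> \<phi> X" unfolding X(2) by (rule W.subset_adjoin)
  ultimately have "X \<subseteq> C \<inter> C'" using D(2)[OF X(1)] E(2)[OF X(1)] by blast
  then have "X = C \<inter> C'" using V.Gr_eqI[OF X(1) X0] by blast
  then show False using X(2) v W.mem_adjoin[OF sub(2), of v] by blast
qed

lemma tops_alike:
  assumes \<phi>: "adj_bij (Suc k) (Suc m) \<phi>" and k: "0 < k" "Suc (Suc k) \<le> n"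
    and C: "C \<in> V.Gr (Suc (Suc k))" "C' \<in> V.Gr (Suc (Suc k))"
    and T: "top_to_top (Suc k) (Suc m) \<phi> C"
  shows "top_to_top (Suc k) (Suc m) \<phi> C'"
  using V.Gr_connected[OF C k(2)]
proof (induction rule: rtranclp_induct)
  case (step D E)
  then show ?case using top_image[OF \<phi> k(1), of E] top_to_top_adjacent[OF \<phi>, of D E] by blast
qed (rule T)

lemma chow_dichotomy:
  assumes "adj_bij (Suc k) (Suc m) \<phi>" "0 < k" "Suc (Suc k) \<le> n"
  shows "(\<forall>C\<in>V.Gr (Suc (Suc k)). top_to_top (Suc k) (Suc m) \<phi> C) \<or>
    (\<forall>C\<in>V.Gr (Suc (Suc k)). top_to_star (Suc k) (Suc m) \<phi> C)"
  using top_image[OF assms(1,2)] tops_alike[OF assms] by blast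

text \<open>
  A top that goes to a top is the image of one under the inverse map, so the inverse cannot send tops to
  stars. Hence \<open>\<phi>\<close> induces a bijection of tops, which is one of Grassmannians one dimension higher.
\<close>

lemma chow_linear:
  assumes \<phi>: "adj_bij (Suc k) (Suc m) \<phi>" and n: "0 < k" "Suc (Suc k) < n" "0 < m" "Suc (Suc m) < n"
    and T: "\<And>C. C \<in> V.Gr (Suc (Suc k)) \<Longrightarrow> top_to_top (Suc k) (Suc m) \<phi> C"
  shows "m = k \<and> (\<exists>l. semilinear_bij s1 s2 l \<and> (\<forall>S\<in>V.Gr (Suc k). \<phi> S = l ` S))"
proof -
  interpret I: two_spaces s2 s1 n using two_spaces_swap two_spaces_axioms .
  have bij: "bij_betw \<phi> (V.Gr (Suc k)) (W.Gr (Suc m))" using \<phi> by (simp add: adj_bij_def)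
  let ?i = "inv_into (V.Gr (Suc k)) \<phi>"
  have i: "?i Y \<in> V.Gr (Suc k)" "\<phi> (?i Y) = Y" if "Y \<in> W.Gr (Suc m)" for Y
    using bij that by (auto simp: bij_betw_def inv_into_into f_inv_into_f)
  have j: "\<phi> X \<in> W.Gr (Suc m)" "?i (\<phi> X) = X" if "X \<in> V.Gr (Suc k)" for X
    using bij that by (auto simp: bij_betw_def)
  have "\<exists>D. D \<in> W.Gr (Suc (Suc m)) \<and> (\<forall>X\<in>V.Gr (Suc k). X \<subseteq> C \<longleftrightarrow> \<phi> X \<subseteq> D)"
    if "C \<in> V.Gr (Suc (Suc k))" for C
    using T[OF that] unfolding top_to_top_def Bex_def .
  then have "\<exists>h. \<forall>C\<in>V.Gr (Suc (Suc k)). h C \<in> W.Gr (Suc (Suc m)) \<and>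
      (\<forall>X\<in>V.Gr (Suc k). X \<subseteq> C \<longleftrightarrow> \<phi> X \<subseteq> h C)"
    by (intro bchoice ballI)
  then obtain h where "\<forall>C\<in>V.Gr (Suc (Suc k)). h C \<in> W.Gr (Suc (Suc m)) \<and>
      (\<forall>X\<in>V.Gr (Suc k). X \<subseteq> C \<longleftrightarrow> \<phi> X \<subseteq> h C)" ..
  then have h: "\<And>C. C \<in> V.Gr (Suc (Suc k)) \<Longrightarrow> h C \<in> W.Gr (Suc (Suc m))"
    "\<And>C X. C \<in> V.Gr (Suc (Suc k)) \<Longrightarrow> X \<in> V.Gr (Suc k) \<Longrightarrow> X \<subseteq> C \<longleftrightarrow> \<phi> X \<subseteq> h C" by blast+
  have \<phi>': "I.adj_bij (Suc m) (Suc k) ?i" using adj_bij_inv[OF \<phi>] .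
  obtain C0 where C0: "C0 \<in> V.Gr (Suc (Suc k))"
    using V.Gr_ex_upper[of "{0}" 0 "Suc (Suc k)"] n by (auto simp: V.Gr_0)
  have "\<not> I.top_to_star (Suc m) (Suc k) ?i (h C0)"
  proof
    assume "I.top_to_star (Suc m) (Suc k) ?i (h C0)"
    then obtain A where A: "A \<in> V.Gr k" "\<And>Y. Y \<in> W.Gr (Suc m) \<Longrightarrow> Y \<subseteq> h C0 \<longleftrightarrow> A \<subseteq> ?i Y"
      by (auto simp: I.top_to_star_def)
    obtain X where X: "X \<in> V.Gr (Suc k)" "X \<subseteq> C0" "\<not> A \<subseteq> X" using V.top_not_in_star[OF C0 A(1) n(1)] by blast
    then show False using h(2)[OF C0 X(1)] A(2)[OF j(1)[OF X(1)]] j(2)[OF X(1)] by simp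
  qed
  then have T': "I.top_to_top (Suc m) (Suc k) ?i D" if "D \<in> W.Gr (Suc (Suc m))" for D
    using I.chow_dichotomy[OF \<phi>' n(3)] n(4) h(1)[OF C0] that by auto
  have "bij_betw h (V.Gr (Suc (Suc k))) (W.Gr (Suc (Suc m)))"
    unfolding bij_betw_def
  proof
    show "inj_on h (V.Gr (Suc (Suc k)))"
    proof (rule inj_onI)
      fix C C' assume C: "C \<in> V.Gr (Suc (Suc k))" "C' \<in> V.Gr (Suc (Suc k))" "h C = h C'"
      show "C = C'" by (rule V.top_determines[OF C(1,2)]) (use h(2)[OF C(1)] h(2)[OF C(2)] C(3) in auto)
    qed
    show "h ` V.Gr (Suc (Suc k)) = W.Gr (Suc (Suc m))"
    proof
      show "W.Gr (Suc (Suc m)) \<subseteq> h ` V.Gr (Suc (Suc k))"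
      proof
        fix D assume D: "D \<in> W.Gr (Suc (Suc m))"
        from T'[OF D] obtain C where C: "C \<in> V.Gr (Suc (Suc k))"
          "\<forall>Y\<in>W.Gr (Suc m). Y \<subseteq> D \<longleftrightarrow> ?i Y \<subseteq> C"
          unfolding I.top_to_top_def ..
        have "D = h C"
        proof (rule W.top_determines[OF D h(1)[OF C(1)]])
          fix Y assume Y: "Y \<in> W.Gr (Suc m)" "Y \<subseteq> D"
          then show "Y \<subseteq> h C" using bspec[OF C(2) Y(1)] h(2)[OF C(1) i(1)[OF Y(1)]] i(2)[OF Y(1)] by simp
        qed
        then show "D \<in> h ` V.Gr (Suc (Suc k))" using C by blast
      qed
    qed (use h(1) in blast)
  qed
  then have "inc_pair (Suc k) (Suc m) \<phi> h" using bij h(2) by (auto simp: inc_pair_def)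
  from inc_pair_linear[OF this] show ?thesis using n by simp
qed

end

section \<open>Isomorphisms of complementarity and the theorem\<close>

context two_spaces begin

text \<open>
  The pairs of component maps that arise from adjacency preserving transformations.
\<close>

definition compl_iso :: "nat \<Rightarrow> nat \<Rightarrow> ('v set \<Rightarrow> 'w set) \<Rightarrow> ('v set \<Rightarrow> 'w set) \<Rightarrow> bool" where
  "compl_iso k m \<phi> \<psi> \<longleftrightarrow> adj_bij k m \<phi> \<and> adj_bij (n - k) (n - m) \<psi> \<and>
     (\<forall>S\<in>V.Gr k. \<forall>U\<in>V.Gr (n - k). S \<inter> U = {0} \<longleftrightarrow> \<phi> S \<inter> \<psi> U = {0})"

definition linear_on :: "nat \<Rightarrow> ('v set \<Rightarrow> 'w set) \<Rightarrow> ('v set \<Rightarrow> 'w set) \<Rightarrow> bool" where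
  "linear_on k \<phi> \<psi> \<longleftrightarrow> (\<exists>l. semilinear_bij s1 s2 l \<and>
     (\<forall>S\<in>V.Gr k. \<phi> S = l ` S) \<and> (\<forall>U\<in>V.Gr (n - k). \<psi> U = l ` U))"

lemma compl_iso_swap:
  assumes "compl_iso k m \<phi> \<psi>" "k \<le> n" "m \<le> n"
  shows "compl_iso (n - k) (n - m) \<psi> \<phi>"
proof -
  have "S \<inter> U = {0} \<longleftrightarrow> \<psi> S \<inter> \<phi> U = {0}" if "S \<in> V.Gr (n - k)" "U \<in> V.Gr k" for S U
    using assms(1) that unfolding compl_iso_def Int_commute[of S U] Int_commute[of "\<psi> S" "\<phi> U"] by blast
  then show ?thesis using assms by (simp add: compl_iso_def)
qed

lemma linear_on_swap: "linear_on k \<phi> \<psi> \<Longrightarrow> k \<le> n \<Longrightarrow> linear_on (n - k) \<psi> \<phi>"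
  by (auto simp: linear_on_def)

text \<open>
  The complements of \<open>\<psi> U\<close> are the images of the complements of \<open>U\<close> under \<open>\<phi>\<close>, hence under \<open>l\<close>, and these are the
  complements of \<open>l ` U\<close>.
\<close>

lemma compl_iso_linear:
  assumes c: "compl_iso k k \<phi> \<psi>" and k: "k \<le> n"
    and ex: "\<exists>l. semilinear_bij s1 s2 l \<and> (\<forall>S\<in>V.Gr k. \<phi> S = l ` S)"
  shows "linear_on k \<phi> \<psi>"
proof -
  from ex obtain l where "semilinear_bij s1 s2 l \<and> (\<forall>S\<in>V.Gr k. \<phi> S = l ` S)" ..
  then have l: "semilinear_bij s1 s2 l" "\<And>S. S \<in> V.Gr k \<Longrightarrow> \<phi> S = l ` S" by simp_all
  have inj: "inj l" and l0: "l 0 = 0"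
  proof -
    have "l (0 + 0) = l 0 + l 0" using l(1) unfolding semilinear_bij_def by blast
    then show "l 0 = 0" by simp
    show "inj l" using l(1) by (simp add: semilinear_bij_def bij_def)
  qed
  have \<phi>: "bij_betw \<phi> (V.Gr k) (W.Gr k)" and \<psi>: "bij_betw \<psi> (V.Gr (n - k)) (W.Gr (n - k))"
    and compl: "\<And>S U. S \<in> V.Gr k \<Longrightarrow> U \<in> V.Gr (n - k) \<Longrightarrow> S \<inter> U = {0} \<longleftrightarrow> \<phi> S \<inter> \<psi> U = {0}"
    using c by (auto simp: compl_iso_def adj_bij_def)
  have "\<psi> U = l ` U" if U: "U \<in> V.Gr (n - k)" for U
  proof (rule W.complements_determine[OF _ semilinear_image_Gr[OF l(1) U] k])
    show "\<psi> U \<in> W.Gr (n - k)" using \<psi> U by (auto simp: bij_betw_def)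
    fix S' assume S': "S' \<in> W.Gr k" "S' \<inter> \<psi> U = {0}"
    then obtain S where S: "S \<in> V.Gr k" "S' = \<phi> S" using \<phi> unfolding bij_betw_def by blast
    then have "S \<inter> U = {0}" using compl U S' by blast
    then have "l ` S \<inter> l ` U = {0}" using image_Int[OF inj, of S U] l0 by simp
    then show "S' \<inter> l ` U = {0}" using S l(2) by simp
  qed
  then show ?thesis using l by (auto simp: linear_on_def)
qed

lemma compl_iso_points:
  assumes c: "compl_iso 1 1 \<phi> \<psi>" and n: "2 < n"
  shows "linear_on 1 \<phi> \<psi>"
proof (rule compl_iso_linear[OF c])
  have \<phi>: "bij_betw \<phi> (V.Gr 1) (W.Gr 1)" and \<psi>: "bij_betw \<psi> (V.Gr (n - 1)) (W.Gr (n - 1))"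
    and compl: "\<And>S U. S \<in> V.Gr 1 \<Longrightarrow> U \<in> V.Gr (n - 1) \<Longrightarrow> S \<inter> U = {0} \<longleftrightarrow> \<phi> S \<inter> \<psi> U = {0}"
    using c by (auto simp: compl_iso_def adj_bij_def)
  have "P \<subseteq> H \<longleftrightarrow> \<phi> P \<subseteq> \<psi> H" if P: "P \<in> V.Gr 1" and H: "H \<in> V.Gr (n - 1)" for P H
  proof -
    have "\<phi> P \<in> W.Gr 1" "\<psi> H \<in> W.Gr (n - 1)" using \<phi> \<psi> P H by (auto simp: bij_betw_def)
    then show ?thesis using V.point_Int_0_iff[OF P, of H] W.point_Int_0_iff[of "\<phi> P" "\<psi> H"] compl[OF P H] H
      by (simp add: V.Gr_iff W.Gr_iff)
  qed
  then show "\<exists>l. semilinear_bij s1 s2 l \<and> (\<forall>S\<in>V.Gr 1. \<phi> S = l ` S)"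
    using linear_from_points[OF \<phi> \<psi>] n by simp
qed (use n in simp)

lemma compl_iso_hyperplanes:
  assumes c: "compl_iso (n - 1) (n - 1) \<phi> \<psi>" and n: "2 < n"
  shows "linear_on (n - 1) \<phi> \<psi>"
proof -
  have "compl_iso 1 1 \<psi> \<phi>" using compl_iso_swap[OF c] n by simp
  from linear_on_swap[OF compl_iso_points[OF this n]] n show ?thesis by simp
qed

lemma compl_iso_tops:
  assumes c: "compl_iso k m \<phi> \<psi>" and n: "1 < k" "Suc k < n" "1 < m" "Suc m < n"
    and T: "\<And>C. C \<in> V.Gr (Suc k) \<Longrightarrow> top_to_top k m \<phi> C"
  shows "m = k \<and> linear_on k \<phi> \<psi>"
proof -
  obtain k' m' where km: "k = Suc k'" "m = Suc m'" using n by (metis less_imp_Suc_add)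
  have "adj_bij (Suc k') (Suc m') \<phi>" using c km by (simp add: compl_iso_def)
  from chow_linear[OF this] n T km
  have "m' = k' \<and> (\<exists>l. semilinear_bij s1 s2 l \<and> (\<forall>S\<in>V.Gr (Suc k'). \<phi> S = l ` S))" by simp
  then show ?thesis using compl_iso_linear[of k \<phi> \<psi>] c km n by simp
qed

end

lemma (in orthogonality) compl_iso_perp:
  assumes c: "two_spaces.compl_iso s1 s1 n k m \<phi> \<psi>" and m: "m \<le> n"
  shows "two_spaces.compl_iso s1 s2 n k (n - m) (perp R \<circ> \<phi>) (perp R \<circ> \<psi>)"
proof -
  interpret VV: two_spaces s1 s1 n by unfold_locales
  interpret VW: two_spaces s1 s2 n by unfold_locales
  have adj: "VW.adj_bij i (n - j) (perp R \<circ> \<theta>)" if a: "VV.adj_bij i j \<theta>" and j: "j \<le> n" for i j \<theta>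
  proof -
    have "\<theta> X \<in> V.Gr j" if "X \<in> V.Gr i" for X using VV.adj_bij_mem[OF a that] .
    then show ?thesis
      using a bij_betw_trans[OF _ bij_perp[OF j], of \<theta>] adj_perp_iff[of _ j]
      unfolding VV.adj_bij_def VW.adj_bij_def by simp
  qed
  have a: "VV.adj_bij k m \<phi>" "VV.adj_bij (n - k) (n - m) \<psi>"
    using c by (simp_all add: VV.compl_iso_def)
  have "perp R (\<phi> S) \<inter> perp R (\<psi> U) = {0} \<longleftrightarrow> \<phi> S \<inter> \<psi> U = {0}"
    if "S \<in> V.Gr k" "U \<in> V.Gr (n - k)" for S U
  proof -
    have "\<phi> S \<in> V.Gr m" "\<psi> U \<in> V.Gr (n - m)"
      using VV.adj_bij_mem[OF a(1) that(1)] VV.adj_bij_mem[OF a(2) that(2)] .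
    from perp_Int_0_iff[OF this m] show ?thesis .
  qed
  then show ?thesis
    using c adj[of k m \<phi>] adj[of "n - k" "n - m" \<psi>] m
    unfolding VV.compl_iso_def VW.compl_iso_def by simp
qed

lemma (in orthogonality) top_to_star_perp:
  assumes "two_spaces.top_to_star s1 s1 k m \<phi> C" "two_spaces.adj_bij s1 s1 k m \<phi>" "0 < m" "m \<le> n"
  shows "two_spaces.top_to_top s1 s2 k (n - m) (perp R \<circ> \<phi>) C"
proof -
  interpret VV: two_spaces s1 s1 n by unfold_locales
  interpret VW: two_spaces s1 s2 n by unfold_locales
  obtain D where D: "D \<in> V.Gr (m - 1)" "\<And>X. X \<in> V.Gr k \<Longrightarrow> X \<subseteq> C \<longleftrightarrow> D \<subseteq> \<phi> X"
    using assms(1) by (auto simp: VV.top_to_star_def)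
  have "\<phi> X \<in> V.Gr m" if "X \<in> V.Gr k" for X using VV.adj_bij_mem[OF assms(2) that] .
  then have "X \<subseteq> C \<longleftrightarrow> perp R (\<phi> X) \<subseteq> perp R D" if "X \<in> V.Gr k" for X
    using D perp_subset_iff[of "\<phi> X" D] that by (simp add: V.Gr_iff)
  moreover have "perp R D \<in> W.Gr (Suc (n - m))" using perp_Gr[OF D(1)] assms(3,4) by (simp add: Suc_diff_le)
  ultimately show ?thesis unfolding VW.top_to_top_def comp_def by blast
qed

text \<open>
  Either the pair itself or its composition with the orthogonal is of a kind treated above: for points
  and hyperplanes the value of \<open>m\<close> decides, otherwise the behaviour of the tops.
\<close>

lemma (in orthogonality) compl_iso_cases:
  assumes c: "two_spaces.compl_iso s1 s1 n k m \<phi> \<psi>" and n: "2 < n" "0 < k" "k < n" and m: "m = k \<or> m = n - k"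
  shows "m = k \<and> two_spaces.linear_on s1 s1 n k \<phi> \<psi> \<or>
    m = n - k \<and> two_spaces.linear_on s1 s2 n k (perp R \<circ> \<phi>) (perp R \<circ> \<psi>)"
proof -
  interpret VV: two_spaces s1 s1 n by unfold_locales
  interpret VW: two_spaces s1 s2 n by unfold_locales
  have mn: "0 < m" "m < n" using m n by auto
  have c': "VW.compl_iso k (n - m) (perp R \<circ> \<phi>) (perp R \<circ> \<psi>)" using compl_iso_perp[OF c] mn by simp
  consider "k = 1" | "k = n - 1" | "1 < k" "Suc k < n" using n by linarith
  then show ?thesis
  proof cases
    case 1
    show ?thesis
    proof (cases "m = k")
      case True
      then show ?thesis using VV.compl_iso_points[of \<phi> \<psi>] c n 1 by simp
    next
      case False
      then have "n - m = 1" using m n 1 by simp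
      then show ?thesis using VW.compl_iso_points[of "perp R \<circ> \<phi>" "perp R \<circ> \<psi>"] c' n 1 m False by simp
    qed
  next
    case 2
    show ?thesis
    proof (cases "m = k")
      case True
      then show ?thesis using VV.compl_iso_hyperplanes[of \<phi> \<psi>] c n 2 by simp
    next
      case False
      then have "n - m = n - 1" using m n 2 by simp
      then show ?thesis using VW.compl_iso_hyperplanes[of "perp R \<circ> \<phi>" "perp R \<circ> \<psi>"] c' n 2 m False by simp
    qed
  next
    case 3
    have m': "1 < m" "Suc m < n" using m 3 by auto
    obtain k' m0 where km: "k = Suc k'" "m = Suc m0" using 3 m' by (metis less_imp_Suc_add)
    have adj: "VV.adj_bij k m \<phi>" using c by (simp add: VV.compl_iso_def)
    have "(\<forall>C\<in>V.Gr (Suc k). VV.top_to_top k m \<phi> C) \<or> (\<forall>C\<in>V.Gr (Suc k). VV.top_to_star k m \<phi> C)"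
      using VV.chow_dichotomy[of k' m0 \<phi>] adj km 3 by simp
    then show ?thesis
    proof
      assume "\<forall>C\<in>V.Gr (Suc k). VV.top_to_top k m \<phi> C"
      then show ?thesis using VV.compl_iso_tops[OF c 3 m'] by blast
    next
      assume S: "\<forall>C\<in>V.Gr (Suc k). VV.top_to_star k m \<phi> C"
      have nm: "1 < n - m" "Suc (n - m) < n" using m' by auto
      have "VW.top_to_top k (n - m) (perp R \<circ> \<phi>) C" if "C \<in> V.Gr (Suc k)" for C
        using top_to_star_perp[OF _ adj] S that mn by simp
      from VW.compl_iso_tops[OF c' 3 nm this] show ?thesis using mn by auto
    qed
  qed
qed

context fin_dim_space begin

lemma semilinear_iso_if: "semilinear_bij scale scale l \<Longrightarrow> semilinear_iso scale l"
  unfolding semilinear_bij_def semilinear_iso_def ring_automorphism_def by blast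

text \<open>
  A semilinear map \<open>l\<close> into the coordinate model of the dual becomes the map \<open>s\<close> into the dual that sends \<open>x\<close> to
  the functional \<open>\<lambda>v. \<beta> v (l x)\<close>; taking the orthogonal once more recovers \<open>\<phi>\<close> and \<open>\<psi>\<close>.
\<close>

theorem complementarity_isomorphisms:
  assumes c: "two_spaces.compl_iso scale scale n k m \<phi> \<psi>" and n: "2 < n" "0 < k" "k < n"
    and m: "m = k \<or> m = n - k"
  shows "m = k \<and> (\<exists>l. semilinear_iso scale l \<and> (\<forall>S\<in>Gr k. \<phi> S = G_map l S) \<and> (\<forall>U\<in>Gr (n - k). \<psi> U = G_map l U)) \<or>
    m = n - k \<and> (\<exists>s. semilinear_iso_dual scale s \<and> (\<forall>S\<in>Gr k. \<phi> S = D_map s S) \<and> (\<forall>U\<in>Gr (n - k). \<psi> U = D_map s U))"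
proof -
  interpret VV: two_spaces scale scale n by unfold_locales
  obtain s2 :: "'k opp \<Rightarrow> 'v \<Rightarrow> 'v" and \<beta> where
    orth: "orthogonality scale s2 n (\<lambda>v w. \<beta> v w = 0)" and
    \<beta>: "\<And>v v' w. \<beta> (v + v') w = \<beta> v w + \<beta> v' w" "\<And>a v w. \<beta> (scale a v) w = a * \<beta> v w"
      "\<And>v w w'. \<beta> v (w + w') = \<beta> v w + \<beta> v w'" "\<And>x v w. \<beta> v (s2 x w) = \<beta> v w * the_opp x"
    and onto: "\<And>\<phi>. \<phi> \<in> dual_space scale \<Longrightarrow> \<exists>w. \<phi> = (\<lambda>v. \<beta> v w)"
    using dual_exists by blast
  interpret O: orthogonality scale s2 n "\<lambda>v w. \<beta> v w = 0" by (rule orth)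
  interpret VW: two_spaces scale s2 n by unfold_locales
  have a: "VV.adj_bij k m \<phi>" "VV.adj_bij (n - k) (n - m) \<psi>"
    using c by (simp_all add: VV.compl_iso_def)
  note \<phi>G = VV.adj_bij_mem[OF a(1)] and \<psi>G = VV.adj_bij_mem[OF a(2)]
  let ?R = "\<lambda>v w. \<beta> v w = 0"
  from O.compl_iso_cases[OF c n m] show ?thesis
  proof
    assume *: "m = k \<and> VV.linear_on k \<phi> \<psi>"
    from conjunct2[OF *, unfolded VV.linear_on_def] obtain l where
      "semilinear_bij scale scale l \<and> (\<forall>S\<in>Gr k. \<phi> S = l ` S) \<and> (\<forall>U\<in>Gr (n - k). \<psi> U = l ` U)" ..
    then have "semilinear_iso scale l \<and> (\<forall>S\<in>Gr k. \<phi> S = G_map l S) \<and> (\<forall>U\<in>Gr (n - k). \<psi> U = G_map l U)"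
      using semilinear_iso_if by (simp add: G_map_def)
    with * show ?thesis by (intro disjI1 conjI exI[of _ l]) simp_all
  next
    assume *: "m = n - k \<and> VW.linear_on k (perp ?R \<circ> \<phi>) (perp ?R \<circ> \<psi>)"
    then have "\<exists>l. semilinear_bij scale s2 l \<and> (\<forall>S\<in>Gr k. perp ?R (\<phi> S) = l ` S) \<and>
        (\<forall>U\<in>Gr (n - k). perp ?R (\<psi> U) = l ` U)" unfolding VW.linear_on_def comp_def by (rule conjunct2)
    then obtain l where "semilinear_bij scale s2 l \<and> (\<forall>S\<in>Gr k. perp ?R (\<phi> S) = l ` S) \<and>
        (\<forall>U\<in>Gr (n - k). perp ?R (\<psi> U) = l ` U)" ..
    then have l: "semilinear_bij scale s2 l" "\<And>S. S \<in> Gr k \<Longrightarrow> perp ?R (\<phi> S) = l ` S"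
      "\<And>U. U \<in> Gr (n - k) \<Longrightarrow> perp ?R (\<psi> U) = l ` U" by simp_all
    then obtain \<sigma> where bij: "bij l" and add: "\<And>x y. l (x + y) = l x + l y"
      and \<sigma>: "bij \<sigma>" "\<sigma> 1 = 1" "\<And>a b. \<sigma> (a + b) = \<sigma> a + \<sigma> b" "\<And>a b. \<sigma> (a * b) = \<sigma> a * \<sigma> b"
      and semi: "\<And>a x. l (scale a x) = s2 (\<sigma> a) (l x)"
      unfolding semilinear_bij_def by blast
    \<comment> \<open>the functional that belongs to the vector \<open>l x\<close>\<close>
    define s where "s = (\<lambda>x v. \<beta> v (l x))"
    have D: "D_map s S = perp (\<lambda>w v. ?R v w) (l ` S)" for S
      by (auto simp: D_map_def annihilator_def perp_def s_def)
    have inj: "inj s"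
    proof (rule injI)
      fix x y assume "s x = s y"
      then have eq: "\<beta> v (l x) = \<beta> v (l y)" for v unfolding s_def by metis
      have "\<beta> v (l x - l y) = 0" for v using \<beta>(3)[of v "l x - l y" "l y"] eq[of v] by simp
      then have "l x - l y = 0" by (rule O.nondegenerate_right)
      then show "x = y" using bij by (simp add: bij_def inj_eq)
    qed
    have "range s = dual_space scale"
    proof
      show "range s \<subseteq> dual_space scale" by (auto simp: s_def dual_space_def \<beta>)
      show "dual_space scale \<subseteq> range s"
      proof
        fix \<theta> assume "\<theta> \<in> dual_space scale"
        then obtain w where w: "\<theta> = (\<lambda>v. \<beta> v w)" using onto by blast
        obtain x where "w = l x" using bij by (metis bij_pointE)
        then show "\<theta> \<in> range s" using w by (auto simp: s_def)
      qed
    qed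
    moreover have "ring_antiautomorphism (the_opp \<circ> \<sigma>)"
    proof -
      have "bij (the_opp :: 'k opp \<Rightarrow> 'k)"
        by (rule bij_betw_byWitness[where f' = Opp]) auto
      then show ?thesis using \<sigma> bij_comp by (auto simp: ring_antiautomorphism_def)
    qed
    moreover have "s (scale a x) = (\<lambda>w. s x w * (the_opp \<circ> \<sigma>) a)" for a x
      by (simp add: s_def semi \<beta>)
    moreover have "s (x + y) = (\<lambda>w. s x w + s y w)" for x y
      by (simp add: s_def add \<beta>)
    ultimately have "semilinear_iso_dual scale s"
      unfolding semilinear_iso_dual_def bij_betw_def using inj by blast
    moreover have "\<phi> S = D_map s S" if "S \<in> Gr k" for S
    proof -
      have "sub (\<phi> S)" using \<phi>G[OF that] by (simp add: Gr_iff)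
      then show ?thesis using O.perp_perp[of "\<phi> S"] l(2)[OF that] by (simp add: D)
    qed
    moreover have "\<psi> U = D_map s U" if "U \<in> Gr (n - k)" for U
    proof -
      have "sub (\<psi> U)" using \<psi>G[OF that] by (simp add: Gr_iff)
      then show ?thesis using O.perp_perp[of "\<psi> U"] l(3)[OF that] by (simp add: D)
    qed
    ultimately show ?thesis using * by (intro disjI2 conjI exI[of _ s]) simp_all
  qed
qed

text \<open>
  In a plane, points are complementary if and only if they are distinct.
\<close>

lemma compl_iso_plane:
  assumes "two_spaces.compl_iso scale scale n 1 1 \<phi> \<psi>" and n: "n = 2" and S: "S \<in> Gr 1"
  shows "\<phi> S = \<psi> S"
proof -
  interpret VV: two_spaces scale scale n by unfold_locales
  have n1: "n - 1 = 1" using n by simp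
  note c = assms(1)[unfolded VV.compl_iso_def n1]
  have compl: "S \<inter> S = {0} \<longleftrightarrow> \<phi> S \<inter> \<psi> S = {0}"
    by (rule c[THEN conjunct2, THEN conjunct2, rule_format, OF S S])
  have eq: "P \<inter> Q = {0} \<longleftrightarrow> P \<noteq> Q" if "P \<in> Gr 1" "Q \<in> Gr 1" for P Q
  proof -
    have "P \<subseteq> Q \<longleftrightarrow> P = Q" using Gr_eqI[OF that] by blast
    then show ?thesis using point_Int_0_iff[OF that(1), of Q] that(2) by (simp add: Gr_iff)
  qed
  have "\<phi> S \<in> Gr 1" "\<psi> S \<in> Gr 1" using VV.adj_bij_mem[OF _ S] c by blast+
  then show ?thesis using compl eq[OF S S] eq[of "\<phi> S" "\<psi> S"] by simp
qed

end

lemma preserving_transformation_iff: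
  assumes "bij_betw f A A" "\<And>x y. x \<in> A \<Longrightarrow> y \<in> A \<Longrightarrow> R x y \<longleftrightarrow> R (f x) (f y)"
  shows "preserving_transformation R A f"
proof -
  have "inv_into A f x \<in> A \<and> f (inv_into A f x) = x" if "x \<in> A" for x
    using assms(1) that by (auto simp: bij_betw_def inv_into_into f_inv_into_f)
  then show ?thesis using assms by (simp add: preserving_transformation_def)
qed

lemma preserving_transformationD:
  assumes "preserving_transformation R A f" "x \<in> A" "y \<in> A"
  shows "R x y \<longleftrightarrow> R (f x) (f y)"
proof -
  have f: "bij_betw f A A" and 1: "R x y \<Longrightarrow> R (f x) (f y)"
    and 2: "\<And>x y. x \<in> A \<Longrightarrow> y \<in> A \<Longrightarrow> R x y \<Longrightarrow> R (inv_into A f x) (inv_into A f y)"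
    using assms by (auto simp: preserving_transformation_def)
  have "inv_into A f (f z) = z" "f z \<in> A" if "z \<in> A" for z
    using f that by (auto simp: bij_betw_def)
  then show ?thesis using 1 2[of "f x" "f y"] assms by auto
qed

text \<open>
  Closeness only compares the components, so injectivity of the component maps suffices.
\<close>

lemma close_preserving:
  assumes f: "bij_betw f C C" and inj: "inj_on \<phi> (fst ` C)" "inj_on \<psi> (snd ` C)"
    and prod: "(\<forall>p\<in>C. f p = map_prod \<phi> \<psi> p) \<or> (\<forall>p\<in>C. f p = twisted_prod \<phi> \<psi> p)"
  shows "preserving_transformation close_pairs C f"
proof (rule preserving_transformation_iff[OF f])
  fix p q assume pq: "p \<in> C" "q \<in> C"
  have 1: "fst p = fst q \<longleftrightarrow> \<phi> (fst p) = \<phi> (fst q)" using inj(1) pq by (auto simp: inj_on_eq_iff)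
  have 2: "snd p = snd q \<longleftrightarrow> \<psi> (snd p) = \<psi> (snd q)" using inj(2) pq by (auto simp: inj_on_eq_iff)
  from prod show "close_pairs p q \<longleftrightarrow> close_pairs (f p) (f q)"
  proof
    assume "\<forall>p\<in>C. f p = map_prod \<phi> \<psi> p"
    then show ?thesis using pq 1 2 by (simp add: close_pairs_def case_prod_beta)
  next
    assume "\<forall>p\<in>C. f p = twisted_prod \<phi> \<psi> p"
    then show ?thesis using pq 1 2 by (auto simp: close_pairs_def twisted_prod_def case_prod_beta)
  qed
qed

theorem theorem2:
  fixes scale :: "'k::division_ring \<Rightarrow> 'v::ab_group_add \<Rightarrow> 'v"
    and n k :: nat
    and f :: "'v set \<times> 'v set \<Rightarrow> 'v set \<times> 'v set"
  defines "\<G> \<equiv> complementary_pairs scale n k"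
  assumes "left_vector_space scale"
    and "has_dim scale UNIV n"
    and "2 \<le> n"
    and "k \<in> {1..n - 1}"
    and "preserving_transformation (adjacent_pairs scale) \<G> f"
  shows
    "((\<exists>l. semilinear_iso scale l \<and> (\<forall>X\<in>\<G>. f X = map_prod (G_map l) (G_map l) X)) \<or>
      (\<exists>s. semilinear_iso_dual scale s \<and> (\<forall>X\<in>\<G>. f X = twisted_prod (D_map s) (D_map s) X)) \<or>
      (n = 2 * k \<and>
        ((\<exists>l. semilinear_iso scale l \<and> (\<forall>X\<in>\<G>. f X = twisted_prod (G_map l) (G_map l) X)) \<or>
         (\<exists>s. semilinear_iso_dual scale s \<and> (\<forall>X\<in>\<G>. f X = map_prod (D_map s) (D_map s) X)))) \<or>
      (n = 2 \<and> k = 1 \<and>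
        (\<exists>h. bij_betw h (grassmannian scale 1) (grassmannian scale 1) \<and>
             ((\<forall>X\<in>\<G>. f X = map_prod h h X) \<or> (\<forall>X\<in>\<G>. f X = twisted_prod h h X))))) \<and>
     preserving_transformation close_pairs \<G> f"
proof -
  interpret V: left_vector_space scale by fact
  interpret V: fin_dim_space scale n by unfold_locales fact
  interpret VV: two_spaces scale scale n by unfold_locales
  have k: "0 < k" "k < n" "k \<le> n" using assms(4,5) by auto
  have grid: "linked_grid \<G> V.adj V.adj" unfolding \<G>_def by (rule V.linked_grid_complementary_pairs[OF k(1,2)])
  have bij: "bij_betw f \<G> \<G>" using assms(6) by (simp add: preserving_transformation_def)
  have edge: "edge V.adj V.adj p q \<longleftrightarrow> adjacent_pairs scale p q" for p q
    by (auto simp: edge_def adjacent_pairs_def case_prod_beta)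
  have iso: "grid_iso \<G> V.adj V.adj \<G> V.adj V.adj f"
    using bij preserving_transformationD[OF assms(6)] by (auto simp: grid_iso_def edge)
  have fstG: "fst ` \<G> = V.Gr k" and sndG: "snd ` \<G> = V.Gr (n - k)"
    unfolding \<G>_def by (rule V.complementary_pairs_fst V.complementary_pairs_snd; rule k)+
  have swapG: "prod.swap ` \<G> = complementary_pairs scale n (n - k)"
    unfolding \<G>_def by (rule V.complementary_pairs_swap[OF k(3)])
  have mem: "(S, U) \<in> \<G> \<longleftrightarrow> S \<in> V.Gr k \<and> U \<in> V.Gr (n - k) \<and> S \<inter> U = {0}" for S U
    unfolding \<G>_def by (rule V.complementary_pairs_iff[OF k(3)])
  have mem': "(U, S) \<in> prod.swap ` \<G> \<longleftrightarrow> U \<in> V.Gr (n - k) \<and> S \<in> V.Gr k \<and> U \<inter> S = {0}" for S U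
    unfolding swapG using V.complementary_pairs_iff[of "n - k" U S] k by simp
  have eq_prod: "\<forall>X\<in>\<G>. f X = map_prod \<phi>' \<psi>' X"
    if "\<forall>X\<in>\<G>. f X = map_prod \<phi> \<psi> X" "\<forall>S\<in>V.Gr k. \<phi> S = \<phi>' S" "\<forall>U\<in>V.Gr (n - k). \<psi> U = \<psi>' U" for \<phi> \<psi> \<phi>' \<psi>'
    using that mem by (auto simp: map_prod_def)
  have eq_twisted: "\<forall>X\<in>\<G>. f X = twisted_prod \<phi>' \<psi>' X"
    if "\<forall>X\<in>\<G>. f X = twisted_prod \<phi> \<psi> X" "\<forall>S\<in>V.Gr k. \<phi> S = \<phi>' S" "\<forall>U\<in>V.Gr (n - k). \<psi> U = \<psi>' U" for \<phi> \<psi> \<phi>' \<psi>'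
    using that mem by (auto simp: twisted_prod_def)
  from grid iso show ?thesis
  proof (rule grid_iso_cases[OF grid])
    fix \<phi> \<psi>
    assume p: "product_iso \<G> V.adj V.adj \<G> V.adj V.adj \<phi> \<psi>" and f: "\<forall>X\<in>\<G>. f X = map_prod \<phi> \<psi> X"
    have bijs: "bij_betw \<phi> (V.Gr k) (V.Gr k)" "bij_betw \<psi> (V.Gr (n - k)) (V.Gr (n - k))"
      using p by (simp_all add: product_iso_def fstG sndG)
    have in_Gr: "\<phi> S \<in> V.Gr k" "\<psi> U \<in> V.Gr (n - k)" if "S \<in> V.Gr k" "U \<in> V.Gr (n - k)" for S U
      using bijs that by (auto simp: bij_betw_def)
    have c: "VV.compl_iso k k \<phi> \<psi>"
      using p bijs in_Gr by (simp add: product_iso_def VV.compl_iso_def VV.adj_bij_def fstG sndG mem)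
    have close: "preserving_transformation close_pairs \<G> f"
      using close_preserving[OF bij, of \<phi> \<psi>] bijs f by (simp add: fstG sndG bij_betw_def)
    show ?thesis
    proof (cases "n = 2")
      case True
      then have k1: "k = 1" "n - k = 1" using k by auto
      have "\<forall>X\<in>\<G>. f X = map_prod \<phi> \<phi> X"
        by (rule eq_prod[OF f]) (use V.compl_iso_plane[of \<phi> \<psi>] c k1 True in auto)
      then show ?thesis using bijs k1 True close by blast
    next
      case False
      then have "2 < n" using assms(4) by simp
      from V.complementarity_isomorphisms[OF c this k(1,2) disjI1[OF refl]] show ?thesis
      proof (elim disjE conjE exE)
        fix l assume l: "semilinear_iso scale l" "\<forall>S\<in>V.Gr k. \<phi> S = G_map l S"
          "\<forall>U\<in>V.Gr (n - k). \<psi> U = G_map l U"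
        from eq_prod[OF f l(2,3)] l(1) close show ?thesis by blast
      next
        fix s assume s: "k = n - k" "semilinear_iso_dual scale s" "\<forall>S\<in>V.Gr k. \<phi> S = D_map s S"
          "\<forall>U\<in>V.Gr (n - k). \<psi> U = D_map s U"
        have "n = 2 * k" using s(1) k by simp
        with eq_prod[OF f s(3,4)] s(2) close show ?thesis by blast
      qed
    qed
  next
    fix \<phi> \<psi>
    assume p: "product_iso \<G> V.adj V.adj (prod.swap ` \<G>) V.adj V.adj \<phi> \<psi>"
      and f: "\<forall>X\<in>\<G>. f X = twisted_prod \<phi> \<psi> X"
    have sw: "fst ` prod.swap ` \<G> = V.Gr (n - k)" "snd ` prod.swap ` \<G> = V.Gr k"
      by (simp_all add: image_image fstG sndG)
    have bijs: "bij_betw \<phi> (V.Gr k) (V.Gr (n - k))" "bij_betw \<psi> (V.Gr (n - k)) (V.Gr k)"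
      using p unfolding product_iso_def fstG sndG sw by simp_all
    have in_Gr: "\<phi> S \<in> V.Gr (n - k)" "\<psi> U \<in> V.Gr k" if "S \<in> V.Gr k" "U \<in> V.Gr (n - k)" for S U
      using bijs that by (auto simp: bij_betw_def)
    have nk: "n - (n - k) = k" using k by simp
    have c: "VV.compl_iso k (n - k) \<phi> \<psi>"
      using p bijs in_Gr unfolding product_iso_def VV.compl_iso_def VV.adj_bij_def fstG sndG sw nk mem mem' by simp
    have close: "preserving_transformation close_pairs \<G> f"
      using close_preserving[OF bij, of \<phi> \<psi>] bijs f by (simp add: fstG sndG bij_betw_def)
    show ?thesis
    proof (cases "n = 2")
      case True
      then have k1: "k = 1" "n - k = 1" using k by auto
      have "\<forall>X\<in>\<G>. f X = twisted_prod \<phi> \<phi> X"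
        by (rule eq_twisted[OF f]) (use V.compl_iso_plane[of \<phi> \<psi>] c k1 True in auto)
      then show ?thesis using bijs k1 True close by metis
    next
      case False
      then have "2 < n" using assms(4) by simp
      from V.complementarity_isomorphisms[OF c this k(1,2) disjI2[OF refl]] show ?thesis
      proof (elim disjE conjE exE)
        fix l assume l: "n - k = k" "semilinear_iso scale l" "\<forall>S\<in>V.Gr k. \<phi> S = G_map l S"
          "\<forall>U\<in>V.Gr (n - k). \<psi> U = G_map l U"
        have "n = 2 * k" using l(1) k by simp
        with eq_twisted[OF f l(3,4)] l(2) close show ?thesis by blast
      next
        fix s assume s: "semilinear_iso_dual scale s" "\<forall>S\<in>V.Gr k. \<phi> S = D_map s S"
          "\<forall>U\<in>V.Gr (n - k). \<psi> U = D_map s U"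
        from eq_twisted[OF f s(2,3)] s(1) close show ?thesis by blast
      qed
    qed
  qed
qed

end
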